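(* Let $0 < c_1 < c_2 < \infty$. Let $\mathbf{v} = (\mathbf{v}_1,\mathbf{v}_2):2\mathbb{D} \rightarrow \mathbb{R}^2$ be a smooth vector field satisfying $c_1 < \|\mathbf{v}\| < c_2$ and let $\gamma(t)$ be the flow induced by $\mathbf{v}$ acting on $\gamma(0) = (0,0)$, i.e. the solution of $\dot\gamma(t) = \mathbf{v}(\gamma(t))$ with $\gamma(0) = (0,0)$. Then $$ \inf_{t > 0}{ \left\{ \int_{0}^{t}{\|\gamma'(s)\|ds}: \|\gamma(t)\| = 1\right\}} \leq \pi \frac{c_2}{c_1}+ \frac{1}{ c_1} \int_{\mathbb{D}}{ \left| \operatorname{curl}\mathbf{v}\right|~ dx\, dy} .$$
   Context: $\|\cdot\|$ is the Euclidean norm on $\mathbb{R}^2$; $\mathbb{D}$ is the open unit disk centered at the origin and $2\mathbb{D}$ the disk of radius $2$ centered at the origin. $\operatorname{curl}\mathbf{v} = \frac{\partial \mathbf{v}_2}{\partial x} - \frac{\partial \mathbf{v}_1}{\partial y}$ is the scalar curl. No incompressibility of $\mathbf{v}$ is assumed. The infimum is over times $t>0$ for which the solution $\gamma$ is defined, and the infimum of the empty set is $+\infty$. *)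

theory Defs
  imports "HOL-Analysis.Analysis"
begin

text \<open>\<open>Ck_on S k f\<close>: \<open>f\<close> is of class \<open>C\<^sup>k\<close> on the open set \<open>S\<close>.
  Iterating all directional derivatives \<open>Df(x) h\<close> (rather than the map \<open>x \<mapsto> Df(x)\<close>) keeps the type
  of the function unchanged along the recursion.\<close>

primrec Ck_on ::
  "'a::real_normed_vector set \<Rightarrow> nat \<Rightarrow> ('a \<Rightarrow> 'b::real_normed_vector) \<Rightarrow> bool" where
  "Ck_on S 0 f \<longleftrightarrow> continuous_on S f"
| "Ck_on S (Suc k) f \<longleftrightarrow>
     (\<forall>x\<in>S. f differentiable (at x)) \<and> (\<forall>h. Ck_on S k (\<lambda>x. frechet_derivative f (at x) h))"

definition smooth_on ::
  "'a::real_normed_vector set \<Rightarrow> ('a \<Rightarrow> 'b::real_normed_vector) \<Rightarrow> bool" where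
  "smooth_on S f \<longleftrightarrow> (\<forall>k. Ck_on S k f)"

definition partial_deriv :: "'n \<Rightarrow> (real^'n \<Rightarrow> real) \<Rightarrow> real^'n::finite \<Rightarrow> real" where
  "partial_deriv i f p = deriv (\<lambda>h. f (p + h *\<^sub>R axis i 1)) 0"

definition curl :: "(real^2 \<Rightarrow> real^2) \<Rightarrow> real^2 \<Rightarrow> real" where
  "curl v p = partial_deriv 1 (\<lambda>q. v q $ 2) p - partial_deriv 2 (\<lambda>q. v q $ 1) p"

text \<open>Values of \<open>v\<close> outside \<open>\<Omega>\<close> and of \<open>\<gamma>\<close> outside \<open>J\<close> are irrelevant; since \<open>J\<close> is open,
  the derivative at a point of \<open>J\<close> depends only on \<open>\<gamma>\<close> restricted to \<open>J\<close>.\<close>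

definition integral_curve ::
  "'a::real_normed_vector set \<Rightarrow> ('a \<Rightarrow> 'a) \<Rightarrow> 'a \<Rightarrow> real set \<Rightarrow> (real \<Rightarrow> 'a) \<Rightarrow> bool" where
  "integral_curve \<Omega> v x0 J \<gamma> \<longleftrightarrow>
     open J \<and> is_interval J \<and> 0 \<in> J \<and> \<gamma> 0 = x0 \<and>
     (\<forall>t\<in>J. \<gamma> t \<in> \<Omega> \<and> (\<gamma> has_vector_derivative v (\<gamma> t)) (at t))"

definition maximal_integral_curve ::
  "'a::real_normed_vector set \<Rightarrow> ('a \<Rightarrow> 'a) \<Rightarrow> 'a \<Rightarrow> real set \<Rightarrow> (real \<Rightarrow> 'a) \<Rightarrow> bool" where
  "maximal_integral_curve \<Omega> v x0 J \<gamma> \<longleftrightarrow>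
     integral_curve \<Omega> v x0 J \<gamma> \<and>
     (\<forall>J' \<gamma>'. integral_curve \<Omega> v x0 J' \<gamma>' \<and> J \<subseteq> J' \<and> (\<forall>t\<in>J. \<gamma>' t = \<gamma> t) \<longrightarrow> J' = J)"

end

theory Submission
  imports Defs "HOL-Complex_Analysis.Winding_Numbers"
begin

text \<open>Continue the trajectory through the origin in both directions until it first meets the unit circle,
  and close this chord by the shorter circular arc, of length at most \<open>\<pi>\<close>. Along the chord the
  circulation of \<open>v\<close> is at least \<open>c1\<close> times its length, along the arc it is at most \<open>\<pi> c2\<close>, and
  Green's theorem bounds the total circulation by the integral of the absolute curl, provided that the
  closed curve is simple.

  That the trajectory is injective and leaves the disc does not need the Jordan curve theorem. As \<open>v\<close>
  has no zeros, its direction has a continuous argument \<open>\<theta>\<close> on the disc, and the direction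
  \<open>\<Theta> s t\<close> of the secant of an injective arc has a continuous argument on \<open>s \<le> t\<close> that extends \<open>\<theta>\<close>
  along the diagonal. If the arc on \<open>[a, b]\<close> avoids its own chord, then \<open>\<Theta> a t - \<Theta> t b\<close> is never a
  multiple of \<open>2\<pi>\<close>, and comparing its values at \<open>t = a\<close> and \<open>t = b\<close> shows that the arc cannot return
  close to its starting point without having advanced in the direction of \<open>v\<close>.

  Green's theorem is used with winding numbers: integrate the Cauchy--Pompeiu formula
  \<open>2\<pi> \<phi>(z) = \<integral> (\<phi>\<^sub>x + i \<phi>\<^sub>y)(a) / (z - a) da\<close> along the closed curve and apply Fubini. The winding number
  of a simple closed path has absolute value at most one.\<close>

section \<open>Maximal integral curves\<close>

text \<open>The backward half of the trajectory is what makes simplicity of the closed curve easy: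
  the chord lies in the open disc except for its two ends, while the closing arc lies on the circle.
  A radius closing only the forward half could cross it. The estimate thus concerns the whole chord,
  and the backward half is discarded at the end by positivity. The secant argument takes the place
  of the Poincare-Bendixson theorem: a trajectory trapped in the closed disc would be recurrent, and
  would have to come back against the field. The divergence of \<open>v\<close> never enters. For
  the conjugated field the real part of \<phi>_x + i \<phi>_y is the divergence and the imaginary
  part is minus the curl; multiplying by 2 pi i times an integer and taking real parts keeps only
  the curl. Since only absolute values are bounded, neither the orientation of the curve nor a
  description of its interior is required. Cauchy-Pompeiu wants compact support, but the field lives
  on the disc of radius 2; the room between the radii 1 and 2 is used for a cutoff.\<close>

lemma integral_cmult_bound:
  fixes f :: "real \<Rightarrow> 'a::euclidean_space"
  assumes "continuous_on {0..c} f" "0 \<le> c" "c \<le> \<epsilon>" "\<And>t. t \<in> {0..c} \<Longrightarrow> norm (f t) \<le> B" "0 \<le> B"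
  shows "norm (integral {0..c} f) \<le> B * \<epsilon>"
proof -
  have "norm (integral {0..c} f) \<le> B * (c - 0)"
    using assms by (intro integral_bound) auto
  also have "\<dots> \<le> B * \<epsilon>" using assms by (simp add: mult_left_mono)
  finally show ?thesis .
qed

lemma picard_local_solution:
  fixes v :: "'a::euclidean_space \<Rightarrow> 'a"
  assumes r: "r > 0" and lip: "L-lipschitz_on (cball q r) v"
  obtains \<epsilon> \<eta> where "\<epsilon> > 0" "\<eta> 0 = q" "\<And>t. t \<in> {0..\<epsilon>} \<Longrightarrow> \<eta> t \<in> cball q r"
    "\<And>t. t \<in> {0..\<epsilon>} \<Longrightarrow> (\<eta> has_vector_derivative v (\<eta> t)) (at t within {0..\<epsilon>})"
proof -
  \<comment> \<open>Composing with the projection makes the field globally bounded and Lipschitz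
    with the same constant, so the iteration cannot leave its domain.\<close>
  define P where "P = closest_point (cball q r)"
  define w where "w = (\<lambda>x. v (P x))"
  have L: "L \<ge> 0" using lip lipschitz_on_nonneg by blast
  have P: "P x \<in> cball q r" for x
    unfolding P_def using r by (intro closest_point_in_set) auto
  have lipw: "dist (w x) (w y) \<le> L * dist x y" for x y
  proof -
    have "dist (w x) (w y) \<le> L * dist (P x) (P y)"
      unfolding w_def using lipschitz_onD[OF lip P P] .
    also have "\<dots> \<le> L * dist x y"
      unfolding P_def using r L by (intro mult_left_mono closest_point_lipschitz) auto
    finally show ?thesis .
  qed
  have "L-lipschitz_on UNIV w" using lipw L by (intro lipschitz_onI)
  then have contw: "continuous_on UNIV w" by (rule lipschitz_on_continuous_on)
  define M where "M = norm (v q) + L * r + 1"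
  have M: "M > 0" using L r by (simp add: M_def add_nonneg_pos)
  have wM: "norm (w x) \<le> M" for x
  proof -
    have "dist (v (P x)) (v q) \<le> L * dist (P x) q" using r by (intro lipschitz_onD[OF lip P]) auto
    also have "\<dots> \<le> L * r" using P[of x] L by (intro mult_left_mono) (auto simp: dist_commute)
    finally have "norm (v (P x) - v q) \<le> L * r" by (simp add: dist_norm)
    then show ?thesis using norm_triangle_ineq2[of "v (P x)" "v q"] by (simp add: M_def w_def)
  qed
  \<comment> \<open>The first bound keeps the fixed point inside the ball, where the projection is
    invisible; the second makes the operator a contraction with factor 1 / 2. Adding 1 to
    \<open>L\<close> covers \<open>L = 0\<close>.\<close>
  define \<epsilon> where "\<epsilon> = min (r / M) (1 / (2 * (L + 1)))"
  have \<epsilon>: "\<epsilon> > 0" "M * \<epsilon> \<le> r" "L * \<epsilon> \<le> 1 / 2"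
  proof -
    show "\<epsilon> > 0" using r M L by (simp add: \<epsilon>_def)
    have "M * \<epsilon> \<le> M * (r / M)" using M by (intro mult_left_mono) (auto simp: \<epsilon>_def)
    then show "M * \<epsilon> \<le> r" using M by simp
    have "L * \<epsilon> \<le> L * (1 / (2 * (L + 1)))" using L by (intro mult_left_mono) (auto simp: \<epsilon>_def)
    also have "\<dots> \<le> 1 / 2" using L by (simp add: field_simps)
    finally show "L * \<epsilon> \<le> 1 / 2" .
  qed
  \<comment> \<open>Clamping time to \<open>{0..\<epsilon>}\<close> lets the integral operator act
    on bounded continuous functions on the whole line, which form a complete space.\<close>
  define c where "c = (\<lambda>t::real. max 0 (min \<epsilon> t))"
  have c: "0 \<le> c t" "c t \<le> \<epsilon>" for t using \<epsilon> by (auto simp: c_def)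
  have contwx: "continuous_on S (\<lambda>s. w (apply_bcontfun x s))" for S and x :: "real \<Rightarrow>\<^sub>C 'a"
    by (rule continuous_on_compose2[OF contw]) auto
  define T where "T = (\<lambda>(x::real \<Rightarrow>\<^sub>C 'a) t. q + integral {0..c t} (\<lambda>s. w (apply_bcontfun x s)))"
  have Tb: "T x \<in> bcontfun" for x
  proof (rule bcontfun_normI)
    have "continuous_on {0..\<epsilon>} (\<lambda>u. integral {0..u} (\<lambda>s. w (apply_bcontfun x s)))"
      by (intro indefinite_integral_continuous_1 integrable_continuous_real contwx)
    then have "continuous_on UNIV (\<lambda>t. integral {0..c t} (\<lambda>s. w (apply_bcontfun x s)))"
      by (rule continuous_on_compose2) (use c in \<open>auto simp: c_def intro!: continuous_intros\<close>)
    then show "continuous_on UNIV (T x)" unfolding T_def by (intro continuous_intros)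
    show "norm (T x t) \<le> norm q + M * \<epsilon>" for t
    proof -
      have "norm (integral {0..c t} (\<lambda>s. w (apply_bcontfun x s))) \<le> M * \<epsilon>"
        using c M wM by (intro integral_cmult_bound contwx) auto
      then show ?thesis unfolding T_def by (intro norm_triangle_le) simp
    qed
  qed
  have apT: "apply_bcontfun (Bcontfun (T x)) = T x" for x
    using Tb by (rule Bcontfun_inverse)
  have "\<exists>!x. Bcontfun (T x) = x"
  proof (rule banach_fix_type[of "1 / 2" "\<lambda>x. Bcontfun (T x)"])
    show "\<forall>x y. dist (Bcontfun (T x)) (Bcontfun (T y)) \<le> 1 / 2 * dist x y"
    proof (intro allI dist_bound)
      fix x y :: "real \<Rightarrow>\<^sub>C 'a" and t
      have "T x t - T y t = integral {0..c t} (\<lambda>s. w (apply_bcontfun x s) - w (apply_bcontfun y s))"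
        unfolding T_def by (simp add: integral_diff integrable_continuous_real contwx)
      also have "norm \<dots> \<le> (L * dist x y) * \<epsilon>"
      proof (rule integral_cmult_bound)
        fix s
        have "dist (w (apply_bcontfun x s)) (w (apply_bcontfun y s)) \<le> L * dist (apply_bcontfun x s) (apply_bcontfun y s)"
          by (rule lipw)
        also have "\<dots> \<le> L * dist x y" using L by (intro mult_left_mono dist_bounded)
        finally show "norm (w (apply_bcontfun x s) - w (apply_bcontfun y s)) \<le> L * dist x y"
          by (simp add: dist_norm)
      qed (use c L in \<open>auto intro!: continuous_intros contwx\<close>)
      also have "\<dots> = (L * \<epsilon>) * dist x y" by simp
      also have "\<dots> \<le> 1 / 2 * dist x y" using \<epsilon> by (intro mult_right_mono) auto
      finally show "dist (apply_bcontfun (Bcontfun (T x)) t) (apply_bcontfun (Bcontfun (T y)) t) \<le> 1 / 2 * dist x y"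
        by (simp add: apT dist_norm)
    qed
  qed auto
  then obtain x where fixp: "Bcontfun (T x) = x" by (rule ex1E)
  have "apply_bcontfun x = T x"
    using apT[of x] unfolding fixp .
  define \<eta> where "\<eta> = apply_bcontfun x"
  have \<eta>: "\<eta> t = q + integral {0..c t} (\<lambda>s. w (\<eta> s))" for t
  proof -
    have "\<eta> t = T x t" unfolding \<eta>_def using \<open>apply_bcontfun x = T x\<close> by (rule fun_cong)
    then show ?thesis unfolding T_def \<eta>_def .
  qed
  have near: "\<eta> t \<in> cball q r" for t
  proof -
    have "norm (integral {0..c t} (\<lambda>s. w (\<eta> s))) \<le> M * \<epsilon>"
      unfolding \<eta>_def using c M wM by (intro integral_cmult_bound contwx) auto
    then show ?thesis by (subst \<eta>) (use \<epsilon> in \<open>simp add: dist_norm\<close>)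
  qed
  have wv: "w (\<eta> t) = v (\<eta> t)" for t
    using near by (simp add: w_def P_def closest_point_self)
  show ?thesis
  proof (rule that[OF \<epsilon>(1)])
    have "c 0 = 0" using \<epsilon> by (simp add: c_def)
    then show "\<eta> 0 = q" using \<eta>[of 0] by (simp only: integral_singleton add_0_right atLeastAtMost_singleton)
    fix t assume t: "t \<in> {0..\<epsilon>}"
    show "\<eta> t \<in> cball q r" by (rule near)
    have "((\<lambda>u. integral {0..u} (\<lambda>s. w (\<eta> s))) has_vector_derivative w (\<eta> t)) (at t within {0..\<epsilon>})"
      unfolding \<eta>_def by (rule integral_has_vector_derivative[OF contwx]) (use t in \<open>auto simp: \<eta>_def\<close>)
    then have d1: "((\<lambda>u. q + integral {0..u} (\<lambda>s. w (\<eta> s))) has_vector_derivative w (\<eta> t)) (at t within {0..\<epsilon>})"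
      by (auto intro!: derivative_eq_intros)
    have d2: "\<eta> u = q + integral {0..u} (\<lambda>s. w (\<eta> s))" if "u \<in> {0..\<epsilon>}" for u
    proof -
      have "c u = u" using that by (simp add: c_def)
      then show ?thesis using \<eta>[of u] by (simp only:)
    qed
    have "(\<eta> has_vector_derivative w (\<eta> t)) (at t within {0..\<epsilon>})"
      by (rule has_vector_derivative_transform[OF t d2 d1])
    then show "(\<eta> has_vector_derivative v (\<eta> t)) (at t within {0..\<epsilon>})" by (simp only: wv)
  qed
qed

lemma onorm_scaleR_vector_le:
  fixes c :: "'a::real_normed_vector"
  assumes "norm c \<le> M"
  shows "onorm (\<lambda>h::real. h *\<^sub>R c) \<le> M"
proof (rule onorm_le)
  fix h :: real
  show "norm (h *\<^sub>R c) \<le> M * norm h"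
    using mult_right_mono[OF assms abs_ge_zero[of h]] by (simp add: mult.commute)
qed

lemma has_vector_derivative_shift_within:
  fixes f :: "real \<Rightarrow> 'a::real_normed_vector"
  assumes "(f has_vector_derivative f') (at (t - b) within {0..\<epsilon>})"
  shows "((\<lambda>t. f (t - b)) has_vector_derivative f') (at t within {b..b + \<epsilon>})"
proof -
  have "(\<lambda>t. t - b) ` {b..b + \<epsilon>} = {0..\<epsilon>}" by (auto simp: image_iff intro!: bexI[of _ "_ + b"])
  then have "(f has_vector_derivative f') (at (t - b) within (\<lambda>t. t - b) ` {b..b + \<epsilon>})"
    using assms by simp
  moreover have "((\<lambda>t. t - b) has_vector_derivative 1) (at t within {b..b + \<epsilon>})"
    by (auto intro!: derivative_eq_intros)
  ultimately show ?thesis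
    using vector_diff_chain_within[of "\<lambda>t. t - b" 1 t "{b..b + \<epsilon>}" f f'] by (simp add: o_def)
qed

lemma integral_curve_derivative:
  assumes "integral_curve \<Omega> v x0 J \<gamma>" "t \<in> J"
  shows "\<gamma> t \<in> \<Omega>" "(\<gamma> has_vector_derivative v (\<gamma> t)) (at t within A)"
  using assms unfolding integral_curve_def by (blast intro: has_vector_derivative_at_within)+

text \<open>In integral form the equation persists up to time \<open>b\<close>, which yields the
  one-sided derivative of \<open>g\<close> there. A forward Picard solution started at
  \<open>g b\<close> has the same one-sided derivative, so the glued curve is differentiable at
  \<open>b\<close>.\<close>

lemma integral_curve_extends_at_limit:
  fixes v :: "'a::euclidean_space \<Rightarrow> 'a"
  assumes \<gamma>: "integral_curve \<Omega> v x0 J \<gamma>" and contv: "continuous_on \<Omega> v"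
    and b: "0 < b" "{0..<b} \<subseteq> J" "b \<notin> J"
    and g: "continuous_on {0..b} g" "\<And>t. t \<in> {0..<b} \<Longrightarrow> g t = \<gamma> t" "g b \<in> \<Omega>"
    and r: "r > 0" "cball (g b) r \<subseteq> \<Omega>" "L-lipschitz_on (cball (g b) r) v"
  shows "\<exists>J' \<gamma>'. integral_curve \<Omega> v x0 J' \<gamma>' \<and> J \<subset> J' \<and> (\<forall>t\<in>J. \<gamma>' t = \<gamma> t)"
proof -
  obtain \<epsilon> \<eta> where \<epsilon>: "\<epsilon> > 0" and \<eta>: "\<eta> 0 = g b" "\<And>t. t \<in> {0..\<epsilon>} \<Longrightarrow> \<eta> t \<in> cball (g b) r"
    "\<And>t. t \<in> {0..\<epsilon>} \<Longrightarrow> (\<eta> has_vector_derivative v (\<eta> t)) (at t within {0..\<epsilon>})"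
    using picard_local_solution[OF r(1,3)] by metis
  have J: "open J" "is_interval J" "0 \<in> J" "\<gamma> 0 = x0"
    using \<gamma> by (auto simp: integral_curve_def)
  have Jb: "t < b" if "t \<in> J" for t
    using J(2,3) b that unfolding is_interval_1 by (meson less_imp_le not_le_imp_less)
  have g\<Omega>: "g t \<in> \<Omega>" if "t \<in> {0..b}" for t
    using that g b integral_curve_derivative(1)[OF \<gamma>, of t] by (cases "t = b") (auto simp: subset_eq)
  have contvg: "continuous_on {0..b} (\<lambda>t. v (g t))"
    by (rule continuous_on_compose2[OF contv g(1)]) (use g\<Omega> in auto)
  have derg: "(g has_vector_derivative v (g t)) (at t within {0..b})" if t: "t \<in> {0..b}" for t
  proof -
    have "integral {0..u} (\<lambda>t. v (g t)) = g u - g 0" if u: "u \<in> {0..b}" for u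
    proof (rule integral_unique, rule fundamental_theorem_of_calculus_interior)
      show "continuous_on {0..u} g" using u by (intro continuous_on_subset[OF g(1)]) auto
      fix x assume x: "x \<in> {0<..<u}"
      have "(\<gamma> has_vector_derivative v (\<gamma> x)) (at x)"
        using integral_curve_derivative(2)[OF \<gamma>, where t = x and A = UNIV] b x u by (auto simp: subset_eq)
      then have "(g has_vector_derivative v (\<gamma> x)) (at x)"
        by (rule has_vector_derivative_transform_within_open[where S = "{0<..<b}"])
           (use x u g(2) in auto)
      then show "(g has_vector_derivative v (g x)) (at x)"
        using x u g(2)[of x] by simp
    qed (use u in auto)
    then have "g u = g 0 + integral {0..u} (\<lambda>t. v (g t))" if "u \<in> {0..b}" for u
      using that by simp
    moreover have "((\<lambda>u. g 0 + integral {0..u} (\<lambda>t. v (g t))) has_vector_derivative v (g t)) (at t within {0..b})"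
      by (auto intro!: derivative_eq_intros integral_has_vector_derivative contvg t)
    ultimately show ?thesis by (metis (mono_tags, lifting) has_vector_derivative_transform t)
  qed
  define h where "h = (\<lambda>t. if t \<in> {0..b} then g t else \<eta> (t - b))"
  have derh: "(h has_vector_derivative v (h t)) (at t)" "h t \<in> \<Omega>" if t: "t \<in> {0<..<b + \<epsilon>}" for t
  proof -
    have un: "{0..b} \<union> {b} = {0..b}" "{b..b + \<epsilon>} \<union> {b} = {b..b + \<epsilon>}" "{0..b} \<inter> {b..b + \<epsilon>} = {b}"
      "{0..b + \<epsilon>} = {0..b} \<union> {b..b + \<epsilon>}"
      using b \<epsilon> by auto
    have "(h has_vector_derivative (if t \<in> {0..b} then v (g t) else v (\<eta> (t - b)))) (at t within {0..b + \<epsilon>})"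
      unfolding h_def
    proof (rule has_vector_derivative_If_within_closures[where T = "{b..b + \<epsilon>}"])
      show "((\<lambda>t. \<eta> (t - b)) has_vector_derivative v (\<eta> (t - b)))
         (at t within {b..b + \<epsilon>} \<union> (closure {0..b} \<inter> closure {b..b + \<epsilon>}))"
        if "t \<in> {b..b + \<epsilon>} \<union> (closure {0..b} \<inter> closure {b..b + \<epsilon>})"
        using that unfolding closure_closed[OF closed_atLeastAtMost] un
        by (intro has_vector_derivative_shift_within \<eta>(3)) auto
    qed (use t derg un \<eta>(1) in auto)
    moreover have "(if t \<in> {0..b} then v (g t) else v (\<eta> (t - b))) = v (h t)" by (simp add: h_def)
    ultimately show "(h has_vector_derivative v (h t)) (at t)"
      using t by (simp add: at_within_Icc_at)
    show "h t \<in> \<Omega>" using t g\<Omega> \<eta>(2)[of "t - b"] r(2) by (auto simp: h_def)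
  qed
  define J' where "J' = J \<union> {0<..<b + \<epsilon>}"
  define \<gamma>' where "\<gamma>' = (\<lambda>t. if t \<in> J then \<gamma> t else h t)"
  have \<gamma>'h: "\<gamma>' t = h t" if "t \<in> {0<..<b + \<epsilon>}" for t
    using that Jb[of t] g(2)[of t] by (auto simp: \<gamma>'_def h_def)
  have der': "\<gamma>' t \<in> \<Omega> \<and> (\<gamma>' has_vector_derivative v (\<gamma>' t)) (at t)" if "t \<in> J'" for t
  proof (cases "t \<in> J")
    case True
    have "(\<gamma>' has_vector_derivative v (\<gamma> t)) (at t)"
      using has_vector_derivative_transform_within_open[OF integral_curve_derivative(2)[OF \<gamma> True, where A = UNIV] J(1) True, of \<gamma>']
      by (simp add: \<gamma>'_def)
    then show ?thesis using True integral_curve_derivative(1)[OF \<gamma> True] by (simp add: \<gamma>'_def)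
  next
    case False
    with that have t: "t \<in> {0<..<b + \<epsilon>}" by (simp add: J'_def)
    have "(\<gamma>' has_vector_derivative v (h t)) (at t)"
      using has_vector_derivative_transform_within_open[OF derh(1)[OF t] _ t, of \<gamma>'] \<gamma>'h by auto
    then show ?thesis using derh(2)[OF t] \<gamma>'h[OF t] by simp
  qed
  have "b / 2 \<in> J \<inter> {0<..<b + \<epsilon>}" using b \<epsilon> by auto
  then have "is_interval J'"
    unfolding J'_def is_interval_connected_1 using J(2)
    by (intro connected_Un) (auto simp: is_interval_connected_1)
  moreover have "open J'" using J(1) by (auto simp: J'_def)
  ultimately have "integral_curve \<Omega> v x0 J' \<gamma>'"
    unfolding integral_curve_def using J der' by (auto simp: J'_def \<gamma>'_def)
  moreover have "b \<in> J'" using b \<epsilon> by (simp add: J'_def)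
  ultimately show ?thesis using b by (intro exI[of _ J'] exI[of _ \<gamma>']) (auto simp: J'_def \<gamma>'_def)
qed

text \<open>On \<open>K\<close> the speed is bounded, so a curve with finite end time
  \<open>b\<close> would be Lipschitz up to \<open>b\<close> and have a limit there. The limit lies
  in \<open>K\<close>, hence in \<open>\<Omega>\<close>, and the extension past \<open>b\<close>
  contradicts maximality.\<close>

lemma maximal_integral_curve_trapped_in_compact:
  fixes v :: "'a::euclidean_space \<Rightarrow> 'a"
  assumes \<gamma>: "maximal_integral_curve \<Omega> v x0 J \<gamma>" and contv: "continuous_on \<Omega> v"
    and lip: "\<And>q. q \<in> \<Omega> \<Longrightarrow> \<exists>r>0. \<exists>L. cball q r \<subseteq> \<Omega> \<and> L-lipschitz_on (cball q r) v"
    and K: "compact K" "K \<subseteq> \<Omega>" "\<And>t. t \<in> J \<Longrightarrow> 0 \<le> t \<Longrightarrow> \<gamma> t \<in> K"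
  shows "{0..} \<subseteq> J"
proof (rule ccontr)
  assume "\<not> ?thesis"
  then obtain T where T: "0 \<le> T" "T \<notin> J" by auto
  have ic: "integral_curve \<Omega> v x0 J \<gamma>" using \<gamma> by (simp add: maximal_integral_curve_def)
  then have J: "open J" "is_interval J" "0 \<in> J" by (auto simp: integral_curve_def)
  have JT: "t \<le> T" if "t \<in> J" for t
    using J(2,3) T that unfolding is_interval_1 by (meson linear)
  then have bdd: "bdd_above J" by (auto simp: bdd_above_def)
  define b where "b = Sup J"
  have bJ: "b \<notin> J"
  proof
    assume "b \<in> J"
    then obtain e where "e > 0" "cball b e \<subseteq> J" using J(1) open_contains_cball by blast
    moreover have "b + e \<in> cball b e" using \<open>e > 0\<close> by (simp add: dist_real_def)
    ultimately show False using cSup_upper[OF _ bdd, of "b + e"] by (auto simp: b_def)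
  qed
  have "0 \<le> b" unfolding b_def by (rule cSup_upper[OF J(3) bdd])
  with bJ J(3) have b: "0 < b" by (cases "b = 0") auto
  have sub: "{0..<b} \<subseteq> J"
  proof
    fix x assume x: "x \<in> {0..<b}"
    then obtain y where "y \<in> J" "x < y" using less_cSup_iff[OF _ bdd, of x] J(3) by (auto simp: b_def)
    then show "x \<in> J" using J(2,3) x unfolding is_interval_1 by (meson atLeastLessThan_iff less_imp_le)
  qed
  have "compact (v ` K)" using K contv by (intro compact_continuous_image) (auto elim: continuous_on_subset)
  then obtain M where M: "M > 0" "\<And>z. z \<in> K \<Longrightarrow> norm (v z) \<le> M"
    using compact_imp_bounded[of "v ` K"] unfolding bounded_pos by blast
  have "M-lipschitz_on {0..<b} \<gamma>"
  proof (rule bounded_derivative_imp_lipschitz)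
    fix t assume t: "t \<in> {0..<b}"
    show "(\<gamma> has_derivative (\<lambda>h. h *\<^sub>R v (\<gamma> t))) (at t within {0..<b})"
      using integral_curve_derivative(2)[OF ic, of t] sub t by (auto simp: has_vector_derivative_def)
    show "onorm (\<lambda>h. h *\<^sub>R v (\<gamma> t)) \<le> M"
      using M(2)[OF K(3)[of t]] sub t by (intro onorm_scaleR_vector_le) auto
  qed (use M in auto)
  then have "uniformly_continuous_on {0..<b} \<gamma>" by (rule lipschitz_on_uniformly_continuous)
  then obtain g where g: "uniformly_continuous_on (closure {0..<b}) g" "\<And>t. t \<in> {0..<b} \<Longrightarrow> \<gamma> t = g t"
    using uniformly_continuous_on_extension_on_closure by metis
  then have contg: "continuous_on {0..b} g" using b uniformly_continuous_imp_continuous by fastforce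
  have "g ` closure {0..<b} \<subseteq> K"
  proof (rule image_closure_subset)
    show "g ` {0..<b} \<subseteq> K" using g(2) K(3) sub by force
  qed (use contg b K compact_imp_closed in auto)
  then have gb: "g b \<in> \<Omega>" using K(2) b by (auto simp: image_subset_iff)
  then obtain r L where "r > 0" "cball (g b) r \<subseteq> \<Omega>" "L-lipschitz_on (cball (g b) r) v" using lip by blast
  then obtain J' \<gamma>' where "integral_curve \<Omega> v x0 J' \<gamma>'" "J \<subset> J'" "\<forall>t\<in>J. \<gamma>' t = \<gamma> t"
    using integral_curve_extends_at_limit[OF ic contv b sub bJ contg _ gb] g(2) by metis
  then show False using \<gamma> unfolding maximal_integral_curve_def by blast
qed

section \<open>Time reversal\<close>

lemma integral_curve_reverse:
  assumes "integral_curve \<Omega> v x0 J \<gamma>"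
  shows "integral_curve \<Omega> (\<lambda>x. - v x) x0 (uminus ` J) (\<lambda>t. \<gamma> (- t))"
proof -
  have "((\<lambda>t. \<gamma> (- t)) has_vector_derivative - v (\<gamma> (- t))) (at t)" if "- t \<in> J" for t
  proof -
    have "((\<gamma> \<circ> uminus) has_vector_derivative (- 1) *\<^sub>R v (\<gamma> (- t))) (at t)"
      by (rule vector_diff_chain_at)
         (use integral_curve_derivative(2)[OF assms that] in \<open>auto intro!: derivative_eq_intros\<close>)
    then show ?thesis by (simp add: o_def)
  qed
  moreover have "- t \<in> J" if "t \<in> uminus ` J" for t using that by auto
  moreover have "is_interval (uminus ` J)"
    using assms by (auto simp: integral_curve_def is_interval_connected_1
        intro!: connected_continuous_image continuous_intros)
  moreover have "open (uminus ` J)" "0 \<in> uminus ` J"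
    using assms open_negations by (force simp: integral_curve_def)+
  ultimately show ?thesis
    using assms unfolding integral_curve_def by simp
qed

text \<open>Carries the exit from the disc over to negative times: the backward half of the chord is
  a forward trajectory of \<open>- v\<close>, and maximality must survive the reversal.\<close>

lemma maximal_integral_curve_reverse:
  assumes "maximal_integral_curve \<Omega> v x0 J \<gamma>"
  shows "maximal_integral_curve \<Omega> (\<lambda>x. - v x) x0 (uminus ` J) (\<lambda>t. \<gamma> (- t))"
proof -
  have uniq: "J' = uminus ` J"
    if ic: "integral_curve \<Omega> (\<lambda>x. - v x) x0 J' \<gamma>'" and sub: "uminus ` J \<subseteq> J'"
      and eq: "\<forall>t\<in>uminus ` J. \<gamma>' t = \<gamma> (- t)" for J' \<gamma>'
  proof -
    have "integral_curve \<Omega> v x0 (uminus ` J') (\<lambda>t. \<gamma>' (- t))"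
      using integral_curve_reverse[OF ic] by simp
    moreover have "J \<subseteq> uminus ` J'" using sub by (force simp: image_iff)
    ultimately have "uminus ` J' = J" using assms eq unfolding maximal_integral_curve_def by auto
    then have "uminus ` uminus ` J' = uminus ` J" by simp
    then show ?thesis by (simp add: image_image)
  qed
  have ic: "integral_curve \<Omega> v x0 J \<gamma>" using assms by (simp add: maximal_integral_curve_def)
  show ?thesis
    unfolding maximal_integral_curve_def
  proof (intro conjI allI impI)
    show "integral_curve \<Omega> (\<lambda>x. - v x) x0 (uminus ` J) (\<lambda>t. \<gamma> (- t))"
      by (rule integral_curve_reverse[OF ic])
  qed (elim conjE, rule uniq)
qed

section \<open>Curves with a continuously liftable direction\<close>

text \<open>When \<open>g'\<close> is the derivative of \<open>g\<close>, this is the difference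
  quotient of \<open>g\<close>. Written as an average of \<open>g'\<close> it is continuous across
  the diagonal, where it becomes the tangent.\<close>

definition secant :: "(real \<Rightarrow> 'a::euclidean_space) \<Rightarrow> real \<times> real \<Rightarrow> 'a" where
  "secant g' = (\<lambda>p. integral {0..1} (\<lambda>x. g' (fst p + x * (snd p - fst p))))"

text \<open>A triangle: its diagonal side carries the tangents, its legs the secants from the start
  point and those to the end point. Convexity provides a continuous logarithm on it, compactness a
  loop of least duration.\<close>

definition ordered_pairs :: "real \<Rightarrow> real \<Rightarrow> (real \<times> real) set" where
  "ordered_pairs a b = {p. a \<le> fst p \<and> fst p \<le> snd p \<and> snd p \<le> b}"

lemma segment_param_bounds:
  fixes s t x :: real
  assumes "s \<le> t" "0 \<le> x" "x \<le> 1"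
  shows "s \<le> s + x * (t - s)" "s + x * (t - s) \<le> t"
proof -
  show "s \<le> s + x * (t - s)" using assms by simp
  have "x * (t - s) \<le> 1 * (t - s)" by (rule mult_right_mono) (use assms in auto)
  then show "s + x * (t - s) \<le> t" by simp
qed

lemma continuous_on_secant:
  assumes "continuous_on {a..b} g'"
  shows "continuous_on (ordered_pairs a b) (secant g')"
proof -
  have "continuous_on (ordered_pairs a b \<times> cbox 0 1)
          (\<lambda>(p, x). g' (fst p + x * (snd p - fst p)))"
    unfolding case_prod_beta
  proof (rule continuous_on_compose2[OF assms])
    show "continuous_on (ordered_pairs a b \<times> cbox 0 1)
        (\<lambda>q. fst (fst q) + snd q * (snd (fst q) - fst (fst q)) :: real)"
      by (intro continuous_intros)
    show "(\<lambda>q. fst (fst q) + snd q * (snd (fst q) - fst (fst q)))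
            ` (ordered_pairs a b \<times> cbox 0 1) \<subseteq> {a..b}"
    proof clarify
      fix s t x :: real assume "(s, t) \<in> ordered_pairs a b" "x \<in> cbox 0 1"
      then have "a \<le> s" "s \<le> t" "t \<le> b" "0 \<le> x" "x \<le> 1" by (auto simp: ordered_pairs_def)
      then show "fst (fst ((s, t), x)) + snd ((s, t), x) * (snd (fst ((s, t), x)) - fst (fst ((s, t), x))) \<in> {a..b}"
        unfolding fst_conv snd_conv atLeastAtMost_iff
        using segment_param_bounds[of s t x] by linarith
    qed
  qed
  then have "continuous_on (ordered_pairs a b)
      (\<lambda>p. integral (cbox 0 1) (\<lambda>x. g' (fst p + x * (snd p - fst p))))"
    by (rule integral_continuous_on_param)
  then show ?thesis by (simp add: secant_def)
qed

lemma secant_diagonal [simp]: "secant g' (t, t) = g' t"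
  by (simp add: secant_def)

lemma secant_eq:
  fixes g :: "real \<Rightarrow> 'a::euclidean_space"
  assumes der: "\<And>t. t \<in> {a..b} \<Longrightarrow> (g has_vector_derivative g' t) (at t within {a..b})"
    and st: "a \<le> s" "s \<le> t" "t \<le> b"
  shows "(t - s) *\<^sub>R secant g' (s, t) = g t - g s"
proof -
  let ?p = "\<lambda>x. s + x * (t - s)"
  have "((\<lambda>x. (t - s) *\<^sub>R g' (?p x)) has_integral (g (?p 1) - g (?p 0))) {0..1}"
  proof (rule fundamental_theorem_of_calculus)
    fix x :: real assume x: "x \<in> {0..1}"
    have im: "?p ` {0..1} \<subseteq> {a..b}"
    proof (clarsimp)
      fix y :: real assume "0 \<le> y" "y \<le> 1"
      then show "a \<le> s + y * (t - s) \<and> s + y * (t - s) \<le> b"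
        using segment_param_bounds(1)[of s t y] segment_param_bounds(2)[of s t y] st by linarith
    qed
    have "(?p has_vector_derivative (t - s)) (at x within {0..1})"
      by (auto intro!: derivative_eq_intros simp: has_real_derivative_iff_has_vector_derivative[symmetric])
    moreover have "(g has_vector_derivative g' (?p x)) (at (?p x) within ?p ` {0..1})"
      using der[of "?p x"] im x by (meson has_vector_derivative_within_subset image_subset_iff)
    ultimately have "((g \<circ> ?p) has_vector_derivative (t - s) *\<^sub>R g' (?p x)) (at x within {0..1})"
      by (rule vector_diff_chain_within)
    then show "((\<lambda>x. g (?p x)) has_vector_derivative (t - s) *\<^sub>R g' (?p x)) (at x within {0..1})"
      by (simp add: o_def)
  qed auto
  then show ?thesis
    by (simp add: secant_def integral_unique flip: integral_cmul)
qed

lemma convex_ordered_pairs: "convex (ordered_pairs a b)"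
proof -
  have "ordered_pairs a b = {p. (-1, 0) \<bullet> p \<le> - a} \<inter> {p. (1, -1) \<bullet> p \<le> 0} \<inter> {p. (0, 1) \<bullet> p \<le> b}"
    by (auto simp: ordered_pairs_def)
  then show ?thesis by (auto intro!: convex_Int convex_halfspace_le)
qed

lemma compact_ordered_pairs: "compact (ordered_pairs a b)"
proof -
  have "closed (ordered_pairs a b)"
    unfolding ordered_pairs_def
    by (intro closed_Collect_conj closed_Collect_le continuous_intros)
  moreover have "ordered_pairs a b \<subseteq> cbox (a, a) (b, b)"
    by (force simp: ordered_pairs_def cbox_Pair_eq)
  ultimately show ?thesis
    by (metis compact_cbox compact_Int_closed inf.absorb_iff2)
qed

text \<open>The difference is continuous on an interval with values in the discrete set of multiples
  of 2 pi i. It serves to match the logarithm of the secants on the diagonal with the given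
  logarithm of the tangent.\<close>

lemma exp_logs_differ_by_constant:
  fixes f h :: "real \<Rightarrow> complex"
  assumes "continuous_on {a..b} f" "continuous_on {a..b} h" "a \<le> b"
    and eq: "\<And>t. t \<in> {a..b} \<Longrightarrow> exp (f t) = exp (h t)"
  obtains n :: int where "\<And>t. t \<in> {a..b} \<Longrightarrow> f t = h t + of_int (2 * n) * of_real pi * \<i>"
proof -
  let ?d = "\<lambda>t. f t - h t"
  have ex: "\<exists>n::int. ?d t = of_int (2 * n) * of_real pi * \<i>" if "t \<in> {a..b}" for t
    using eq[OF that] by (auto simp: exp_eq algebra_simps)
  have "?d constant_on {a..b}"
  proof (rule continuous_discrete_range_constant)
    show "continuous_on {a..b} ?d" by (intro continuous_intros assms)
    fix x assume x: "x \<in> {a..b}"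
    show "\<exists>e>0. \<forall>y. y \<in> {a..b} \<and> ?d y \<noteq> ?d x \<longrightarrow> e \<le> norm (?d y - ?d x)"
    proof (intro exI conjI allI impI)
      show "2 * pi > 0" by simp
      fix y assume y: "y \<in> {a..b} \<and> ?d y \<noteq> ?d x"
      obtain m n :: int where mn: "?d x = of_int (2 * m) * of_real pi * \<i>" "?d y = of_int (2 * n) * of_real pi * \<i>"
        using ex x y by metis
      with y have "n \<noteq> m" by auto
      then have "\<bar>real_of_int (n - m)\<bar> \<ge> 1" by linarith
      have "?d y - ?d x = of_real (2 * pi * real_of_int (n - m)) * \<i>"
        unfolding mn by (simp add: algebra_simps)
      then have "norm (?d y - ?d x) = 2 * pi * \<bar>real_of_int (n - m)\<bar>"
        by (simp only: norm_mult norm_of_real norm_ii) (simp add: abs_mult)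
      then show "2 * pi \<le> norm (?d y - ?d x)"
        using \<open>\<bar>real_of_int (n - m)\<bar> \<ge> 1\<close> by simp
    qed
  qed simp
  then obtain c where c: "\<And>t. t \<in> {a..b} \<Longrightarrow> ?d t = c" by (auto simp: constant_on_def)
  obtain n :: int where "?d a = of_int (2 * n) * of_real pi * \<i>" using ex \<open>a \<le> b\<close> by force
  with c \<open>a \<le> b\<close> have "f t = h t + of_int (2 * n) * of_real pi * \<i>" if "t \<in> {a..b}" for t
    using c[OF that] c[of a] by (auto simp: algebra_simps)
  then show ?thesis using that by blast
qed

section \<open>Turning of secants and the advance of injective curves\<close>

lemma IVT_between:
  fixes f :: "real \<Rightarrow> real"
  assumes "continuous_on {a..b} f" "a \<le> b"
    and "f a \<le> y \<and> y \<le> f b \<or> f b \<le> y \<and> y \<le> f a"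
  obtains t where "t \<in> {a..b}" "f t = y"
  using IVT'[of f a y b] IVT2'[of f b y a] assms by (metis atLeastAtMost_iff)

text \<open>The arguments of the secants along the two legs have a difference that starts at
  \<open>Im (l a) - \<alpha> - 2 * pi * m\<close> and ends at
  \<open>\<alpha> - Im (l b) + 2 * pi * m\<close> for some integer \<open>m\<close>. Since
  \<open>m\<close> enters with opposite signs, the window imposed on \<open>l a\<close> and
  \<open>l b\<close> forces a multiple of 2 pi between these values, whatever \<open>m\<close> is.
  When it is attained, both partial secants point the same way and \<open>g t\<close> lies on the
  chord; the window excludes the end times.\<close>

lemma chord_parity:
  fixes g l :: "real \<Rightarrow> complex"
  assumes ab: "a < b"
    and der: "\<And>t. t \<in> {a..b} \<Longrightarrow> (g has_vector_derivative exp (l t)) (at t within {a..b})"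
    and l: "continuous_on {a..b} l"
    and inj: "inj_on g {a..b}"
    and avoid: "\<And>t. t \<in> {a<..<b} \<Longrightarrow> g t \<notin> open_segment (g a) (g b)"
    and r: "r > 0" and chord: "g b - g a = of_real r * cis \<alpha>"
    and la: "\<alpha> - 2 * pi < Im (l a)" "Im (l a) < \<alpha>"
    and lb: "\<alpha> - 2 * pi < Im (l b)" "Im (l b) < \<alpha>"
  shows False
proof -
  define T where "T = ordered_pairs a b"
  define Q where "Q = secant (\<lambda>t. exp (l t))"
  have Tiff: "(s, t) \<in> T \<longleftrightarrow> a \<le> s \<and> s \<le> t \<and> t \<le> b" for s t
    by (simp add: T_def ordered_pairs_def)
  have contQ: "continuous_on T Q"
    unfolding T_def Q_def by (intro continuous_on_secant continuous_intros l)
  have Qeq: "(t - s) *\<^sub>R Q (s, t) = g t - g s" if "(s, t) \<in> T" for s t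
    unfolding Q_def using that by (intro secant_eq[OF der]) (auto simp: Tiff)
  have Q0: "Q p \<noteq> 0" if "p \<in> T" for p
  proof -
    obtain s t where p: "p = (s, t)" by force
    show ?thesis
    proof (cases "s = t")
      case True
      then show ?thesis by (simp add: p Q_def)
    next
      case False
      with that p have "g s \<noteq> g t" using inj by (auto simp: Tiff inj_on_def)
      then show ?thesis using Qeq[of s t] that p by auto
    qed
  qed
  have "contractible T" unfolding T_def by (intro convex_imp_contractible convex_ordered_pairs)
  then obtain L where contL: "continuous_on T L" and L: "\<And>p. p \<in> T \<Longrightarrow> Q p = exp (L p)"
    using continuous_logarithm_on_contractible[OF contQ] Q0 by metis
  have "continuous_on {a..b} (\<lambda>t. L (t, t))"
    by (rule continuous_on_compose2[OF contL]) (auto intro!: continuous_intros simp: Tiff)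
  moreover have expd: "exp (L (t, t)) = exp (l t)" if "t \<in> {a..b}" for t
    using that by (subst L[symmetric]) (auto simp: Tiff Q_def)
  ultimately obtain n :: int where n: "\<And>t. t \<in> {a..b} \<Longrightarrow> L (t, t) = l t + of_int (2 * n) * of_real pi * \<i>"
    using exp_logs_differ_by_constant[OF _ l less_imp_le[OF ab], of "\<lambda>t. L (t, t)"] by blast
  define E where "E = (\<lambda>t. Im (L (a, t) - L (t, b)))"
  have contE: "continuous_on {a..b} E"
    unfolding E_def
    by (intro continuous_intros continuous_on_compose2[OF contL]) (auto simp: Tiff)
  have "of_real (b - a) * exp (L (a, b)) = of_real r * cis \<alpha>"
    using Qeq[of a b] L[of "(a, b)"] ab chord by (simp add: Tiff scaleR_conv_of_real)
  then have expL: "exp (L (a, b)) = of_real (r / (b - a)) * cis \<alpha>"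
    using ab by (simp add: field_simps)
  then have "exp (L (a, b)) = exp (of_real (ln (r / (b - a))) + \<i> * of_real \<alpha>)"
    using r ab by (simp add: exp_add cis_conv_exp exp_of_real)
  then obtain m' :: int where "L (a, b) = of_real (ln (r / (b - a))) + \<i> * of_real \<alpha> + of_int (2 * m') * of_real pi * \<i>"
    by (auto simp: exp_eq)
  then have ImL: "Im (L (a, b)) = \<alpha> + 2 * pi * m'" by (simp add: algebra_simps)
  have pi2: "0 < 2 * pi" by simp
  \<comment> \<open>\<open>m'\<close> counts the turns of the full secant relative to
    \<open>\<alpha>\<close>, and \<open>n\<close> those of \<open>L\<close> on the diagonal relative
    to \<open>l\<close>; only the difference is invariant.\<close>
  define m where "m = m' - n"
  have Ea: "E a = Im (l a) - \<alpha> - 2 * pi * m"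
    using n[of a] ab ImL by (simp add: E_def m_def algebra_simps)
  have Eb: "E b = \<alpha> - Im (l b) + 2 * pi * m"
    using n[of b] ab ImL by (simp add: E_def m_def algebra_simps)
  have twopi: "- 1 < x \<and> x < 0" if "- (2 * pi) < 2 * pi * x" "2 * pi * x < 0" for x :: real
  proof -
    have "2 * pi * (- 1) < 2 * pi * x" using that by simp
    then show ?thesis using that by (simp only: mult_less_cancel_left_pos[OF pi2] mult_less_0_iff) (use pi_gt_zero in auto)
  qed
  have Ene: "E t \<noteq> 2 * pi * of_int k" if t: "t \<in> {a..b}" for t and k :: int
  proof
    assume Et: "E t = 2 * pi * of_int k"
    consider "t = a" | "t = b" | "a < t" "t < b" using t by force
    then show False
    proof cases
      case 1
      then have "Im (l a) = \<alpha> + 2 * pi * of_int (m + k)" using Ea Et by (simp add: algebra_simps)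
      then have "- 1 < real_of_int (m + k)" "real_of_int (m + k) < 0"
        using la twopi[of "real_of_int (m + k)"] by linarith+
      then have "- 1 < m + k" "m + k < 0" by linarith+
      then show False by linarith
    next
      case 2
      then have "Im (l b) = \<alpha> + 2 * pi * of_int (m - k)" using Eb Et by (simp add: algebra_simps)
      then have "- 1 < real_of_int (m - k)" "real_of_int (m - k) < 0"
        using lb twopi[of "real_of_int (m - k)"] by linarith+
      then have "- 1 < m - k" "m - k < 0" by linarith+
      then show False by linarith
    next
      case 3
      \<comment> \<open>The ratio of the moduli of the two difference quotients. With equal
        directions, \<open>g t\<close> becomes the mean of \<open>g a\<close> and \<open>g b\<close>
        with positive weights \<open>b - t\<close> and \<open>\<rho> * (t - a)\<close>.\<close>
      define \<rho> where "\<rho> = exp (Re (L (a, t) - L (t, b)))"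
      have "exp (L (a, t) - L (t, b)) = of_real \<rho> * cis (E t)"
        unfolding \<rho>_def E_def by (rule exp_eq_polar)
      also have "cis (E t) = 1"
        unfolding Et by (simp add: cis_multiple_2pi)
      finally have "Q (a, t) = of_real \<rho> * Q (t, b)"
        using 3 L[of "(a, t)"] L[of "(t, b)"] by (simp add: Tiff exp_diff field_simps)
      moreover have "g t - g a = of_real (t - a) * Q (a, t)" "g b - g t = of_real (b - t) * Q (t, b)"
        using Qeq[of a t] Qeq[of t b] 3 by (simp_all add: Tiff scaleR_conv_of_real)
      ultimately have eq: "of_real (b - t) * (g t - g a) = of_real (\<rho> * (t - a)) * (g b - g t)"
        by (simp only: of_real_mult mult_ac)
      define u where "u = \<rho> * (t - a) / ((b - t) + \<rho> * (t - a))"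
      have \<rho>: "\<rho> > 0" by (simp add: \<rho>_def)
      have den: "(b - t) + \<rho> * (t - a) > 0" using 3 \<rho> by (simp add: add_pos_pos)
      have num: "0 < \<rho> * (t - a)" using 3 \<rho> by simp
      define d where "d = (b - t) + \<rho> * (t - a)"
      have u: "0 < u" "u < 1" and u1: "(b - t) / d = 1 - u"
        using 3 num den by (auto simp: u_def d_def divide_less_eq) (simp add: diff_divide_distrib[symmetric] field_simps)
      have "of_real d * g t = of_real (b - t) * g a + of_real (\<rho> * (t - a)) * g b"
        using eq by (simp add: d_def algebra_simps)
      then have "g t = (of_real (b - t) * g a + of_real (\<rho> * (t - a)) * g b) / of_real d"
        using den by (metis d_def less_irrefl nonzero_mult_div_cancel_left of_real_eq_0_iff)
      also have "\<dots> = of_real ((b - t) / d) * g a + of_real u * g b"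
        by (simp add: u_def d_def add_divide_distrib)
      finally have "g t = of_real ((b - t) / d) * g a + of_real u * g b" .
      moreover note u1
      ultimately have "g t = (1 - u) *\<^sub>R g a + u *\<^sub>R g b" by (simp add: scaleR_conv_of_real)
      moreover have "g a \<noteq> g b" using chord r by auto
      ultimately have "g t \<in> open_segment (g a) (g b)" using u by (auto simp: in_segment)
      with avoid[of t] 3 show False by simp
    qed
  qed
  \<comment> \<open>The multiple that must be crossed is \<open>2 * pi * m\<close> if
    \<open>m\<close> is nonnegative and \<open>2 * pi * (m + 1)\<close> otherwise.\<close>
  show False
  proof (cases "m \<ge> 0")
    case True
    then have "0 \<le> 2 * pi * real_of_int m" by simp
    then have "E a \<le> 2 * pi * of_int m" "2 * pi * of_int m \<le> E b"
      using Ea Eb la lb by linarith+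
    then show False using IVT_between[OF contE] ab Ene by (metis less_imp_le)
  next
    case False
    then have "real_of_int m \<le> - 1" by linarith
    then have "2 * pi * real_of_int m \<le> 2 * pi * (- 1)" by (intro mult_left_mono) auto
    then have "E b \<le> 2 * pi * of_int (m + 1)" "2 * pi * of_int (m + 1) \<le> E a"
      using Ea Eb la lb by (auto simp: algebra_simps)
    then show False using IVT_between[OF contE] ab Ene by (metis less_imp_le)
  qed
qed

lemma has_real_derivative_Re_rotated:
  assumes "(g has_vector_derivative g') F"
  shows "((\<lambda>t. Re (c * g t)) has_real_derivative Re (c * g')) F"
proof -
  have "((\<lambda>t. c * g t) has_vector_derivative c * g') F"
    using assms by (rule has_vector_derivative_mult_right)
  then have "((\<lambda>t. Re (c * g t)) has_vector_derivative Re (c * g')) F"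
    by (rule bounded_linear.has_vector_derivative[OF bounded_linear_Re])
  then show ?thesis by (simp add: has_real_derivative_iff_has_vector_derivative)
qed

lemma Re_cis_mult_exp_pos:
  assumes "\<bar>Im l - \<mu>\<bar> < pi / 2"
  shows "0 < Re (cis (- \<mu>) * exp l)"
proof -
  have "cis (- \<mu>) * exp l = of_real (exp (Re l)) * cis (Im l - \<mu>)"
    by (simp add: exp_eq_polar cis_mult[symmetric] mult_ac flip: cis_mult) (simp add: cis_mult)
  moreover have "cos (Im l - \<mu>) > 0" using assms by (intro cos_gt_zero_pi) linarith+
  ultimately show ?thesis by simp
qed

lemma advances_in_cone:
  fixes g l :: "real \<Rightarrow> complex"
  assumes "s < t"
    and der: "\<And>u. u \<in> {s..t} \<Longrightarrow> (g has_vector_derivative exp (l u)) (at u within {s..t})"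
    and cone: "\<And>u. u \<in> {s..t} \<Longrightarrow> \<bar>Im (l u) - \<mu>\<bar> < pi / 2"
  shows "0 < Re (cis (- \<mu>) * (g t - g s))"
proof -
  let ?f = "\<lambda>t. Re (cis (- \<mu>) * g t)"
  have "?f s < ?f t"
  proof (rule DERIV_pos_imp_increasing_open[of s t ?f])
    fix u assume "s < u" "u < t"
    then have "(g has_vector_derivative exp (l u)) (at u)"
      using der[of u] by (simp add: at_within_Icc_at)
    then show "\<exists>y. (?f has_real_derivative y) (at u) \<and> 0 < y"
      using has_real_derivative_Re_rotated Re_cis_mult_exp_pos[OF cone[of u]] \<open>s < u\<close> \<open>u < t\<close>
      by (metis atLeastAtMost_iff less_imp_le)
  next
    show "continuous_on {s..t} ?f"
      by (rule DERIV_continuous_on[OF has_real_derivative_Re_rotated[OF der]])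
  qed fact
  then show ?thesis by (simp add: algebra_simps)
qed

text \<open>The argument is normalised relative to \<open>\<mu>\<close> and not by the principal
  branch: every direction less than pi / 2 away from \<open>\<mu>\<close> then falls strictly
  between \<open>\<alpha> - 2 * pi\<close> and \<open>\<alpha>\<close>, the window of
  \<open>chord_parity\<close>.\<close>

lemma obtain_arg_in_left_half:
  assumes "z \<noteq> 0" "Re (cis (- \<mu>) * z) \<le> 0"
  obtains \<alpha> where "z = of_real (norm z) * cis \<alpha>" "\<mu> + pi / 2 \<le> \<alpha>" "\<alpha> \<le> \<mu> + 3 * pi / 2"
proof -
  define w where "w = - (cis (- \<mu>) * z)"
  have w: "w \<noteq> 0" "Re w \<ge> 0" using assms by (auto simp: w_def)
  have "norm w = norm z" by (simp add: w_def norm_mult)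
  then have "w = of_real (norm z) * cis (Arg w)" using rcis_cmod_Arg[of w] by (simp add: rcis_def)
  then have "z = of_real (norm z) * (- cis \<mu> * cis (Arg w))"
    by (metis (no_types, lifting) w_def minus_mult_minus mult.left_commute mult_minus_right
         cis_mult cis_zero add.right_inverse mult.assoc mult_1 minus_minus)
  also have "- cis \<mu> * cis (Arg w) = cis (\<mu> + pi + Arg w)"
    by (simp add: cis_mult[symmetric])
  finally have z: "z = of_real (norm z) * cis (\<mu> + pi + Arg w)" .
  have "\<bar>Arg w\<bar> \<le> pi / 2" using Arg_Re_nonneg[of w] w by simp
  then show ?thesis using that[OF z] by (auto simp: field_simps)
qed

text \<open>Otherwise stop the curve when it first meets the segment from \<open>g a\<close> to \<open>g b\<close> again: the
  resulting arc avoids its own chord, and \<open>chord_parity\<close> applies.\<close>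

lemma injective_curve_advances:
  fixes g l :: "real \<Rightarrow> complex"
  assumes "a < b"
    and der: "\<And>t. t \<in> {a..b} \<Longrightarrow> (g has_vector_derivative exp (l t)) (at t within {a..b})"
    and l: "continuous_on {a..b} l"
    and inj: "inj_on g {a..b}"
    and B: "convex B" "open B" "g a \<in> B" "g b \<in> B"
    and cone: "\<And>t. t \<in> {a..b} \<Longrightarrow> g t \<in> B \<Longrightarrow> \<bar>Im (l t) - \<mu>\<bar> < pi / 2"
  shows "0 < Re (cis (- \<mu>) * (g b - g a))"
proof (rule ccontr)
  let ?f = "\<lambda>z. Re (cis (- \<mu>) * (z - g a))"
  assume "\<not> ?thesis"
  then have le: "?f (g b) \<le> 0" by simp
  have contg: "continuous_on {a..b} g"
    using der by (meson continuous_on_eq_continuous_within has_vector_derivative_continuous)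
  obtain e where e: "e > 0" "ball (g a) e \<subseteq> B" using B openE by blast
  then obtain d where d: "d > 0" "\<And>t. t \<in> {a..b} \<Longrightarrow> dist t a < d \<Longrightarrow> dist (g t) (g a) < e"
    using contg \<open>a < b\<close> unfolding continuous_on_iff by (metis atLeastAtMost_iff less_imp_le order_refl)
  \<comment> \<open>The start \<open>g a\<close> itself lies on the segment, so the return is sought
    only after a short time during which the curve strictly advances. Points of the segment have not
    advanced, hence nothing is missed.\<close>
  define \<delta> where "\<delta> = min (d / 2) ((b - a) / 2)"
  have \<delta>: "\<delta> > 0" "\<delta> < d" "a + \<delta> < b" using d \<open>a < b\<close> by (auto simp: \<delta>_def min_def field_simps)
  have inB: "g t \<in> B" if "t \<in> {a..a + \<delta>}" for t
    using that d(2)[of t] \<delta> e by (auto simp: dist_commute dist_real_def)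
  have adv: "0 < ?f (g t)" if "a < t" "t \<le> a + \<delta>" for t
  proof (rule advances_in_cone[OF that(1)])
    fix u assume "u \<in> {a..t}"
    then show "\<bar>Im (l u) - \<mu>\<bar> < pi / 2" "(g has_vector_derivative exp (l u)) (at u within {a..t})"
      using cone[of u] inB[of u] that \<delta> der[of u]
      by (auto elim!: has_vector_derivative_within_subset)
  qed
  define U where "U = {t \<in> {a + \<delta>..b}. g t \<in> closed_segment (g a) (g b)}"
  have "U = {a + \<delta>..b} \<inter> g -` closed_segment (g a) (g b)" by (auto simp: U_def)
  then have "closed U"
    using \<delta> by (auto intro!: continuous_closed_preimage continuous_on_subset[OF contg])
  moreover have "b \<in> U" using \<delta> by (simp add: U_def)
  moreover have "bdd_below U" by (auto simp: U_def bdd_below_def)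
  ultimately have Inf: "Inf U \<in> U" by (intro closed_contains_Inf) auto
  define u where "u = Inf U"
  have u: "a + \<delta> \<le> u" "u \<le> b" "g u \<in> closed_segment (g a) (g b)"
    using Inf by (auto simp: U_def u_def)
  have umin: "t \<notin> U" if "t < u" for t
    using that \<open>bdd_below U\<close> cInf_lower[of t U] by (auto simp: u_def)
  have fle: "?f z \<le> 0" if seg: "z \<in> closed_segment (g a) (g b)" for z
  proof -
    obtain x where x: "0 \<le> x" "z = (1 - x) *\<^sub>R g a + x *\<^sub>R g b" using seg by (auto simp: in_segment)
    then have "z - g a = of_real x * (g b - g a)" by (simp add: scaleR_conv_of_real algebra_simps)
    then have "?f z = x * ?f (g b)" by (simp only: mult.left_commute[of _ "of_real x"]) simp
    then show ?thesis using x le by (simp add: mult_nonneg_nonpos)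
  qed
  have "g u \<noteq> g a" using inj_on_eq_iff[OF inj, of u a] u \<delta> \<open>a < b\<close> by auto
  then obtain \<alpha> where \<alpha>: "g u - g a = of_real (norm (g u - g a)) * cis \<alpha>"
      "\<mu> + pi / 2 \<le> \<alpha>" "\<alpha> \<le> \<mu> + 3 * pi / 2"
    using obtain_arg_in_left_half[of "g u - g a" \<mu>] fle[OF u(3)] by auto
  \<comment> \<open>Convexity of \<open>B\<close> makes the cone condition available at the first
    return as well.\<close>
  have guB: "g u \<in> B" using u(3) B by (meson closed_segment_subset in_mono)
  have "\<bar>Im (l a) - \<mu>\<bar> < pi / 2" "\<bar>Im (l u) - \<mu>\<bar> < pi / 2"
    using cone[of a] cone[of u] B guB u \<delta> \<open>a < b\<close> by auto
  then have "\<alpha> - 2 * pi < Im (l a)" "Im (l a) < \<alpha>" "\<alpha> - 2 * pi < Im (l u)" "Im (l u) < \<alpha>"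
    using \<alpha>(2,3) by linarith+
  moreover have "g t \<notin> open_segment (g a) (g u)" if t: "t \<in> {a<..<u}" for t
  proof
    assume "g t \<in> open_segment (g a) (g u)"
    then have seg: "g t \<in> closed_segment (g a) (g b)"
      using u(3) by (meson ends_in_segment(1) open_closed_segment subsetD subset_closed_segment)
    then show False using fle[OF seg] adv[of t] umin[of t] t u by (cases "t \<le> a + \<delta>") (auto simp: U_def)
  qed
  ultimately show False
    using chord_parity[of a u g l "norm (g u - g a)" \<alpha>] u \<delta> \<alpha>(1) \<open>g u \<noteq> g a\<close>
      inj_on_subset[OF inj] continuous_on_subset[OF l] has_vector_derivative_within_subset[OF der]
    by auto
qed

text \<open>A closed curve would contain a minimal loop; stopping the loop shortly before it closes gives
  an injective curve that has not advanced.\<close>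

lemma liftable_curve_injective:
  fixes g l :: "real \<Rightarrow> complex" and \<Lambda> :: "complex \<Rightarrow> complex"
  assumes der: "\<And>t. t \<in> {a..b} \<Longrightarrow> (g has_vector_derivative exp (\<Lambda> (g t))) (at t within {a..b})"
    and \<Lambda>: "continuous_on S \<Lambda>" "open S" "g ` {a..b} \<subseteq> S"
  shows "inj_on g {a..b}"
proof (rule ccontr)
  assume "\<not> ?thesis"
  then obtain s0 t0 where st0: "a \<le> s0" "s0 < t0" "t0 \<le> b" "g s0 = g t0"
    unfolding inj_on_def by (metis atLeastAtMost_iff linorder_neqE_linordered_idom)
  have contg: "continuous_on {a..b} g"
    using der by (meson continuous_on_eq_continuous_within has_vector_derivative_continuous)
  define l where "l = (\<lambda>t. \<Lambda> (g t))"
  have l: "continuous_on {a..b} l"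
    unfolding l_def using \<Lambda> by (intro continuous_on_compose2[OF \<Lambda>(1) contg])
  define Q where "Q = secant (\<lambda>t. exp (l t))"
  have contQ: "continuous_on (ordered_pairs a b) Q"
    unfolding Q_def by (intro continuous_on_secant continuous_intros l)
  have Qeq: "(t - s) *\<^sub>R Q (s, t) = g t - g s" if "a \<le> s" "s \<le> t" "t \<le> b" for s t
    unfolding Q_def using that by (intro secant_eq[of a b]) (auto simp: l_def intro!: der)
  \<comment> \<open>On the diagonal the secant is a value of \<open>exp\<close> and so nonzero. The
    zeros are therefore exactly the pairs \<open>s < t\<close> with \<open>g s = g t\<close>, and
    they form a compact set on which the duration attains its minimum.\<close>
  define Z where "Z = ordered_pairs a b \<inter> Q -` {0}"
  have "closed Z"
    unfolding Z_def
    by (intro continuous_closed_preimage contQ compact_imp_closed compact_ordered_pairs) simp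
  then have "compact (ordered_pairs a b \<inter> Z)" by (intro compact_Int_closed compact_ordered_pairs)
  also have "ordered_pairs a b \<inter> Z = Z" by (auto simp: Z_def)
  finally have "compact Z" .
  moreover have "(s0, t0) \<in> Z"
    using st0 Qeq[of s0 t0] by (simp add: Z_def ordered_pairs_def)
  moreover have "continuous_on Z (\<lambda>p. snd p - fst p)" by (intro continuous_intros)
  ultimately obtain p where p: "p \<in> Z" and pmin: "\<forall>q\<in>Z. snd p - fst p \<le> snd q - fst q"
    using continuous_attains_inf[of Z "\<lambda>p. snd p - fst p"] by blast
  obtain s t where pst: "p = (s, t)" by force
  have st: "a \<le> s" "s \<le> t" "t \<le> b" "Q (s, t) = 0"
    using p by (auto simp: pst Z_def ordered_pairs_def)
  have "s \<noteq> t" using st by (auto simp: Q_def)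
  with st have "s < t" by simp
  have gst: "g s = g t" using Qeq[of s t] st by simp
  have noloop: "g x \<noteq> g y" if "s \<le> x" "x < y" "y \<le> t" "y - x < t - s" for x y
  proof
    assume "g x = g y"
    then have "(x, y) \<in> Z" using that st Qeq[of x y] by (simp add: Z_def ordered_pairs_def)
    then show False using bspec[OF pmin, of "(x, y)"] that by (simp add: pst)
  qed
  have gt: "g t \<in> S" using \<Lambda>(3) st by auto
  define \<mu> where "\<mu> = Im (\<Lambda> (g t))"
  have "isCont \<Lambda> (g t)" using \<Lambda> gt by (simp add: continuous_on_eq_continuous_at)
  then obtain e1 where e1: "e1 > 0" "\<And>z. dist z (g t) < e1 \<Longrightarrow> dist (\<Lambda> z) (\<Lambda> (g t)) < pi / 2"
    unfolding continuous_at_eps_delta by (metis pi_half_gt_zero)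
  define B where "B = ball (g t) e1"
  have cone: "\<bar>Im (\<Lambda> z) - \<mu>\<bar> < pi / 2" if "z \<in> B" for z
    using e1(2)[of z] that abs_Im_le_cmod[of "\<Lambda> z - \<Lambda> (g t)"]
    by (simp add: B_def \<mu>_def dist_norm norm_minus_commute)
  obtain d where d: "d > 0" "\<And>u. u \<in> {a..b} \<Longrightarrow> dist u t < d \<Longrightarrow> dist (g u) (g t) < e1"
    using contg st \<open>e1 > 0\<close> unfolding continuous_on_iff by (metis atLeastAtMost_iff order_trans)
  \<comment> \<open>The curve is injective from \<open>s\<close> to \<open>t'\<close>, and the
    remaining piece stays in \<open>B\<close>. Both pieces advance in direction
    \<open>\<mu>\<close>, although together they return to the start.\<close>
  define t' where "t' = t - min (d / 2) ((t - s) / 2)"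
  have t': "s < t'" "t' < t" "t - t' < d" using d \<open>s < t\<close> by (auto simp: t'_def min_def field_simps)
  have inB: "g u \<in> B" if "u \<in> {t'..t}" for u
    using d(2)[of u] that t' st by (auto simp: B_def dist_commute dist_real_def)
  have "0 < Re (cis (- \<mu>) * (g t - g t'))"
  proof (rule advances_in_cone[OF t'(2)])
    fix u assume u: "u \<in> {t'..t}"
    then show "\<bar>Im (l u) - \<mu>\<bar> < pi / 2" using cone inB by (simp add: l_def)
    show "(g has_vector_derivative exp (l u)) (at u within {t'..t})"
      unfolding l_def by (rule has_vector_derivative_within_subset[OF der]) (use u t' st in auto)
  qed
  moreover have "0 < Re (cis (- \<mu>) * (g t' - g s))"
  proof (rule injective_curve_advances[OF t'(1), of g l])
    show "(g has_vector_derivative exp (l u)) (at u within {s..t'})" if "u \<in> {s..t'}" for u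
      unfolding l_def by (rule has_vector_derivative_within_subset[OF der]) (use that t' st in auto)
    show "continuous_on {s..t'} l" using t' st by (intro continuous_on_subset[OF l]) auto
    show "inj_on g {s..t'}"
    proof (rule linorder_inj_onI)
      fix x y assume "x < y" "x \<in> {s..t'}" "y \<in> {s..t'}"
      then show "g x \<noteq> g y" using noloop[of x y] t' by auto
    qed auto
    show "convex B" "open B" "g s \<in> B" "g t' \<in> B"
      using inB[of t'] t' gst e1 by (auto simp: B_def)
  qed (use cone in \<open>auto simp: l_def\<close>)
  ultimately show False by (simp add: gst algebra_simps)
qed

text \<open>A trapped trajectory accumulates at some \<open>p\<close>. One passage near
  \<open>p\<close> gains a definite amount in the direction of the field at \<open>p\<close>; a
  later visit that is closer to \<open>p\<close> than this gain would mean having moved back,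
  against \<open>injective_curve_advances\<close>.\<close>

lemma not_trapped_in_compact:
  fixes g :: "real \<Rightarrow> complex" and \<Lambda> :: "complex \<Rightarrow> complex"
  assumes \<Lambda>: "continuous_on S \<Lambda>" "open S" and K: "compact K" "K \<subseteq> S"
    and der: "\<And>t. 0 \<le> t \<Longrightarrow> (g has_vector_derivative exp (\<Lambda> (g t))) (at t)"
    and gK: "\<And>t. 0 \<le> t \<Longrightarrow> g t \<in> K"
  shows False
proof -
  have der': "(g has_vector_derivative exp (\<Lambda> (g t))) (at t within A)" if "0 \<le> t" for t A
    using der[OF that] has_vector_derivative_at_within by blast
  have contg: "continuous_on {0..} g"
    using der' by (meson atLeast_iff continuous_on_eq_continuous_within has_vector_derivative_continuous)
  have inj: "inj_on g {a..b}" if "0 \<le> a" for a b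
    by (rule liftable_curve_injective[OF der' \<Lambda>]) (use that gK K in auto)
  have contl: "continuous_on {a..b} (\<lambda>t. \<Lambda> (g t))" if "0 \<le> a" for a b
    by (rule continuous_on_compose2[OF \<Lambda>(1) continuous_on_subset[OF contg]]) (use that gK K in auto)
  have "seq_compact K" using K compact_imp_seq_compact by blast
  then obtain p r where p: "p \<in> K" "strict_mono (r :: nat \<Rightarrow> nat)" "((\<lambda>n. g (real n)) \<circ> r) \<longlonglongrightarrow> p"
    using gK unfolding seq_compact_def by (metis of_nat_0_le_iff)
  have recur: "\<exists>t>T. dist (g t) p < e" if "e > 0" for e T
  proof -
    have "eventually (\<lambda>n. dist (g (real (r n))) p < e) sequentially"
      using p(3) that by (auto simp: tendsto_iff)
    moreover have "eventually (\<lambda>n. real (r n) > T) sequentially"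
      using filterlim_compose[OF filterlim_real_sequentially filterlim_subseq[OF p(2)]]
      by (simp add: filterlim_at_top_dense)
    ultimately have "eventually (\<lambda>n. dist (g (real (r n))) p < e \<and> real (r n) > T) sequentially"
      by eventually_elim simp
    then obtain N where "\<forall>n\<ge>N. dist (g (real (r n))) p < e \<and> real (r n) > T"
      unfolding eventually_sequentially by blast
    then show ?thesis by blast
  qed
  have "continuous_on K (\<lambda>z. exp (\<Lambda> z))"
    using K by (intro continuous_intros continuous_on_subset[OF \<Lambda>(1)])
  then have "bounded ((\<lambda>z. exp (\<Lambda> z)) ` K)" using K compact_continuous_image compact_imp_bounded by blast
  then obtain M where M: "M > 0" "\<And>z. z \<in> K \<Longrightarrow> norm (exp (\<Lambda> z)) \<le> M"
    unfolding bounded_pos by blast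
  define \<mu> where "\<mu> = Im (\<Lambda> p)"
  define f where "f = (\<lambda>z. Re (cis (- \<mu>) * z))"
  have "p \<in> S" using p K by auto
  have "continuous_on S (\<lambda>z. f (exp (\<Lambda> z)))" "continuous_on S (\<lambda>z. Im (\<Lambda> z))"
    unfolding f_def by (intro continuous_intros \<Lambda>)+
  then have "isCont (\<lambda>z. f (exp (\<Lambda> z))) p" "isCont (\<lambda>z. Im (\<Lambda> z)) p"
    using \<Lambda>(2) \<open>p \<in> S\<close> by (auto simp: continuous_on_eq_continuous_at)
  \<comment> \<open>Half of the speed at \<open>p\<close> in direction \<open>\<mu>\<close>; by
    continuity it remains a lower bound for this component on a ball around
    \<open>p\<close>.\<close>
  moreover define m where "m = f (exp (\<Lambda> p)) / 2"
  have m: "m > 0" "f (exp (\<Lambda> p)) = 2 * m" using Re_cis_mult_exp_pos[of "\<Lambda> p" \<mu>] by (simp_all add: m_def f_def \<mu>_def)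
  ultimately obtain \<rho>1 \<rho>2 where \<rho>: "\<rho>1 > 0" "\<rho>2 > 0"
      "\<And>z. dist z p < \<rho>1 \<Longrightarrow> dist (f (exp (\<Lambda> z))) (f (exp (\<Lambda> p))) < m"
      "\<And>z. dist z p < \<rho>2 \<Longrightarrow> dist (Im (\<Lambda> z)) \<mu> < pi / 2"
    unfolding continuous_at_eps_delta \<mu>_def by (metis pi_half_gt_zero)
  define \<rho> where "\<rho> = min \<rho>1 \<rho>2"
  define B where "B = ball p \<rho>"
  have "\<rho> > 0" using \<rho> by (simp add: \<rho>_def)
  have speed: "m \<le> f (exp (\<Lambda> z))" and cone: "\<bar>Im (\<Lambda> z) - \<mu>\<bar> < pi / 2" if "z \<in> B" for z
  proof -
    have "dist z p < \<rho>1" "dist z p < \<rho>2" using that by (auto simp: B_def \<rho>_def dist_commute)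
    then show "m \<le> f (exp (\<Lambda> z))" "\<bar>Im (\<Lambda> z) - \<mu>\<bar> < pi / 2"
      using \<rho>(3)[of z] \<rho>(4)[of z] m(2) unfolding dist_real_def by linarith+
  qed
  \<comment> \<open>Speed at most \<open>M\<close> confines the curve to distance
    \<open>\<rho> / 2\<close> from \<open>g s1\<close> during time \<open>\<tau>\<close>, and
    \<open>e \<le> \<rho> / 2\<close> then keeps it in \<open>B\<close>. The gain
    \<open>m * \<tau>\<close> is at least \<open>2 * e\<close>, one \<open>e\<close> for each of the
    two visits.\<close>
  define \<tau> where "\<tau> = \<rho> / (2 * M)"
  have \<tau>: "\<tau> > 0" using \<open>\<rho> > 0\<close> M by (simp add: \<tau>_def)
  define e where "e = min (\<rho> / 2) (m * \<tau> / 2)"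
  have e: "e > 0" "e \<le> \<rho> / 2" "2 * e \<le> m * \<tau>" using \<open>\<rho> > 0\<close> m \<tau> by (auto simp: e_def)
  have fle: "\<bar>f z - f w\<bar> \<le> dist z w" for z w
  proof -
    have "f z - f w = Re (cis (- \<mu>) * (z - w))" by (simp add: f_def algebra_simps)
    then show ?thesis using abs_Re_le_cmod[of "cis (- \<mu>) * (z - w)"] by (simp add: norm_mult dist_norm)
  qed
  obtain s1 where s1: "s1 > 0" "dist (g s1) p < e" using recur[OF e(1), of 0] by auto
  have near: "g t \<in> B" if t: "t \<in> {s1..s1 + \<tau>}" for t
  proof -
    have "norm (g t - g s1) \<le> M * norm (t - s1)"
    proof (rule differentiable_bound[of "{s1..t}" g "\<lambda>u h. h *\<^sub>R exp (\<Lambda> (g u))"])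
      fix u assume u: "u \<in> {s1..t}"
      show "(g has_derivative (\<lambda>h. h *\<^sub>R exp (\<Lambda> (g u)))) (at u within {s1..t})"
        using der'[of u] u s1 by (auto simp: has_vector_derivative_def)
      show "onorm (\<lambda>h. h *\<^sub>R exp (\<Lambda> (g u))) \<le> M"
        using M(2)[OF gK[of u]] u s1 by (intro onorm_scaleR_vector_le) auto
    qed (use t in auto)
    also have "\<dots> \<le> M * \<tau>" using t M by (intro mult_left_mono) auto
    also have "\<dots> = \<rho> / 2" using M by (simp add: \<tau>_def)
    finally have "dist (g t) (g s1) \<le> \<rho> / 2" by (simp add: dist_norm)
    then show ?thesis using s1 e dist_triangle[of "g t" p "g s1"] by (simp add: B_def dist_commute)
  qed
  define s where "s = s1 + \<tau>"
  have "f (g s1) + m * \<tau> \<le> f (g s)"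
  proof -
    have "f (g s1) - m * s1 \<le> f (g s) - m * s"
    proof (rule DERIV_nonneg_imp_nondecreasing[of s1 s "\<lambda>t. f (g t) - m * t"])
      fix t assume t: "s1 \<le> t" "t \<le> s"
      have "((\<lambda>t. f (g t) - m * t) has_real_derivative f (exp (\<Lambda> (g t))) - m) (at t)"
        unfolding f_def
        using t s1 by (auto intro!: derivative_eq_intros has_real_derivative_Re_rotated der)
      moreover have "0 \<le> f (exp (\<Lambda> (g t))) - m"
        using speed near[of t] t by (simp add: s_def)
      ultimately show "\<exists>y. ((\<lambda>t. f (g t) - m * t) has_real_derivative y) (at t) \<and> 0 \<le> y"
        by blast
    qed (use \<tau> in \<open>simp add: s_def\<close>)
    then show ?thesis by (simp add: s_def algebra_simps)
  qed
  moreover have "\<bar>f (g s1) - f p\<bar> < e" using fle[of "g s1" p] s1 by simp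
  ultimately have fs: "f p + e \<le> f (g s)" using e by simp
  obtain t where t: "t > s" "dist (g t) p < e" using recur[OF e(1)] by blast
  have "f (g t) < f p + e" using fle[of "g t" p] t by simp
  moreover have "0 < Re (cis (- \<mu>) * (g t - g s))"
  proof (rule injective_curve_advances[OF t(1) der' contl inj, where B = B])
    show "convex B" "open B" "g s \<in> B" "g t \<in> B"
      using near[of s] \<tau> t e by (auto simp: B_def s_def dist_commute)
  qed (use cone s1 \<tau> in \<open>auto simp: s_def\<close>)
  ultimately show False using fs by (simp add: f_def algebra_simps)
qed

section \<open>The Cauchy--Pompeiu formula and Green's theorem\<close>

lemma integral_lborel_translate:
  fixes F :: "'a::euclidean_space \<Rightarrow> 'b::euclidean_space"
  assumes "F \<in> borel_measurable borel"
  shows "(\<integral>z. F (z + c) \<partial>lborel) = (\<integral>z. F z \<partial>lborel)"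
proof -
  have "(\<integral>z. F z \<partial>lborel) = (\<integral>z. F z \<partial>distr lborel borel ((+) c))"
    by (simp add: lborel_distr_plus)
  also have "\<dots> = (\<integral>z. F (c + z) \<partial>lborel)" using assms by (subst integral_distr) auto
  finally show ?thesis by (simp add: add.commute)
qed

lemma nn_integral_lborel_reflect:
  fixes F :: "'a::euclidean_space \<Rightarrow> ennreal"
  assumes "F \<in> borel_measurable borel"
  shows "(\<integral>\<^sup>+z. F (c - z) \<partial>lborel) = (\<integral>\<^sup>+z. F z \<partial>lborel)"
proof -
  have "(lborel :: 'a measure) = distr lborel borel (\<lambda>z. c - z)"
    using lborel_affine[of "- 1" c] by (simp add: density_1)
  then have "(\<integral>\<^sup>+z. F z \<partial>lborel) = (\<integral>\<^sup>+z. F z \<partial>distr lborel borel (\<lambda>z. c - z))" by simp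
  also have "\<dots> = (\<integral>\<^sup>+z. F (c - z) \<partial>lborel)" using assms by (subst nn_integral_distr) auto
  finally show ?thesis ..
qed

lemma integrable_continuous_compact_support:
  fixes F :: "'a::euclidean_space \<Rightarrow> 'b::euclidean_space"
  assumes "continuous_on UNIV F" "\<And>z. norm z > R \<Longrightarrow> F z = 0"
  shows "integrable lborel F"
proof -
  have "integrable lborel (\<lambda>z. indicator (cball 0 R) z *\<^sub>R F z)"
    by (rule borel_integrable_compact) (auto intro: continuous_on_subset[OF assms(1)])
  also have "(\<lambda>z. indicator (cball 0 R) z *\<^sub>R F z) = F"
    using assms(2) by (auto simp: fun_eq_iff indicator_def not_le)
  finally show ?thesis .
qed

lemma difference_quotient_LIMSEQ:
  fixes f :: "real \<Rightarrow> 'b::real_normed_vector"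
  assumes "(f has_vector_derivative f') (at 0)"
  shows "(\<lambda>n. real (Suc n) *\<^sub>R (f (1 / real (Suc n)) - f 0)) \<longlonglongrightarrow> f'"
proof -
  have "((\<lambda>t. norm ((f t - f 0) - t *\<^sub>R f') / norm t) \<longlongrightarrow> 0) (at 0)"
    using assms by (simp add: has_vector_derivative_def has_derivative_iff_norm)
  moreover have "filterlim (\<lambda>n. 1 / real (Suc n)) (at 0) sequentially"
    unfolding filterlim_at using LIMSEQ_inverse_real_of_nat[unfolded inverse_eq_divide] by auto
  ultimately have "(\<lambda>n. norm ((f (1 / real (Suc n)) - f 0) - (1 / real (Suc n)) *\<^sub>R f') / norm (1 / real (Suc n))) \<longlonglongrightarrow> 0"
    by (rule filterlim_compose)
  moreover have "norm ((f (1 / real (Suc n)) - f 0) - (1 / real (Suc n)) *\<^sub>R f') / norm (1 / real (Suc n))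
      = norm (real (Suc n) *\<^sub>R (f (1 / real (Suc n)) - f 0) - f')" for n
  proof -
    have "real (Suc n) *\<^sub>R (f (1 / real (Suc n)) - f 0) - f'
        = real (Suc n) *\<^sub>R ((f (1 / real (Suc n)) - f 0) - (1 / real (Suc n)) *\<^sub>R f')"
      by (simp add: scaleR_diff_right)
    also have "norm \<dots> = norm ((f (1 / real (Suc n)) - f 0) - (1 / real (Suc n)) *\<^sub>R f') / norm (1 / real (Suc n))"
      by (simp only: norm_scaleR) (simp add: field_simps)
    finally show ?thesis ..
  qed
  ultimately have "(\<lambda>n. norm (real (Suc n) *\<^sub>R (f (1 / real (Suc n)) - f 0) - f')) \<longlonglongrightarrow> 0" by simp
  then show ?thesis using LIM_zero_iff tendsto_norm_zero_iff by blast
qed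

text \<open>By translation invariance every difference quotient integrates to zero; hence so does the limit.\<close>

lemma integral_directional_derivative_eq_0:
  fixes F F' :: "'a::euclidean_space \<Rightarrow> 'b::euclidean_space"
  assumes lip: "M-lipschitz_on UNIV F" and supp: "\<And>z. norm z > R \<Longrightarrow> F z = 0"
    and meas: "F' \<in> borel_measurable borel"
    and der: "AE z in lborel. ((\<lambda>t. F (z + t *\<^sub>R e)) has_vector_derivative F' z) (at 0)"
  shows "integrable lborel F'" "(\<integral>z. F' z \<partial>lborel) = 0"
proof -
  have contF: "continuous_on UNIV F" using lip by (rule lipschitz_on_continuous_on)
  have [measurable]: "F \<in> borel_measurable borel" "F' \<in> borel_measurable borel"
    using contF meas by (auto intro: borel_measurable_continuous_onI)
  have M: "M \<ge> 0" using lip lipschitz_on_nonneg by blast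
  define s where "s = (\<lambda>n z. real (Suc n) *\<^sub>R (F (z + (1 / real (Suc n)) *\<^sub>R e) - F z))"
  \<comment> \<open>Dominating function: the shifts have length at most \<open>norm e\<close>, so
    all quotients vanish beyond \<open>R + norm e\<close>, and the Lipschitz constant bounds them
    inside.\<close>
  define w where "w = (\<lambda>z::'a. indicator (cball 0 (R + norm e)) z *\<^sub>R (M * norm e))"
  have intF: "integrable lborel F" by (rule integrable_continuous_compact_support[OF contF supp])
  have intFt: "integrable lborel (\<lambda>z. F (z + c))" for c
    by (rule integrable_continuous_compact_support[where R = "R + norm c"])
       (auto intro!: continuous_on_compose2[OF contF] continuous_intros supp
         intro: less_le_trans[OF _ norm_diff_ineq])
  have bound: "norm (s n z) \<le> w z" for n z
  proof (cases "norm z \<le> R + norm e")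
    case True
    have "norm (F (z + (1 / real (Suc n)) *\<^sub>R e) - F z) \<le> M * (1 / real (Suc n) * norm e)"
      using lipschitz_onD[OF lip, of "z + (1 / real (Suc n)) *\<^sub>R e" z] by (simp add: dist_norm)
    then have "norm (s n z) \<le> real (Suc n) * (M * (1 / real (Suc n) * norm e))"
      unfolding s_def norm_scaleR by (intro mult_mono) auto
    then show ?thesis using True by (simp add: w_def)
  next
    case False
    have "norm ((1 / real (Suc n)) *\<^sub>R e) \<le> 1 * norm e"
      unfolding norm_scaleR by (rule mult_right_mono) auto
    then have "norm (z + (1 / real (Suc n)) *\<^sub>R e) > R"
      using False norm_diff_ineq[of z "(1 / real (Suc n)) *\<^sub>R e"] by linarith
    moreover have "norm z > R" using False norm_ge_zero[of e] by linarith
    ultimately have "s n z = 0" by (simp add: s_def supp)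
    moreover have "0 \<le> w z" using M by (simp add: w_def)
    ultimately show ?thesis by simp
  qed
  have lim: "AE z in lborel. (\<lambda>n. s n z) \<longlonglongrightarrow> F' z"
    using der
  proof eventually_elim
    case (elim z)
    show ?case using difference_quotient_LIMSEQ[OF elim] by (simp add: s_def)
  qed
  have w: "integrable lborel w"
    unfolding w_def by (rule borel_integrable_compact) auto
  have s: "s n \<in> borel_measurable lborel" for n unfolding s_def by measurable
  show "integrable lborel F'"
    by (rule integrable_dominated_convergence[OF _ s w lim]) (use bound in auto)
  have "(\<lambda>n. \<integral>z. s n z \<partial>lborel) \<longlonglongrightarrow> (\<integral>z. F' z \<partial>lborel)"
    by (rule integral_dominated_convergence[OF _ s w lim]) (use bound in auto)
  moreover have "(\<integral>z. s n z \<partial>lborel) = 0" for n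
    unfolding s_def using intF intFt by (simp add: integral_lborel_translate)
  ultimately show "(\<integral>z. F' z \<partial>lborel) = 0" by (simp add: LIMSEQ_const_iff)
qed

lemma has_vector_derivative_along:
  fixes f :: "'a::real_normed_vector \<Rightarrow> 'b::real_normed_vector"
  assumes "(f has_derivative f') (at z)"
  shows "((\<lambda>t. f (z + t *\<^sub>R e)) has_vector_derivative f' e) (at 0)"
proof -
  have "((\<lambda>t::real. z + t *\<^sub>R e) has_derivative (\<lambda>t. t *\<^sub>R e)) (at 0)"
    by (auto intro!: derivative_eq_intros)
  then have "((\<lambda>t. f (z + t *\<^sub>R e)) has_derivative (\<lambda>t. f' (t *\<^sub>R e))) (at 0)"
    using has_derivative_compose[of "\<lambda>t::real. z + t *\<^sub>R e" "\<lambda>t. t *\<^sub>R e" 0 UNIV f f'] assms by simp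
  moreover have "f' (t *\<^sub>R e) = t *\<^sub>R f' e" for t
    using assms by (simp add: has_derivative_def bounded_linear.linear linear_cmul)
  ultimately show ?thesis by (simp add: has_vector_derivative_def)
qed

text \<open>A Lipschitz truncation of \<open>1 / u\<close>. It is holomorphic outside the disc of radius \<open>\<epsilon>\<close>, and inside it
  its \<open>\<partial>\<^sub>x + \<i> \<partial>\<^sub>y\<close> derivative is the constant \<open>2 / \<epsilon>\<^sup>2\<close>, so integration by parts produces a mean value.\<close>

definition cauchy_kernel :: "real \<Rightarrow> complex \<Rightarrow> complex" where
  "cauchy_kernel \<epsilon> u = of_real (1 / (max (norm u) \<epsilon>)\<^sup>2) * cnj u"

text \<open>The directional derivative along \<open>e\<close>. On the circle of radius
  \<open>\<epsilon>\<close> the value is a convention: the derivative is asserted only off this null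
  set.\<close>

definition cauchy_kernel_deriv :: "real \<Rightarrow> complex \<Rightarrow> complex \<Rightarrow> complex" where
  "cauchy_kernel_deriv \<epsilon> e u = (if norm u < \<epsilon> then of_real (1 / \<epsilon>\<^sup>2) * cnj e else - e / u\<^sup>2)"

lemma cauchy_kernel_outside:
  assumes "\<epsilon> > 0" "\<epsilon> \<le> norm u"
  shows "cauchy_kernel \<epsilon> u = 1 / u"
proof -
  have "u \<noteq> 0" using assms by auto
  have "cauchy_kernel \<epsilon> u = cnj u / of_real ((norm u)\<^sup>2)"
    using assms by (simp add: cauchy_kernel_def max_def)
  also have "of_real ((norm u)\<^sup>2) = u * cnj u" by (rule complex_norm_square)
  finally show ?thesis using \<open>u \<noteq> 0\<close> by simp
qed

lemma norm_cauchy_kernel_le: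
  assumes "\<epsilon> > 0"
  shows "norm (cauchy_kernel \<epsilon> u) \<le> 1 / \<epsilon>" "norm (cauchy_kernel \<epsilon> u) \<le> 1 / norm u"
proof -
  have m: "max (norm u) \<epsilon> > 0" using assms by simp
  have eq: "norm (cauchy_kernel \<epsilon> u) = norm u / (max (norm u) \<epsilon>)\<^sup>2"
    by (simp add: cauchy_kernel_def norm_mult norm_divide norm_power)
  have le: "norm u / (max (norm u) \<epsilon>)\<^sup>2 \<le> 1 / max (norm u) \<epsilon>"
    using m by (simp add: divide_le_eq power2_eq_square)
  have "1 / max (norm u) \<epsilon> \<le> 1 / \<epsilon>" using assms by (intro divide_left_mono) auto
  then show "norm (cauchy_kernel \<epsilon> u) \<le> 1 / \<epsilon>" using eq le by linarith
  show "norm (cauchy_kernel \<epsilon> u) \<le> 1 / norm u"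
  proof (cases "u = 0")
    case True
    then show ?thesis by (simp add: cauchy_kernel_def)
  next
    case False
    then have "1 / max (norm u) \<epsilon> \<le> 1 / norm u" using m by (intro divide_left_mono) auto
    then show ?thesis using eq le by linarith
  qed
qed

text \<open>The constant 3 is 1 + 2: one part from moving \<open>cnj u\<close>, two from moving the
  scalar in front of it.\<close>

lemma lipschitz_cauchy_kernel:
  assumes "\<epsilon> > 0"
  shows "dist (cauchy_kernel \<epsilon> u) (cauchy_kernel \<epsilon> w) \<le> 3 / \<epsilon>\<^sup>2 * dist u w"
proof -
  define p q where "p = max (norm u) \<epsilon>" and "q = max (norm w) \<epsilon>"
  have pq: "\<epsilon> \<le> p" "\<epsilon> \<le> q" "norm w \<le> q" "0 < p" "0 < q" using assms by (auto simp: p_def q_def)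
  have qp: "\<bar>q - p\<bar> \<le> dist u w"
    using norm_triangle_ineq3[of u w] by (auto simp: p_def q_def dist_norm max_def)
  have inv: "1 / p \<le> 1 / \<epsilon>" "1 / q \<le> 1 / \<epsilon>" using pq assms by (auto intro!: divide_left_mono)
  have p2: "1 / p\<^sup>2 \<le> 1 / \<epsilon>\<^sup>2"
    using mult_mono[OF inv(1) inv(1)] pq assms by (simp add: power2_eq_square)
  have pq2: "1 / p * (1 / q) \<le> 1 / \<epsilon>\<^sup>2"
    using mult_mono[OF inv] pq assms by (simp add: power2_eq_square)
  \<comment> \<open>In this factorisation one \<open>1 / q\<close> is left unestimated in each term,
    to be cancelled against \<open>norm w \<le> q\<close>.\<close>
  have "1 / p\<^sup>2 - 1 / q\<^sup>2 = (q - p) * ((1 / p * (1 / q)) * (1 / q) + (1 / p\<^sup>2) * (1 / q))"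
    using pq by (simp add: field_simps power2_eq_square)
  then have "\<bar>1 / p\<^sup>2 - 1 / q\<^sup>2\<bar> = \<bar>q - p\<bar> * ((1 / p * (1 / q)) * (1 / q) + (1 / p\<^sup>2) * (1 / q))"
    using pq by (simp only: abs_mult) simp
  also have "\<dots> \<le> dist u w * ((1 / \<epsilon>\<^sup>2) * (1 / q) + (1 / \<epsilon>\<^sup>2) * (1 / q))"
    using qp p2 pq2 pq by (intro mult_mono add_mono) auto
  finally have d: "\<bar>1 / p\<^sup>2 - 1 / q\<^sup>2\<bar> \<le> dist u w * (2 / \<epsilon>\<^sup>2) * (1 / q)" by (simp add: mult.commute)
  have "cauchy_kernel \<epsilon> u - cauchy_kernel \<epsilon> w
      = of_real (1 / p\<^sup>2) * cnj (u - w) + of_real (1 / p\<^sup>2 - 1 / q\<^sup>2) * cnj w"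
    unfolding cauchy_kernel_def p_def[symmetric] q_def[symmetric] complex_cnj_diff of_real_diff
    by (simp only: left_diff_distrib right_diff_distrib) simp
  then have "dist (cauchy_kernel \<epsilon> u) (cauchy_kernel \<epsilon> w)
      \<le> norm (of_real (1 / p\<^sup>2) * cnj (u - w)) + norm (of_real (1 / p\<^sup>2 - 1 / q\<^sup>2) * cnj w)"
    unfolding dist_norm by (simp only: norm_triangle_ineq)
  also have "\<dots> = 1 / p\<^sup>2 * dist u w + \<bar>1 / p\<^sup>2 - 1 / q\<^sup>2\<bar> * norm w"
    by (simp only: norm_mult norm_of_real complex_mod_cnj dist_norm) simp
  also have "\<dots> \<le> 1 / \<epsilon>\<^sup>2 * dist u w + (dist u w * (2 / \<epsilon>\<^sup>2) * (1 / q)) * q"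
    using p2 d pq by (intro add_mono mult_mono) auto
  also have "\<dots> = 3 / \<epsilon>\<^sup>2 * dist u w" using pq by simp
  finally show ?thesis .
qed

lemma continuous_cauchy_kernel:
  assumes "\<epsilon> > 0"
  shows "continuous_on UNIV (cauchy_kernel \<epsilon>)"
  by (rule lipschitz_on_continuous_on[of "3 / \<epsilon>\<^sup>2"])
     (auto intro!: lipschitz_onI lipschitz_cauchy_kernel assms)

lemma cauchy_kernel_has_vector_derivative:
  assumes "\<epsilon> > 0" "norm u \<noteq> \<epsilon>"
  shows "((\<lambda>t. cauchy_kernel \<epsilon> (u + t *\<^sub>R e)) has_vector_derivative cauchy_kernel_deriv \<epsilon> e u) (at 0)"
proof (cases "norm u < \<epsilon>")
  case True
  have "((\<lambda>t. of_real (1 / \<epsilon>\<^sup>2) * cnj (u + t *\<^sub>R e)) has_vector_derivative of_real (1 / \<epsilon>\<^sup>2) * cnj e) (at 0)"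
    by (intro has_vector_derivative_mult_right has_vector_derivative_along
          bounded_linear_imp_has_derivative bounded_linear_cnj)
  moreover have "open {t. norm (u + t *\<^sub>R e) < \<epsilon>}" by (intro open_Collect_less continuous_intros)
  ultimately have "((\<lambda>t. cauchy_kernel \<epsilon> (u + t *\<^sub>R e)) has_vector_derivative of_real (1 / \<epsilon>\<^sup>2) * cnj e) (at 0)"
    by (rule has_vector_derivative_transform_within_open)
       (use True in \<open>auto simp: cauchy_kernel_def max_def\<close>)
  then show ?thesis using True by (simp add: cauchy_kernel_deriv_def)
next
  case False
  with assms have u: "norm u > \<epsilon>" "u \<noteq> 0" by auto
  have "((\<lambda>z. 1 / z) has_field_derivative - 1 / u\<^sup>2) (at u)"
    using u by (auto intro!: derivative_eq_intros simp: power2_eq_square)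
  then have "((\<lambda>t. 1 / (u + t *\<^sub>R e)) has_vector_derivative - 1 / u\<^sup>2 * e) (at 0)"
    using has_vector_derivative_along[of "\<lambda>z. 1 / z" "(*) (- 1 / u\<^sup>2)" u e]
    by (simp add: has_field_derivative_def)
  moreover have "open {t. norm (u + t *\<^sub>R e) > \<epsilon>}" by (intro open_Collect_less continuous_intros)
  ultimately have "((\<lambda>t. cauchy_kernel \<epsilon> (u + t *\<^sub>R e)) has_vector_derivative - 1 / u\<^sup>2 * e) (at 0)"
    by (rule has_vector_derivative_transform_within_open)
       (use u assms in \<open>auto simp: cauchy_kernel_outside\<close>)
  then show ?thesis using False by (simp add: cauchy_kernel_deriv_def)
qed

lemma bounded_continuous_compact_support:
  fixes F :: "'a::euclidean_space \<Rightarrow> 'b::euclidean_space"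
  assumes "continuous_on UNIV F" "\<And>z. norm z > R \<Longrightarrow> F z = 0"
  obtains B where "B > 0" "\<And>z. norm (F z) \<le> B"
proof -
  have "compact (F ` cball 0 R)"
    by (intro compact_continuous_image continuous_on_subset[OF assms(1)]) auto
  then obtain B where B: "B > 0" "\<And>z. z \<in> cball 0 R \<Longrightarrow> norm (F z) \<le> B"
    using compact_imp_bounded[of "F ` cball 0 R"] unfolding bounded_pos by blast
  then have "norm (F z) \<le> B" for z
    using assms(2)[of z] by (cases "norm z \<le> R") auto
  with B(1) that show ?thesis by blast
qed

lemma AE_lborel_not_in_negligible:
  assumes "negligible N" "N \<in> sets borel"
  shows "AE z in lborel. z \<notin> N"
proof -
  have "N \<in> null_sets lborel"
    using assms by (simp add: negligible_iff_null_sets null_sets_completion_iff)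
  then show ?thesis by (rule AE_not_in)
qed

text \<open>Dyadic comparison: \<open>c n\<close> is the value of the function at radius
  \<open>\<rho> / 2 ^ Suc n\<close>. It doubles with \<open>n\<close> while the area of the
  \<open>n\<close>-th ball falls by a factor of 4, so the integrals form a geometric series. Full
  balls replace annuli.\<close>

lemma nn_integral_inverse_norm_ball_finite:
  assumes "\<rho> > 0"
  shows "(\<integral>\<^sup>+u. indicator (ball 0 \<rho>) u * ennreal (1 / norm (u::complex)) \<partial>lborel) < \<infinity>"
proof -
  define c where "c = (\<lambda>n::nat. 2 ^ Suc n / \<rho>)"
  define f where "f = (\<lambda>n (u::complex). ennreal (c n) * indicator (ball 0 (\<rho> / 2 ^ n)) u)"
  have le: "indicator (ball 0 \<rho>) u * ennreal (1 / norm u) \<le> (\<Sum>n. f n u)" for u :: complex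
  proof (cases "u \<in> ball 0 \<rho> \<and> u \<noteq> 0")
    case True
    then have u: "0 < norm u" "norm u < \<rho>" by auto
    have "(\<lambda>n. \<rho> / 2 ^ n) \<longlonglongrightarrow> 0"
      using LIMSEQ_divide_realpow_zero[of 2 \<rho>] by simp
    then have "eventually (\<lambda>n. \<rho> / 2 ^ n < norm u) sequentially"
      using u by (simp add: order_tendstoD)
    then obtain N where N: "\<rho> / 2 ^ N < norm u" by (auto simp: eventually_sequentially)
    define m where "m = (LEAST n. \<rho> / 2 ^ n < norm u)"
    have m: "\<rho> / 2 ^ m < norm u" unfolding m_def using N by (rule LeastI)
    have "m \<noteq> 0" using m u by (cases m) auto
    then obtain n where n: "m = Suc n" by (cases m) auto
    then have "\<not> \<rho> / 2 ^ n < norm u" using not_less_Least[of n "\<lambda>n. \<rho> / 2 ^ n < norm u"] by (simp add: m_def)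
    \<comment> \<open>The balls are open, so a point at distance exactly
      \<open>\<rho> / 2 ^ n\<close> is charged to the next larger ball, whose constant is precisely
      \<open>1 / norm u\<close>.\<close>
    show ?thesis
    proof (cases "norm u = \<rho> / 2 ^ n")
      case True
      have "n \<noteq> 0" using True u by (cases n) auto
      then obtain k where k: "n = Suc k" by (cases n) auto
      have "u \<in> ball 0 (\<rho> / 2 ^ k)" using True assms by (simp add: k field_simps)
      moreover have "1 / norm u \<le> c k" using True assms by (simp add: c_def k)
      ultimately have "ennreal (1 / norm u) \<le> f k u" by (simp add: f_def ennreal_leI)
      also have "\<dots> \<le> (\<Sum>n. f n u)" using sum_le_suminf[of "\<lambda>n. f n u" "{k}"] by simp
      finally show ?thesis using \<open>u \<in> ball 0 \<rho> \<and> u \<noteq> 0\<close> by simp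
    next
      case False
      then have "u \<in> ball 0 (\<rho> / 2 ^ n)" using \<open>\<not> \<rho> / 2 ^ n < norm u\<close> by simp
      moreover have "\<rho> \<le> norm u * 2 ^ Suc n" using m n by (simp add: divide_less_eq)
      then have "1 / norm u \<le> c n"
        unfolding c_def pos_le_divide_eq[OF assms] using u by (simp add: divide_le_eq mult.commute)
      ultimately have "ennreal (1 / norm u) \<le> f n u" by (simp add: f_def ennreal_leI)
      also have "\<dots> \<le> (\<Sum>n. f n u)" using sum_le_suminf[of "\<lambda>n. f n u" "{n}"] by simp
      finally show ?thesis using \<open>u \<in> ball 0 \<rho> \<and> u \<noteq> 0\<close> by simp
    qed
  next
    case False
    then have "indicator (ball 0 \<rho>) u * ennreal (1 / norm u) = 0"
      by (cases "u = 0") auto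
    then show ?thesis by (simp only: zero_le)
  qed
  have int: "(\<integral>\<^sup>+u. f n u \<partial>lborel) = ennreal (2 * pi * \<rho> * (1 / 2) ^ n)" for n
  proof -
    have "(\<integral>\<^sup>+u. f n u \<partial>lborel) = ennreal (c n) * emeasure lborel (ball (0::complex) (\<rho> / 2 ^ n))"
      unfolding f_def by (subst nn_integral_cmult_indicator) auto
    also have "emeasure lborel (ball (0::complex) (\<rho> / 2 ^ n)) = ennreal (pi * (\<rho> / 2 ^ n)\<^sup>2)"
      using assms by (subst emeasure_ball) (auto simp: unit_ball_vol_2)
    also have "ennreal (c n) * ennreal (pi * (\<rho> / 2 ^ n)\<^sup>2) = ennreal (c n * (pi * (\<rho> / 2 ^ n)\<^sup>2))"
      using assms by (intro ennreal_mult[symmetric]) (auto simp: c_def)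
    also have "c n * (pi * (\<rho> / 2 ^ n)\<^sup>2) = 2 * pi * \<rho> * (1 / 2) ^ n"
      using assms by (simp add: c_def power2_eq_square field_simps)
    finally show ?thesis .
  qed
  have "(\<integral>\<^sup>+u. indicator (ball 0 \<rho>) u * ennreal (1 / norm (u::complex)) \<partial>lborel) \<le> (\<integral>\<^sup>+u. (\<Sum>n. f n u) \<partial>lborel)"
    by (intro nn_integral_mono le)
  also have "\<dots> = (\<Sum>n. \<integral>\<^sup>+u. f n u \<partial>lborel)"
    unfolding f_def
    by (intro nn_integral_suminf borel_measurable_times_ennreal borel_measurable_const borel_measurable_indicator) auto
  also have "\<dots> = (\<Sum>n. ennreal (2 * pi * \<rho> * (1 / 2) ^ n))" by (simp add: int)
  also have "\<dots> = ennreal (\<Sum>n. 2 * pi * \<rho> * (1 / 2) ^ n)"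
    using assms by (intro suminf_ennreal2 summable_mult) (auto simp: summable_geometric_iff)
  finally show ?thesis using le_less_trans ennreal_less_top by fastforce
qed

section \<open>The Cauchy-Pompeiu formula for compactly supported functions\<close>

locale C1_compact_support =
  fixes \<phi> \<phi>x \<phi>y :: "complex \<Rightarrow> complex" and R :: real
  assumes der: "\<And>z. (\<phi> has_derivative (\<lambda>h. Re h *\<^sub>R \<phi>x z + Im h *\<^sub>R \<phi>y z)) (at z)"
    and contx: "continuous_on UNIV \<phi>x" and conty: "continuous_on UNIV \<phi>y"
    and R: "R > 0" and supp: "\<And>z. norm z > R \<Longrightarrow> \<phi> z = 0"
begin

text \<open>Twice the Wirtinger derivative of \<open>\<phi>\<close> with respect to the conjugate variable.\<close>

definition dbar2 :: "complex \<Rightarrow> complex" where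
  "dbar2 z = \<phi>x z + \<i> * \<phi>y z"

lemma cont: "continuous_on UNIV \<phi>"
  using der has_derivative_continuous by (metis continuous_at_imp_continuous_on)

lemma supp_partials:
  assumes "norm z > R"
  shows "\<phi>x z = 0" "\<phi>y z = 0"
proof -
  have "open {z::complex. norm z > R}" by (intro open_Collect_less continuous_intros)
  then have "(\<phi> has_derivative (\<lambda>h. 0)) (at z)"
    using has_derivative_transform_within_open[OF has_derivative_const, of "{z. norm z > R}" z 0 \<phi>] assms supp
    by auto
  then have "(\<lambda>h. Re h *\<^sub>R \<phi>x z + Im h *\<^sub>R \<phi>y z) = (\<lambda>h. 0)"
    using has_derivative_unique[OF der] by blast
  from fun_cong[OF this, of 1] fun_cong[OF this, of \<i>] show "\<phi>x z = 0" "\<phi>y z = 0" by simp_all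
qed

lemma continuous_dbar2: "continuous_on UNIV dbar2"
  unfolding dbar2_def by (intro continuous_intros contx conty)

lemma dbar2_supp: "norm z > R \<Longrightarrow> dbar2 z = 0"
  by (simp add: dbar2_def supp_partials)

lemma lipschitz:
  obtains C where "C-lipschitz_on UNIV \<phi>"
proof -
  obtain B1 where B1: "B1 > 0" "\<And>z. norm (\<phi>x z) \<le> B1"
    using bounded_continuous_compact_support[OF contx supp_partials(1)] by blast
  obtain B2 where B2: "B2 > 0" "\<And>z. norm (\<phi>y z) \<le> B2"
    using bounded_continuous_compact_support[OF conty supp_partials(2)] by blast
  have "(B1 + B2)-lipschitz_on UNIV \<phi>"
  proof (rule bounded_derivative_imp_lipschitz)
    fix z
    show "(\<phi> has_derivative (\<lambda>h. Re h *\<^sub>R \<phi>x z + Im h *\<^sub>R \<phi>y z)) (at z within UNIV)" by (rule der)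
    show "onorm (\<lambda>h. Re h *\<^sub>R \<phi>x z + Im h *\<^sub>R \<phi>y z) \<le> B1 + B2"
    proof (rule onorm_le)
      fix h
      have "norm (Re h *\<^sub>R \<phi>x z + Im h *\<^sub>R \<phi>y z) \<le> \<bar>Re h\<bar> * norm (\<phi>x z) + \<bar>Im h\<bar> * norm (\<phi>y z)"
        using norm_triangle_ineq[of "Re h *\<^sub>R \<phi>x z" "Im h *\<^sub>R \<phi>y z"] by simp
      also have "\<dots> \<le> norm h * B1 + norm h * B2"
        using B1 B2 abs_Re_le_cmod[of h] abs_Im_le_cmod[of h] by (intro add_mono mult_mono) auto
      finally show "norm (Re h *\<^sub>R \<phi>x z + Im h *\<^sub>R \<phi>y z) \<le> (B1 + B2) * norm h"
        by (simp add: algebra_simps)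
    qed
  qed (use B1 B2 in auto)
  then show ?thesis using that by blast
qed

text \<open>The product of \<open>\<phi>\<close> with the truncated kernel is Lipschitz with compact
  support, so its \<partial>_x + i \<partial>_y derivative has integral zero. By the product rule
  the kernel contributes nothing outside the disc, where it is holomorphic, and
  \<open>- 2 / \<epsilon>\<^sup>2\<close> inside; the sign comes from the argument
  \<open>z - a\<close>.\<close>

lemma regularised_cauchy_pompeiu:
  assumes \<epsilon>: "\<epsilon> > 0"
  shows "(\<integral>a. dbar2 a * cauchy_kernel \<epsilon> (z - a) \<partial>lborel)
       = of_real (2 / \<epsilon>\<^sup>2) * (\<integral>a. indicator (ball z \<epsilon>) a *\<^sub>R \<phi> a \<partial>lborel)"
proof -
  define F where "F = (\<lambda>a. \<phi> a * cauchy_kernel \<epsilon> (z - a))"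
  define F' where "F' = (\<lambda>e a. \<phi> a * cauchy_kernel_deriv \<epsilon> (- e) (z - a)
      + (Re e *\<^sub>R \<phi>x a + Im e *\<^sub>R \<phi>y a) * cauchy_kernel \<epsilon> (z - a))"
  obtain C where C: "C-lipschitz_on UNIV \<phi>" using lipschitz by blast
  obtain B where B: "B > 0" "\<And>a. norm (\<phi> a) \<le> B"
    using bounded_continuous_compact_support[OF cont supp] by blast
  have C0: "C \<ge> 0" using C lipschitz_on_nonneg by blast
  have lipF: "(C * (1 / \<epsilon>) + B * (3 / \<epsilon>\<^sup>2))-lipschitz_on UNIV F"
  proof (rule lipschitz_onI)
    fix a b
    have "F a - F b = (\<phi> a - \<phi> b) * cauchy_kernel \<epsilon> (z - a)
        + \<phi> b * (cauchy_kernel \<epsilon> (z - a) - cauchy_kernel \<epsilon> (z - b))"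
      by (simp add: F_def algebra_simps)
    then have "dist (F a) (F b) \<le> dist (\<phi> a) (\<phi> b) * norm (cauchy_kernel \<epsilon> (z - a))
        + norm (\<phi> b) * dist (cauchy_kernel \<epsilon> (z - a)) (cauchy_kernel \<epsilon> (z - b))"
      unfolding dist_norm by (metis norm_mult norm_triangle_ineq)
    also have "\<dots> \<le> (C * dist a b) * (1 / \<epsilon>) + B * (3 / \<epsilon>\<^sup>2 * dist (z - a) (z - b))"
      using lipschitz_onD[OF C, of a b] norm_cauchy_kernel_le(1)[OF \<epsilon>] B lipschitz_cauchy_kernel[OF \<epsilon>] C0
      by (intro add_mono mult_mono) auto
    also have "dist (z - a) (z - b) = dist a b" by (simp add: dist_norm norm_minus_commute)
    finally show "dist (F a) (F b) \<le> (C * (1 / \<epsilon>) + B * (3 / \<epsilon>\<^sup>2)) * dist a b"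
      by (simp add: algebra_simps)
  qed (use C0 B \<epsilon> in auto)
  have [measurable]: "\<phi> \<in> borel_measurable borel" "\<phi>x \<in> borel_measurable borel"
    "\<phi>y \<in> borel_measurable borel" "cauchy_kernel \<epsilon> \<in> borel_measurable borel"
    using cont contx conty continuous_cauchy_kernel[OF \<epsilon>] by (auto intro: borel_measurable_continuous_onI)
  have [measurable]: "cauchy_kernel_deriv \<epsilon> e \<in> borel_measurable borel" for e
    unfolding cauchy_kernel_deriv_def by measurable
  have meas: "F' e \<in> borel_measurable borel" for e
    unfolding F'_def by measurable
  have "AE a in lborel. a \<notin> sphere z \<epsilon>"
    by (intro AE_lborel_not_in_negligible negligible_sphere) auto
  then have derF: "AE a in lborel. ((\<lambda>t. F (a + t *\<^sub>R e)) has_vector_derivative F' e a) (at 0)" for e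
  proof eventually_elim
    case (elim a)
    then have "norm (z - a) \<noteq> \<epsilon>" by (simp add: dist_norm)
    from cauchy_kernel_has_vector_derivative[OF \<epsilon> this, of "- e"]
    have "((\<lambda>t. cauchy_kernel \<epsilon> (z - (a + t *\<^sub>R e))) has_vector_derivative cauchy_kernel_deriv \<epsilon> (- e) (z - a)) (at 0)"
      by (simp add: algebra_simps)
    from has_vector_derivative_mult[OF has_vector_derivative_along[OF der[of a], of e] this]
    show ?case by (simp add: F_def F'_def)
  qed
  have suppF: "F a = 0" if "norm a > R" for a using supp[OF that] by (simp add: F_def)
  have zero: "integrable lborel (F' e)" "(\<integral>a. F' e a \<partial>lborel) = 0" for e
    using integral_directional_derivative_eq_0[of _ F R "F' e" e] lipF suppF meas derF by blast+
  have "dbar2 a * cauchy_kernel \<epsilon> (z - a)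
      = F' 1 a + \<i> * F' \<i> a + of_real (2 / \<epsilon>\<^sup>2) * (indicator (ball z \<epsilon>) a *\<^sub>R \<phi> a)" for a
  proof (cases "norm (z - a) < \<epsilon>")
    case True
    then have "a \<in> ball z \<epsilon>" by (simp add: dist_norm)
    then show ?thesis using True
      by (simp add: F'_def dbar2_def cauchy_kernel_deriv_def algebra_simps)
  next
    case False
    then have "a \<notin> ball z \<epsilon>" by (simp add: dist_norm)
    then show ?thesis using False
      by (simp add: F'_def dbar2_def cauchy_kernel_deriv_def algebra_simps)
  qed
  then have "(\<integral>a. dbar2 a * cauchy_kernel \<epsilon> (z - a) \<partial>lborel)
      = (\<integral>a. F' 1 a + \<i> * F' \<i> a + of_real (2 / \<epsilon>\<^sup>2) * (indicator (ball z \<epsilon>) a *\<^sub>R \<phi> a) \<partial>lborel)"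
    by (simp only:)
  also have "\<dots> = (\<integral>a. F' 1 a + \<i> * F' \<i> a \<partial>lborel)
      + (\<integral>a. of_real (2 / \<epsilon>\<^sup>2) * (indicator (ball z \<epsilon>) a *\<^sub>R \<phi> a) \<partial>lborel)"
    using zero integrable_mult_indicator[of "ball z \<epsilon>" lborel \<phi>]
      integrable_continuous_compact_support[OF cont supp]
    by (intro Bochner_Integration.integral_add Bochner_Integration.integrable_add integrable_mult_right) auto
  also have "(\<integral>a. F' 1 a + \<i> * F' \<i> a \<partial>lborel) = 0" using zero by simp
  finally show ?thesis by (simp only: integral_mult_right_zero add_0_left)
qed

text \<open>The singularity is integrable in the plane. Uniformity in \<open>z\<close> is what the
  exchange of integrals along a path will require; it holds because \<open>z - a\<close> stays in
  one fixed ball and Lebesgue measure is invariant under \<open>a \<mapsto> z - a\<close>.\<close>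

lemma nn_integral_dbar2_kernel_bound:
  obtains C where "C < \<infinity>" "\<And>z. norm z \<le> R \<Longrightarrow> (\<integral>\<^sup>+a. ennreal (norm (dbar2 a / (z - a))) \<partial>lborel) \<le> C"
proof -
  obtain B where B: "B > 0" "\<And>a. norm (dbar2 a) \<le> B"
    using bounded_continuous_compact_support[OF continuous_dbar2 dbar2_supp] by blast
  define I where "I = (\<integral>\<^sup>+u. indicator (ball 0 (2 * R + 1)) u * ennreal (1 / norm (u::complex)) \<partial>lborel)"
  have "(\<lambda>u::complex. 1 / norm u) \<in> borel_measurable borel"
    by (intro borel_measurable_divide borel_measurable_const borel_measurable_norm)
  then have meas: "(\<lambda>u. indicator (ball 0 (2 * R + 1)) u * ennreal (1 / norm (u::complex))) \<in> borel_measurable borel"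
    by (intro borel_measurable_times_ennreal borel_measurable_indicator
          measurable_compose[OF _ measurable_ennreal]) auto
  have "(\<lambda>a. z - a) \<in> borel_measurable borel" for z :: complex by measurable
  from measurable_compose[OF this meas]
  have meas': "(\<lambda>a. indicator (ball 0 (2 * R + 1)) (z - a) * ennreal (1 / norm (z - a))) \<in> borel_measurable lborel"
    for z :: complex by simp
  have "I < \<infinity>" unfolding I_def using R by (intro nn_integral_inverse_norm_ball_finite) simp
  then have "ennreal B * I < \<infinity>" by (simp add: ennreal_mult_less_top)
  moreover have "(\<integral>\<^sup>+a. ennreal (norm (dbar2 a / (z - a))) \<partial>lborel) \<le> ennreal B * I" if z: "norm z \<le> R" for z
  proof -
    have "ennreal (norm (dbar2 a / (z - a)))
        \<le> ennreal B * (indicator (ball 0 (2 * R + 1)) (z - a) * ennreal (1 / norm (z - a)))" for a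
    proof (cases "norm a > R")
      case False
      then have "norm (z - a) < 2 * R + 1" using z norm_triangle_ineq4[of z a] by simp
      then have "z - a \<in> ball 0 (2 * R + 1)" by simp
      moreover have "norm (dbar2 a / (z - a)) \<le> B * (1 / norm (z - a))"
        using mult_right_mono[OF B(2)[of a], of "1 / norm (z - a)"] by (simp add: norm_divide)
      then have "ennreal (norm (dbar2 a / (z - a))) \<le> ennreal B * ennreal (1 / norm (z - a))"
        using B by (simp add: ennreal_mult[symmetric] ennreal_leI)
      ultimately show ?thesis by simp
    qed (simp add: dbar2_supp)
    then have "(\<integral>\<^sup>+a. ennreal (norm (dbar2 a / (z - a))) \<partial>lborel)
        \<le> (\<integral>\<^sup>+a. ennreal B * (indicator (ball 0 (2 * R + 1)) (z - a) * ennreal (1 / norm (z - a))) \<partial>lborel)"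
      by (intro nn_integral_mono)
    also have "\<dots> = ennreal B * (\<integral>\<^sup>+a. indicator (ball 0 (2 * R + 1)) (z - a) * ennreal (1 / norm (z - a)) \<partial>lborel)"
      by (rule nn_integral_cmult[OF meas'])
    also have "(\<integral>\<^sup>+a. indicator (ball 0 (2 * R + 1)) (z - a) * ennreal (1 / norm (z - a)) \<partial>lborel) = I"
      unfolding I_def by (rule nn_integral_lborel_reflect[OF meas])
    finally show ?thesis .
  qed
  ultimately show ?thesis using that by blast
qed

lemma measurable_dbar2 [measurable]: "dbar2 \<in> borel_measurable borel"
  by (rule borel_measurable_continuous_onI[OF continuous_dbar2])

text \<open>Let the truncation radius tend to 0. The truncated kernels are dominated by
  \<open>1 / norm (z - a)\<close>, while the disc has area \<open>pi * \<epsilon>\<^sup>2\<close>,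
  so that the factor \<open>2 / \<epsilon>\<^sup>2\<close> leaves \<open>2 * pi\<close> times a mean
  value of \<open>\<phi>\<close>.\<close>

lemma cauchy_pompeiu:
  assumes z: "norm z \<le> R"
  shows "(\<integral>a. dbar2 a / (z - a) \<partial>lborel) = of_real (2 * pi) * \<phi> z"
proof -
  define \<epsilon> where "\<epsilon> = (\<lambda>n. 1 / real (Suc n))"
  have \<epsilon>: "\<epsilon> n > 0" for n by (simp add: \<epsilon>_def)
  have \<epsilon>0: "\<epsilon> \<longlonglongrightarrow> 0" unfolding \<epsilon>_def using LIMSEQ_inverse_real_of_nat[unfolded inverse_eq_divide] .
  have int: "integrable lborel (\<lambda>a. dbar2 a / (z - a))"
  proof (rule integrableI_bounded)
    obtain C where "C < \<infinity>" "(\<integral>\<^sup>+a. ennreal (norm (dbar2 a / (z - a))) \<partial>lborel) \<le> C"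
      using nn_integral_dbar2_kernel_bound z by metis
    then show "(\<integral>\<^sup>+a. ennreal (norm (dbar2 a / (z - a))) \<partial>lborel) < \<infinity>" by (rule le_less_trans[rotated])
  qed measurable
  have [measurable]: "cauchy_kernel (\<epsilon> n) \<in> borel_measurable borel" for n
    by (rule borel_measurable_continuous_onI[OF continuous_cauchy_kernel[OF \<epsilon>]])
  have "(\<lambda>n. \<integral>a. dbar2 a * cauchy_kernel (\<epsilon> n) (z - a) \<partial>lborel) \<longlonglongrightarrow> (\<integral>a. dbar2 a / (z - a) \<partial>lborel)"
  proof (rule integral_dominated_convergence)
    show "integrable lborel (\<lambda>a. norm (dbar2 a / (z - a)))" using int by (rule integrable_norm)
    show "AE a in lborel. norm (dbar2 a * cauchy_kernel (\<epsilon> n) (z - a)) \<le> norm (dbar2 a / (z - a))" for n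
    proof (rule AE_I2)
      fix a
      show "norm (dbar2 a * cauchy_kernel (\<epsilon> n) (z - a)) \<le> norm (dbar2 a / (z - a))"
        using mult_left_mono[OF norm_cauchy_kernel_le(2)[OF \<epsilon>], of "norm (dbar2 a)" n "z - a"]
        by (simp add: norm_mult norm_divide)
    qed
    have "(\<lambda>n. dbar2 a * cauchy_kernel (\<epsilon> n) (z - a)) \<longlonglongrightarrow> dbar2 a / (z - a)" if "a \<noteq> z" for a
    proof (rule tendsto_eventually)
      have "eventually (\<lambda>n. \<epsilon> n < norm (z - a)) sequentially"
        using \<epsilon>0 that by (intro order_tendstoD) auto
      then show "eventually (\<lambda>n. dbar2 a * cauchy_kernel (\<epsilon> n) (z - a) = dbar2 a / (z - a)) sequentially"
        by eventually_elim (simp add: cauchy_kernel_outside \<epsilon>)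
    qed
    moreover have "AE a in lborel. a \<notin> {z}" by (intro AE_lborel_not_in_negligible) auto
    ultimately show "AE a in lborel. (\<lambda>n. dbar2 a * cauchy_kernel (\<epsilon> n) (z - a)) \<longlonglongrightarrow> dbar2 a / (z - a)"
      by (auto elim: eventually_mono)
  qed measurable
  moreover have "(\<lambda>n. \<integral>a. dbar2 a * cauchy_kernel (\<epsilon> n) (z - a) \<partial>lborel) \<longlonglongrightarrow> of_real (2 * pi) * \<phi> z"
  proof (rule LIMSEQ_I)
    fix r :: real assume r: "r > 0"
    \<comment> \<open>The mean value carries the factor
      \<open>2 / e\<^sup>2 * (pi * e\<^sup>2) = 2 * pi\<close>, which turns this tolerance into
      \<open>r / 2\<close>.\<close>
    then have "r / (4 * pi) > 0" by simp
    moreover have "isCont \<phi> z" using cont by (simp add: continuous_on_eq_continuous_at)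
    ultimately obtain d where d: "d > 0" "\<And>a. dist a z < d \<Longrightarrow> dist (\<phi> a) (\<phi> z) < r / (4 * pi)"
      unfolding continuous_at_eps_delta by metis
    have "eventually (\<lambda>n. \<epsilon> n < d) sequentially" using \<epsilon>0 d by (intro order_tendstoD) auto
    then obtain N where N: "\<And>n. n \<ge> N \<Longrightarrow> \<epsilon> n < d" by (auto simp: eventually_sequentially)
    have "norm ((\<integral>a. dbar2 a * cauchy_kernel (\<epsilon> n) (z - a) \<partial>lborel) - of_real (2 * pi) * \<phi> z) < r" if n: "n \<ge> N" for n
    proof -
      define e where "e = \<epsilon> n"
      have e: "e > 0" "e < d" using \<epsilon> N[OF n] by (auto simp: e_def)
      have ball: "measure lborel (ball z e) = pi * e\<^sup>2"
        using e by (subst content_ball) (auto simp: unit_ball_vol_2)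
      have i1: "integrable lborel (\<lambda>a. indicator (ball z e) a *\<^sub>R \<phi> a)"
        using integrable_mult_indicator[of "ball z e" lborel \<phi>] integrable_continuous_compact_support[OF cont supp]
        by simp
      have i0: "integrable lborel (\<lambda>a. indicator (ball z e) a :: real)"
        by (rule integrable_real_indicator[OF _ emeasure_lborel_ball_finite]) simp
      have i2: "integrable lborel (\<lambda>a. indicator (ball z e) a *\<^sub>R \<phi> z)"
        using i0 by (rule integrable_scaleR_left)
      have "(\<integral>a. indicator (ball z e) a *\<^sub>R \<phi> z \<partial>lborel) = (pi * e\<^sup>2) *\<^sub>R \<phi> z"
        using i0 ball by simp
      moreover have "of_real (2 * pi) * \<phi> z = of_real (2 / e\<^sup>2) * ((pi * e\<^sup>2) *\<^sub>R \<phi> z)"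
        using e by (simp add: scaleR_conv_of_real field_simps)
      ultimately have "of_real (2 * pi) * \<phi> z = of_real (2 / e\<^sup>2) * (\<integral>a. indicator (ball z e) a *\<^sub>R \<phi> z \<partial>lborel)"
        by (simp only:)
      then have "(\<integral>a. dbar2 a * cauchy_kernel e (z - a) \<partial>lborel) - of_real (2 * pi) * \<phi> z
          = of_real (2 / e\<^sup>2) * (\<integral>a. indicator (ball z e) a *\<^sub>R (\<phi> a - \<phi> z) \<partial>lborel)"
        using i1 i2 by (simp only: regularised_cauchy_pompeiu[OF e(1)] scaleR_diff_right
          Bochner_Integration.integral_diff right_diff_distrib)
      also have "norm \<dots> \<le> (2 / e\<^sup>2) * ((r / (4 * pi)) * (pi * e\<^sup>2))"
      proof -
        have "norm (\<integral>a. indicator (ball z e) a *\<^sub>R (\<phi> a - \<phi> z) \<partial>lborel)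
            \<le> (\<integral>a. indicator (ball z e) a * (r / (4 * pi)) \<partial>lborel)"
        proof (rule Bochner_Integration.integral_norm_bound_integral)
          show "integrable lborel (\<lambda>a. indicator (ball z e) a *\<^sub>R (\<phi> a - \<phi> z))"
            using i1 i2 by (simp add: scaleR_diff_right)
          show "integrable lborel (\<lambda>a. indicator (ball z e) a * (r / (4 * pi)))" using i0 by simp
          show "norm (indicator (ball z e) a *\<^sub>R (\<phi> a - \<phi> z)) \<le> indicator (ball z e) a * (r / (4 * pi))" for a
            using d(2)[of a] e by (auto simp: indicator_def dist_norm norm_minus_commute)
        qed
        also have "\<dots> = (r / (4 * pi)) * (pi * e\<^sup>2)" using i0 ball by simp
        finally show ?thesis unfolding norm_mult norm_of_real using e by (intro mult_mono) auto
      qed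
      also have "\<dots> = r / 2" using e by (simp add: field_simps)
      also have "\<dots> < r" using r by simp
      finally show ?thesis by (simp add: e_def)
    qed
    then show "\<exists>N. \<forall>n\<ge>N. norm ((\<integral>a. dbar2 a * cauchy_kernel (\<epsilon> n) (z - a) \<partial>lborel) - of_real (2 * pi) * \<phi> z) < r"
      by blast
  qed
  ultimately show ?thesis by (rule LIMSEQ_unique)
qed

end

section \<open>Fubini along paths and Green's theorem\<close>

context C1_compact_support
begin

text \<open>The Cauchy-Pompeiu formula is integrated against \<open>g' t\<close> and the integrals
  are exchanged; the uniform kernel bound gives absolute integrability. Functions on the whole line
  make the joint integrand Borel measurable.\<close>

lemma fubini_along_arc:
  fixes g g' :: "real \<Rightarrow> complex"
  assumes g: "continuous_on UNIV g" "continuous_on UNIV g'" "\<And>t. norm (g t) \<le> R"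
  defines "J \<equiv> \<lambda>a. \<integral>t. indicator {0..1} t *\<^sub>R (g' t / (g t - a)) \<partial>lborel"
  shows "integrable lborel (\<lambda>a. dbar2 a * J a)"
    and "(\<integral>a. dbar2 a * J a \<partial>lborel) = of_real (2 * pi) * (\<integral>t. indicator {0..1} t *\<^sub>R (\<phi> (g t) * g' t) \<partial>lborel)"
proof -
  define f where "f = (\<lambda>t a. (indicator {0..1} t *\<^sub>R g' t) * (dbar2 a / (g t - a)))"
  have [measurable]: "g \<in> borel_measurable borel" "g' \<in> borel_measurable borel"
    using g by (auto intro: borel_measurable_continuous_onI)
  have meas: "case_prod f \<in> borel_measurable (lborel \<Otimes>\<^sub>M lborel)"
    unfolding f_def by measurable
  obtain C where C: "C < \<infinity>" "\<And>z. norm z \<le> R \<Longrightarrow> (\<integral>\<^sup>+a. ennreal (norm (dbar2 a / (z - a))) \<partial>lborel) \<le> C"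
    using nn_integral_dbar2_kernel_bound by blast
  have "compact (g' ` {0..1})" using g by (intro compact_continuous_image continuous_on_subset[OF g(2)]) auto
  then obtain B where B: "B > 0" "\<And>t. t \<in> {0..1} \<Longrightarrow> norm (g' t) \<le> B"
    using compact_imp_bounded[of "g' ` {0..1}"] unfolding bounded_pos by blast
  have inner: "(\<integral>\<^sup>+a. ennreal (norm (f t a)) \<partial>lborel) \<le> ennreal B * C * indicator {0..1} t" for t
  proof (cases "t \<in> {0..1}")
    case True
    have m: "(\<lambda>a. ennreal (norm (dbar2 a / (g t - a)))) \<in> borel_measurable lborel" by measurable
    have "(\<integral>\<^sup>+a. ennreal (norm (f t a)) \<partial>lborel) = (\<integral>\<^sup>+a. ennreal (norm (g' t)) * ennreal (norm (dbar2 a / (g t - a))) \<partial>lborel)"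
      using True by (intro nn_integral_cong) (simp add: f_def norm_mult norm_divide ennreal_mult[symmetric])
    also have "\<dots> = ennreal (norm (g' t)) * (\<integral>\<^sup>+a. ennreal (norm (dbar2 a / (g t - a))) \<partial>lborel)"
      by (rule nn_integral_cmult[OF m])
    also have "\<dots> \<le> ennreal B * C" using B(2)[OF True] C(2)[OF g(3)] by (intro mult_mono ennreal_leI) auto
    finally show ?thesis using True by simp
  qed (simp add: f_def)
  have int: "integrable (lborel \<Otimes>\<^sub>M lborel) (case_prod f)"
  proof (rule integrableI_bounded[OF meas])
    have "(\<integral>\<^sup>+p. ennreal (norm (case_prod f p)) \<partial>(lborel \<Otimes>\<^sub>M lborel))
        = (\<integral>\<^sup>+t. \<integral>\<^sup>+a. ennreal (norm (f t a)) \<partial>lborel \<partial>lborel)"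
      using lborel.nn_integral_fst[of "\<lambda>p. ennreal (norm (case_prod f p))" lborel] meas by simp
    also have "\<dots> \<le> (\<integral>\<^sup>+t. ennreal B * C * indicator {0..1} (t::real) \<partial>lborel)"
      by (intro nn_integral_mono inner)
    also have "\<dots> = ennreal B * C" by (subst nn_integral_cmult_indicator) auto
    also have "\<dots> < \<infinity>" using C(1) by (simp add: ennreal_mult_less_top)
    finally show "(\<integral>\<^sup>+p. ennreal (norm (case_prod f p)) \<partial>(lborel \<Otimes>\<^sub>M lborel)) < \<infinity>" .
  qed
  have snd: "(\<integral>t. f t a \<partial>lborel) = dbar2 a * J a" for a
  proof -
    have "(\<integral>t. f t a \<partial>lborel) = (\<integral>t. dbar2 a * (indicator {0..1} t *\<^sub>R (g' t / (g t - a))) \<partial>lborel)"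
      by (intro Bochner_Integration.integral_cong refl) (simp add: f_def scaleR_conv_of_real mult_ac)
    then show ?thesis by (simp only: integral_mult_right_zero J_def)
  qed
  have fst: "(\<integral>a. f t a \<partial>lborel) = of_real (2 * pi) * (indicator {0..1} t *\<^sub>R (\<phi> (g t) * g' t))" for t
    unfolding f_def integral_mult_right_zero cauchy_pompeiu[OF g(3)] by simp
  show "integrable lborel (\<lambda>a. dbar2 a * J a)"
    using lborel_pair.integrable_snd[OF int] by (simp only: snd)
  have "(\<integral>a. \<integral>t. f t a \<partial>lborel \<partial>lborel) = (\<integral>t. \<integral>a. f t a \<partial>lborel \<partial>lborel)"
    by (rule lborel_pair.Fubini_integral[OF int])
  then show "(\<integral>a. dbar2 a * J a \<partial>lborel) = of_real (2 * pi) * (\<integral>t. indicator {0..1} t *\<^sub>R (\<phi> (g t) * g' t) \<partial>lborel)"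
    by (simp only: snd fst integral_mult_right_zero)
qed

end

lemma contour_integral_eq_lborel_integral:
  assumes der: "\<And>t. t \<in> {0..1} \<Longrightarrow> (p has_vector_derivative p' t) (at t)"
    and "continuous_on {0..1} p'" "continuous_on (path_image p) f"
  shows "contour_integral p f = (\<integral>t. indicator {0..1} t *\<^sub>R (f (p t) * p' t) \<partial>lborel)"
proof -
  have "continuous_on {0..1} p"
    using der by (meson continuous_on_eq_continuous_within has_vector_derivative_at_within
      has_vector_derivative_continuous)
  then have "continuous_on {0..1} (\<lambda>t. f (p t) * p' t)"
    using assms by (intro continuous_intros continuous_on_compose2[OF assms(3)]) (auto simp: path_image_def)
  then have "set_integrable lborel {0..1} (\<lambda>t. f (p t) * p' t)" by (rule borel_integrable_atLeastAtMost')
  then have "(LINT t:{0..1}|lborel. f (p t) * p' t) = integral {0..1} (\<lambda>t. f (p t) * p' t)"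
    by (rule set_borel_integral_eq_integral)
  also have "\<dots> = contour_integral p f"
    unfolding contour_integral_integral
    by (intro integral_cong) (simp add: vector_derivative_at[OF der])
  finally show ?thesis by (simp add: set_lebesgue_integral_def)
qed

lemma negligible_C1_path_image:
  fixes p :: "real \<Rightarrow> complex"
  assumes "\<And>t. t \<in> {0..1} \<Longrightarrow> (p has_vector_derivative p' t) (at t)"
  shows "negligible (path_image p)"
  unfolding path_image_def
proof (rule negligible_differentiable_image_lowdim)
  show "p differentiable_on {0..1}"
    unfolding differentiable_on_def
    using assms differentiableI_vector differentiable_at_withinI by blast
qed simp

text \<open>\<open>J\<close> is left abstract and identified with the Cauchy integral only off the
  path: on the path the integrand is singular, but the path is a null set.\<close>

lemma (in C1_compact_support) contour_integral_eq_area_integral: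
  assumes der: "\<And>t. t \<in> {0..1} \<Longrightarrow> (p has_vector_derivative p' t) (at t)"
    and cont': "continuous_on {0..1} p'" and img: "path_image p \<subseteq> cball 0 R"
  obtains J where "integrable lborel (\<lambda>a. dbar2 a * J a)"
    "\<And>a. a \<notin> path_image p \<Longrightarrow> J a = contour_integral p (\<lambda>w. 1 / (w - a))"
    "of_real (2 * pi) * contour_integral p \<phi> = (\<integral>a. dbar2 a * J a \<partial>lborel)"
proof -
  \<comment> \<open>The path and its derivative are controlled only on \<open>{0..1}\<close>;
    clamping the parameter extends both continuously without affecting the integrals.\<close>
  define c where "c = (\<lambda>t::real. max 0 (min 1 t))"
  have c: "c t \<in> {0..1}" for t by (auto simp: c_def)
  have cid: "c t = t" if "t \<in> {0..1}" for t using that by (auto simp: c_def)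
  have contc: "continuous_on UNIV c" unfolding c_def by (intro continuous_intros)
  have contp: "continuous_on {0..1} p"
    using der by (meson continuous_on_eq_continuous_within has_vector_derivative_at_within
      has_vector_derivative_continuous)
  have g: "continuous_on UNIV (\<lambda>t. p (c t))" "continuous_on UNIV (\<lambda>t. p' (c t))"
    using c by (auto intro!: continuous_on_compose2[OF contp contc] continuous_on_compose2[OF cont' contc])
  have gR: "norm (p (c t)) \<le> R" for t using img c[of t] unfolding path_image_def by (metis image_subset_iff mem_cball_0)
  have ind: "indicator {0..1} t *\<^sub>R F (c t) = indicator {0..1} t *\<^sub>R (F t :: complex)" for t F
    by (cases "t \<in> {0..1}") (simp_all add: cid)
  define J where "J = (\<lambda>a. \<integral>t. indicator {0..1} t *\<^sub>R (p' t / (p t - a)) \<partial>lborel)"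
  note F = fubini_along_arc[OF g gR]
  have J: "(\<integral>t. indicator {0..1} t *\<^sub>R (p' (c t) / (p (c t) - a)) \<partial>lborel) = J a" for a
    unfolding J_def by (intro Bochner_Integration.integral_cong refl ind[of _ "\<lambda>t. p' t / (p t - a)"])
  show ?thesis
  proof (rule that)
    show "integrable lborel (\<lambda>a. dbar2 a * J a)" using F(1) by (simp only: J)
    show "J a = contour_integral p (\<lambda>w. 1 / (w - a))" if "a \<notin> path_image p" for a
      unfolding J_def
      by (subst contour_integral_eq_lborel_integral[OF der cont']) (use that in \<open>auto intro!: continuous_intros\<close>)
    have "of_real (2 * pi) * contour_integral p \<phi>
        = of_real (2 * pi) * (\<integral>t. indicator {0..1} t *\<^sub>R (\<phi> (p t) * p' t) \<partial>lborel)"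
      using contour_integral_eq_lborel_integral[OF der cont' continuous_on_subset[OF cont]] by simp
    also have "\<dots> = (\<integral>a. dbar2 a * J a \<partial>lborel)"
      using F(2) by (simp only: J ind[of _ "\<lambda>t. \<phi> (p t) * p' t"])
    finally show "of_real (2 * pi) * contour_integral p \<phi> = (\<integral>a. dbar2 a * J a \<partial>lborel)" .
  qed
qed

text \<open>The pieces are treated separately because the closed curve may have corners. Off the
  curve the inner integrals of \<open>p\<close> and \<open>q\<close> add up to 2 pi i times its
  winding number, which is -1, 0 or 1 and vanishes outside the disc; the plane integral thus reduces
  to the disc with weight at most one.\<close>

lemma (in C1_compact_support) circulation_bound:
  assumes p: "\<And>t. t \<in> {0..1} \<Longrightarrow> (p has_vector_derivative p' t) (at t)" "continuous_on {0..1} p'"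
    and q: "\<And>t. t \<in> {0..1} \<Longrightarrow> (q has_vector_derivative q' t) (at t)" "continuous_on {0..1} q'"
    and simple: "simple_path (p +++ q)" "pathfinish p = pathstart q" "pathfinish q = pathstart p"
    and img: "path_image p \<subseteq> cball 0 \<rho>" "path_image q \<subseteq> cball 0 \<rho>" and \<rho>: "\<rho> \<le> R"
  shows "\<bar>Re (contour_integral p \<phi> + contour_integral q \<phi>)\<bar>
       \<le> (\<integral>a. indicator (ball 0 \<rho>) a * \<bar>Im (dbar2 a)\<bar> \<partial>lborel)"
proof -
  have pi2: "0 < 2 * pi" by simp
  have imgR: "path_image p \<subseteq> cball 0 R" "path_image q \<subseteq> cball 0 R"
    using img \<rho> by (meson subset_cball order_trans)+
  obtain P where P: "integrable lborel (\<lambda>a. dbar2 a * P a)"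
    "\<And>a. a \<notin> path_image p \<Longrightarrow> P a = contour_integral p (\<lambda>w. 1 / (w - a))"
    "of_real (2 * pi) * contour_integral p \<phi> = (\<integral>a. dbar2 a * P a \<partial>lborel)"
    using contour_integral_eq_area_integral[OF p imgR(1)] by blast
  obtain Q where Q: "integrable lborel (\<lambda>a. dbar2 a * Q a)"
    "\<And>a. a \<notin> path_image q \<Longrightarrow> Q a = contour_integral q (\<lambda>w. 1 / (w - a))"
    "of_real (2 * pi) * contour_integral q \<phi> = (\<integral>a. dbar2 a * Q a \<partial>lborel)"
    using contour_integral_eq_area_integral[OF q imgR(2)] by blast
  have "p C1_differentiable_on {0..1}" "q C1_differentiable_on {0..1}"
    unfolding C1_differentiable_on_def using p q by blast+
  then have valid: "valid_path p" "valid_path q"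
    by (auto simp: valid_path_def intro: C1_differentiable_imp_piecewise)
  note paths = valid[THEN valid_path_imp_path]
  \<comment> \<open>The circle is discarded too: the winding number is shown to vanish only off the
    closed disc, while the bound integrates over the open one.\<close>
  define N where "N = path_image p \<union> path_image q \<union> sphere 0 \<rho>"
  have "closed (path_image p)" "closed (path_image q)" using paths by (auto simp: closed_path_image)
  then have "AE a in lborel. a \<notin> N"
    unfolding N_def
    by (intro AE_lborel_not_in_negligible negligible_Un negligible_sphere
          negligible_C1_path_image[OF p(1)] negligible_C1_path_image[OF q(1)]) auto
  then have le: "AE a in lborel. \<bar>Re (dbar2 a * (P a + Q a))\<bar> \<le> 2 * pi * (indicator (ball 0 \<rho>) a * \<bar>Im (dbar2 a)\<bar>)"
  proof eventually_elim
    case (elim a)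
    then have a: "a \<notin> path_image p" "a \<notin> path_image q" "norm a \<noteq> \<rho>" by (auto simp: N_def)
    define n where "n = winding_number (p +++ q) a"
    have "n = winding_number p a + winding_number q a"
      unfolding n_def using a paths simple by (intro winding_number_join) auto
    then have PQ: "P a + Q a = of_real (2 * pi) * \<i> * n"
      using a valid by (simp add: P(2) Q(2) winding_number_valid_path field_simps)
    have img_join: "path_image (p +++ q) \<subseteq> path_image p \<union> path_image q" by (rule path_image_join_subset)
    have n: "n \<in> {-1, 0, 1}"
      unfolding n_def using simple a img_join by (intro simple_closed_path_winding_number_cases) auto
    have n0: "n = 0" if "a \<notin> ball 0 \<rho>"
    proof -
      have "a \<notin> cball 0 \<rho>" using that a(3) unfolding mem_ball_0 mem_cball_0 by linarith
      moreover have "path_image (p +++ q) \<subseteq> cball 0 \<rho>" using img img_join by blast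
      ultimately show ?thesis
        unfolding n_def using simple
        by (intro winding_number_zero_outside[of "p +++ q" "cball 0 \<rho>" a])
           (simp_all add: simple_path_imp_path)
    qed
    \<comment> \<open>As \<open>n\<close> is real, the factor \<open>\<i>\<close> lets only the
      imaginary part of \<open>dbar2 a\<close> through. For the conjugated field this discards the
      divergence and keeps the curl.\<close>
    have "Re (dbar2 a * (P a + Q a)) = - (2 * pi) * (Re n * Im (dbar2 a))"
      unfolding PQ using n by auto
    moreover have "\<bar>Re n\<bar> \<le> indicator (ball 0 \<rho>) a" using n n0 by (cases "a \<in> ball 0 \<rho>") auto
    ultimately show ?case
      by (simp add: abs_mult mult_right_mono)
  qed
  have "continuous_on UNIV (\<lambda>a. \<bar>Im (dbar2 a)\<bar>)" by (intro continuous_intros continuous_dbar2)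
  then have "integrable lborel (\<lambda>a. \<bar>Im (dbar2 a)\<bar>)"
    by (rule integrable_continuous_compact_support[where R = R]) (simp add: dbar2_supp)
  then have int: "integrable lborel (\<lambda>a. indicator (ball 0 \<rho>) a * \<bar>Im (dbar2 a)\<bar>)"
    using integrable_mult_indicator[of "ball 0 \<rho>" lborel "\<lambda>a. \<bar>Im (dbar2 a)\<bar>"] by simp
  have intPQ: "integrable lborel (\<lambda>a. dbar2 a * (P a + Q a))"
    using P(1) Q(1) by (simp add: distrib_left)
  have "of_real (2 * pi) * (contour_integral p \<phi> + contour_integral q \<phi>) = (\<integral>a. dbar2 a * (P a + Q a) \<partial>lborel)"
    using P(1,3) Q(1,3) by (simp add: distrib_left)
  then have "Re (of_real (2 * pi) * (contour_integral p \<phi> + contour_integral q \<phi>)) = Re (\<integral>a. dbar2 a * (P a + Q a) \<partial>lborel)"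
    by (simp only:)
  also have "\<dots> = (\<integral>a. Re (dbar2 a * (P a + Q a)) \<partial>lborel)"
    using intPQ by (rule integral_Re[symmetric])
  finally have "2 * pi * Re (contour_integral p \<phi> + contour_integral q \<phi>) = (\<integral>a. Re (dbar2 a * (P a + Q a)) \<partial>lborel)"
    by simp
  then have "\<bar>2 * pi * Re (contour_integral p \<phi> + contour_integral q \<phi>)\<bar> = \<bar>\<integral>a. Re (dbar2 a * (P a + Q a)) \<partial>lborel\<bar>"
    by (simp only:)
  also have "\<bar>2 * pi * Re (contour_integral p \<phi> + contour_integral q \<phi>)\<bar>
      = 2 * pi * \<bar>Re (contour_integral p \<phi> + contour_integral q \<phi>)\<bar>"
    by (simp add: abs_mult)
  finally have "2 * pi * \<bar>Re (contour_integral p \<phi> + contour_integral q \<phi>)\<bar>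
      = \<bar>\<integral>a. Re (dbar2 a * (P a + Q a)) \<partial>lborel\<bar>" .
  also have "\<dots> \<le> (\<integral>a. \<bar>Re (dbar2 a * (P a + Q a))\<bar> \<partial>lborel)" by (rule integral_abs_bound)
  also have "\<dots> \<le> (\<integral>a. 2 * pi * (indicator (ball 0 \<rho>) a * \<bar>Im (dbar2 a)\<bar>) \<partial>lborel)"
    using int le integrable_abs[OF integrable_bounded_linear[OF bounded_linear_Re intPQ]]
    by (intro integral_mono_AE integrable_mult_right)
  also have "\<dots> = 2 * pi * (\<integral>a. indicator (ball 0 \<rho>) a * \<bar>Im (dbar2 a)\<bar> \<partial>lborel)"
    by (rule integral_mult_right_zero)
  finally show ?thesis by (simp only: mult_le_cancel_left_pos[OF pi2])
qed

section \<open>Chords of the unit disc\<close>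

definition sq_pos :: "real \<Rightarrow> real" where "sq_pos x = (max 0 x)\<^sup>2"

lemma sq_pos_has_derivative: "(sq_pos has_real_derivative 2 * max 0 x) (at x)"
proof -
  consider "x < 0" | "x > 0" | "x = 0" by linarith
  then show ?thesis
  proof cases
    case 1
    have "((\<lambda>x. 0) has_real_derivative 0) (at x)" by simp
    then have "(sq_pos has_real_derivative 0) (at x)"
      by (rule has_field_derivative_transform_within_open[where S = "{..<0}"]) (use 1 in \<open>auto simp: sq_pos_def\<close>)
    then show ?thesis using 1 by simp
  next
    case 2
    have "((\<lambda>x. x\<^sup>2) has_real_derivative 2 * x) (at x)" by (auto intro!: derivative_eq_intros)
    then have "(sq_pos has_real_derivative 2 * x) (at x)"
      by (rule has_field_derivative_transform_within_open[where S = "{0<..}"]) (use 2 in \<open>auto simp: sq_pos_def\<close>)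
    then show ?thesis using 2 by simp
  next
    case 3
    have "(\<lambda>h. (sq_pos h - sq_pos 0) / h) \<midarrow>0\<rightarrow> 0"
    proof (rule Lim_null_comparison)
      show "\<forall>\<^sub>F h in at 0. norm ((sq_pos h - sq_pos 0) / h) \<le> \<bar>h\<bar>"
        by (auto simp: sq_pos_def max_def power2_eq_square eventually_at_filter intro!: always_eventually)
      show "((\<lambda>h::real. \<bar>h\<bar>) \<longlongrightarrow> 0) (at 0)" by (rule tendsto_eq_intros refl)+ simp
    qed
    then show ?thesis using 3 by (simp add: DERIV_def)
  qed
qed

lemma continuous_on_sq_pos [continuous_intros]:
  "continuous_on A f \<Longrightarrow> continuous_on A (\<lambda>x. sq_pos (f x))"
  unfolding sq_pos_def by (intro continuous_intros)

text \<open>A composition of squared positive parts is a simple function of class C1 that equals 1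
  on the closed unit disc and 0 once \<open>(norm z)\<^sup>2 \<ge> 2\<close>, in particular from
  radius 3 / 2 on, well inside the domain of the field.\<close>

definition cutoff :: "complex \<Rightarrow> real" where
  "cutoff z = sq_pos (1 - sq_pos ((norm z)\<^sup>2 - 1))"

text \<open>The cutoff is radial, so its gradient at \<open>z\<close> is a real multiple of
  \<open>z\<close>; this is the multiple.\<close>

definition cutoff_coeff :: "complex \<Rightarrow> real" where
  "cutoff_coeff z = 2 * max 0 (1 - sq_pos ((norm z)\<^sup>2 - 1)) * - (2 * max 0 ((norm z)\<^sup>2 - 1)) * 2"

lemma cutoff_has_derivative:
  "(cutoff has_derivative (\<lambda>h. cutoff_coeff z * (Re z * Re h + Im z * Im h))) (at z)"
proof -
  have n: "((\<lambda>z. (norm z)\<^sup>2 - 1) has_derivative (\<lambda>h. 2 * (Re z * Re h + Im z * Im h))) (at z)"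
    unfolding cmod_power2 by (auto intro!: derivative_eq_intros simp: algebra_simps)
  have "((\<lambda>z. 1 - sq_pos ((norm z)\<^sup>2 - 1)) has_derivative
      (\<lambda>h. - (2 * max 0 ((norm z)\<^sup>2 - 1) * (2 * (Re z * Re h + Im z * Im h))))) (at z)"
    using has_derivative_compose[OF n sq_pos_has_derivative[unfolded has_field_derivative_def]]
    by (auto intro!: derivative_eq_intros)
  from has_derivative_compose[OF this sq_pos_has_derivative[unfolded has_field_derivative_def]]
  show ?thesis by (simp add: cutoff_def[abs_def] cutoff_coeff_def algebra_simps)
qed

lemma continuous_cutoff: "continuous_on A cutoff" "continuous_on A cutoff_coeff"
  unfolding cutoff_def[abs_def] cutoff_coeff_def[abs_def] by (intro continuous_intros)+

lemma cutoff_eq_1: "norm z \<le> 1 \<Longrightarrow> cutoff z = 1" "norm z \<le> 1 \<Longrightarrow> cutoff_coeff z = 0"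
  by (simp_all add: cutoff_def cutoff_coeff_def sq_pos_def power_le_one max_absorb1)

lemma cutoff_eq_0:
  assumes "norm z \<ge> 3 / 2"
  shows "cutoff z = 0" "cutoff_coeff z = 0"
proof -
  have "(3 / 2)\<^sup>2 \<le> (norm z)\<^sup>2" using assms by (intro power_mono) auto
  then have "1 \<le> (norm z)\<^sup>2 - 1" by (simp add: power2_eq_square)
  then have "1 \<le> ((norm z)\<^sup>2 - 1)\<^sup>2" using one_le_power by blast
  then have "1 - sq_pos ((norm z)\<^sup>2 - 1) \<le> 0" using \<open>1 \<le> (norm z)\<^sup>2 - 1\<close> by (simp add: sq_pos_def max_def)
  then have m: "max 0 (1 - sq_pos ((norm z)\<^sup>2 - 1)) = 0" by simp
  have "cutoff z = (max 0 (1 - sq_pos ((norm z)\<^sup>2 - 1)))\<^sup>2"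
    unfolding cutoff_def by (rule sq_pos_def)
  then show "cutoff z = 0" by (simp only: m) simp
  show "cutoff_coeff z = 0" by (simp only: cutoff_coeff_def m)
qed

text \<open>Since the gradient of the cutoff also vanishes on the closed unit disc, both the values
  and the partial derivatives of \<open>f\<close> survive there, up to and including the circle that
  carries the closing arc.\<close>

lemma C1_cutoff:
  fixes f fx fy :: "complex \<Rightarrow> complex"
  assumes der: "\<And>z. z \<in> ball 0 2 \<Longrightarrow> (f has_derivative (\<lambda>h. Re h *\<^sub>R fx z + Im h *\<^sub>R fy z)) (at z)"
    and cont: "continuous_on (ball 0 2) fx" "continuous_on (ball 0 2) fy"
  obtains \<phi> \<phi>x \<phi>y where "C1_compact_support \<phi> \<phi>x \<phi>y (3 / 2)"
    "\<And>z. norm z \<le> 1 \<Longrightarrow> \<phi> z = f z \<and> \<phi>x z = fx z \<and> \<phi>y z = fy z"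
proof -
  define ext where "ext = (\<lambda>F (z::complex). if norm z < 2 then F z else (0::complex))"
  define \<phi> where "\<phi> = ext (\<lambda>z. cutoff z *\<^sub>R f z)"
  define \<phi>x where "\<phi>x = ext (\<lambda>z. (cutoff_coeff z * Re z) *\<^sub>R f z + cutoff z *\<^sub>R fx z)"
  define \<phi>y where "\<phi>y = ext (\<lambda>z. (cutoff_coeff z * Im z) *\<^sub>R f z + cutoff z *\<^sub>R fy z)"
  note defs = \<phi>_def \<phi>x_def \<phi>y_def ext_def
  have zero: "\<phi> z = 0" "\<phi>x z = 0" "\<phi>y z = 0" if "norm z > 3 / 2" for z
    using cutoff_eq_0[of z] that by (simp_all add: defs)
  have op: "open {z::complex. norm z > 3 / 2}" by (intro open_Collect_less continuous_intros)
  have contf: "continuous_on (ball 0 2) f"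
    by (meson der continuous_at_imp_continuous_on has_derivative_continuous)
  have ext_cont: "continuous_on UNIV (ext F)"
    if "continuous_on (ball 0 2) F" "\<And>z. norm z > 3 / 2 \<Longrightarrow> ext F z = 0" for F
  proof -
    have "continuous_on (ball 0 2) (ext F)"
      using that(1) by (rule continuous_on_eq) (simp add: ext_def)
    moreover have "continuous_on {z. norm z > 3 / 2} (ext F)"
      by (rule continuous_on_eq[OF continuous_on_const[of _ 0]]) (simp add: that(2))
    ultimately have "continuous_on (ball 0 2 \<union> {z. norm z > 3 / 2}) (ext F)"
      using op by (intro continuous_on_open_Un) auto
    moreover have "ball 0 2 \<union> {z::complex. norm z > 3 / 2} = UNIV" by auto
    ultimately show ?thesis by simp
  qed
  have "C1_compact_support \<phi> \<phi>x \<phi>y (3 / 2)"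
  proof
    show "continuous_on UNIV \<phi>x" "continuous_on UNIV \<phi>y"
      unfolding \<phi>x_def \<phi>y_def
      by (rule ext_cont, (intro continuous_intros cont contf continuous_cutoff),
          simp add: zero[unfolded \<phi>x_def \<phi>y_def])+
    fix z
    show "(\<phi> has_derivative (\<lambda>h. Re h *\<^sub>R \<phi>x z + Im h *\<^sub>R \<phi>y z)) (at z)"
    proof (cases "norm z < 2")
      case True
      have "((\<lambda>z. cutoff z *\<^sub>R f z) has_derivative
          (\<lambda>h. cutoff z *\<^sub>R (Re h *\<^sub>R fx z + Im h *\<^sub>R fy z)
             + (cutoff_coeff z * (Re z * Re h + Im z * Im h)) *\<^sub>R f z)) (at z)"
        using True by (intro has_derivative_scaleR cutoff_has_derivative der) simp
      also have "(\<lambda>h. cutoff z *\<^sub>R (Re h *\<^sub>R fx z + Im h *\<^sub>R fy z)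
             + (cutoff_coeff z * (Re z * Re h + Im z * Im h)) *\<^sub>R f z)
          = (\<lambda>h. Re h *\<^sub>R \<phi>x z + Im h *\<^sub>R \<phi>y z)"
        using True by (auto simp: defs algebra_simps)
      finally show ?thesis
        by (rule has_derivative_transform_within_open[OF _ open_ball[of 0 2]]) (use True in \<open>auto simp: defs\<close>)
    next
      case False
      have "((\<lambda>z. 0) has_derivative (\<lambda>h. Re h *\<^sub>R \<phi>x z + Im h *\<^sub>R \<phi>y z)) (at z)"
        using False by (simp add: zero)
      then show ?thesis
        by (rule has_derivative_transform_within_open[OF _ op]) (use False zero in auto)
    qed
  qed (use zero in auto)
  moreover have "\<phi> z = f z \<and> \<phi>x z = fx z \<and> \<phi>y z = fy z" if "norm z \<le> 1" for z
    using that cutoff_eq_1[of z] by (simp add: defs)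
  ultimately show ?thesis using that by blast
qed

section \<open>Identification of \<open>real^2\<close> with the complex plane\<close>

definition to_complex :: "real^2 \<Rightarrow> complex" where "to_complex p = Complex (p $ 1) (p $ 2)"

definition of_complex :: "complex \<Rightarrow> real^2" where "of_complex z = Re z *\<^sub>R axis 1 1 + Im z *\<^sub>R axis 2 1"

lemma of_complex_nth [simp]: "of_complex z $ 1 = Re z" "of_complex z $ 2 = Im z"
  by (simp_all add: of_complex_def axis_def)

lemma to_complex_sel [simp]: "Re (to_complex p) = p $ 1" "Im (to_complex p) = p $ 2"
  by (simp_all add: to_complex_def)

lemma of_to_complex [simp]: "of_complex (to_complex p) = p" "to_complex (of_complex z) = z"
  by (simp_all add: vec_eq_iff forall_2 complex_eq_iff)

lemma norm_to_complex [simp]: "norm (to_complex p) = norm p"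
  by (simp add: to_complex_def norm_vec_def L2_set_def cmod_def sum_2)

lemma norm_of_complex [simp]: "norm (of_complex z) = norm z"
  by (metis norm_to_complex of_to_complex(2))

lemma bounded_linear_to_complex: "bounded_linear to_complex"
  by (rule bounded_linear_intro[where K = 1]) (simp_all add: complex_eq_iff)

lemma bounded_linear_of_complex: "bounded_linear of_complex"
  by (rule bounded_linear_intro[where K = 1]) (simp_all add: vec_eq_iff forall_2)

text \<open>The identification preserves the measure of boxes, and these determine Lebesgue
  measure.\<close>

lemma lborel_eq_distr_of_complex: "(lborel :: (real^2) measure) = distr lborel borel of_complex"
proof (rule lborel_eqI)
  have meas: "of_complex \<in> borel_measurable borel"
    by (intro borel_measurable_continuous_onI linear_continuous_on bounded_linear_of_complex)
  have basis: "(Basis :: (real^2) set) = {axis 1 1, axis 2 1}"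
    by (auto simp: Basis_vec_def exhaust_2 UNIV_2)
  have ne: "axis 1 1 \<noteq> (axis 2 1 :: real^2)" by (simp add: axis_eq_axis)
  fix l u :: "real^2" assume le: "\<And>b. b \<in> Basis \<Longrightarrow> l \<bullet> b \<le> u \<bullet> b"
  have vim: "of_complex -` box l u = box (to_complex l) (to_complex u)"
    by (auto simp: box_def basis Basis_complex_def inner_axis to_complex_def)
  have le': "to_complex l \<bullet> b \<le> to_complex u \<bullet> b" if "b \<in> Basis" for b
    using le[of "axis 1 1"] le[of "axis 2 1"] that
    by (auto simp: Basis_complex_def basis inner_axis to_complex_def)
  from le' have "emeasure lborel (box (to_complex l) (to_complex u))
      = (\<Prod>b\<in>Basis. (to_complex u - to_complex l) \<bullet> b)"
    by (rule emeasure_lborel_box)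
  moreover have "(\<Prod>b\<in>Basis. (to_complex u - to_complex l) \<bullet> b) = (\<Prod>b\<in>Basis. (u - l) \<bullet> b)"
    using ne by (simp add: basis Basis_complex_def inner_axis complex_eq_iff)
  ultimately show "emeasure (distr lborel borel of_complex) (box l u) = (\<Prod>b\<in>Basis. (u - l) \<bullet> b)"
    using meas by (simp add: emeasure_distr vim)
qed simp

text \<open>Connects the Lebesgue integral over \<open>complex\<close>, produced by Green's theorem,
  with the gauge integral over \<open>real^2\<close>. Integrability of \<open>F\<close> is imported
  from \<open>G\<close>.\<close>

lemma integral_ball_eq_complex:
  fixes F :: "real^2 \<Rightarrow> real"
  assumes cont: "continuous_on (ball 0 1) F"
    and G: "integrable lborel (\<lambda>a. indicator (ball 0 1) a * G a)"
    and FG: "\<And>a. a \<in> ball 0 1 \<Longrightarrow> F (of_complex a) = G a"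
  shows "integral (ball 0 1) F = (\<integral>a. indicator (ball 0 1) a * G a \<partial>lborel)"
proof -
  define H where "H = (\<lambda>p. indicator (ball 0 1) p *\<^sub>R F p)"
  have meas: "H \<in> borel_measurable borel"
    unfolding H_def by (rule borel_measurable_continuous_on_indicator[OF _ cont]) simp
  have measc: "of_complex \<in> measurable lborel borel"
    using borel_measurable_continuous_onI[OF linear_continuous_on[OF bounded_linear_of_complex]] by simp
  have H: "H (of_complex a) = indicator (ball 0 1) a * G a" for a
    using FG[of a] by (auto simp: H_def indicator_def)
  have "integrable lborel H"
    using G by (subst lborel_eq_distr_of_complex, subst integrable_distr_eq[OF measc meas]) (simp only: H)
  then have "set_integrable lborel (ball 0 1) F" by (simp add: set_integrable_def H_def)
  then have "integral (ball 0 1) F = (LINT p:ball 0 1|lborel. F p)"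
    by (rule set_borel_integral_eq_integral(2)[symmetric])
  also have "\<dots> = (\<integral>p. H p \<partial>lborel)" by (simp only: set_lebesgue_integral_def H_def)
  also have "\<dots> = (\<integral>a. H (of_complex a) \<partial>lborel)"
    by (subst lborel_eq_distr_of_complex, subst integral_distr[OF measc meas]) simp
  finally show ?thesis by (simp only: H)
qed

section \<open>Regularity of the field and exit from the unit disc\<close>

lemma Ck_on_1D:
  assumes "Ck_on S 1 f"
  shows "\<And>x. x \<in> S \<Longrightarrow> (f has_derivative frechet_derivative f (at x)) (at x)"
    "\<And>h. continuous_on S (\<lambda>x. frechet_derivative f (at x) h)"
  using assms by (auto simp: One_nat_def frechet_derivative_works[symmetric])

lemma frechet_derivative_of_complex:
  fixes v :: "real^2 \<Rightarrow> 'b::real_normed_vector"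
  assumes "(v has_derivative v') (at x)"
  shows "v' (of_complex h) = Re h *\<^sub>R v' (axis 1 1) + Im h *\<^sub>R v' (axis 2 1)"
proof -
  have "linear v'" using assms has_derivative_linear by blast
  then show ?thesis by (simp add: of_complex_def linear_add linear_cmul)
qed

lemma curl_eq:
  assumes "(v has_derivative v') (at p)"
  shows "curl v p = v' (axis 1 1) $ 2 - v' (axis 2 1) $ 1"
proof -
  have "partial_deriv i (\<lambda>q. v q $ j) p = v' (axis i 1) $ j" for i j :: 2
  proof -
    have "((\<lambda>h. v (p + h *\<^sub>R axis i 1) $ j) has_vector_derivative v' (axis i 1) $ j) (at 0)"
      by (rule bounded_linear.has_vector_derivative[OF bounded_linear_vec_nth has_vector_derivative_along[OF assms]])
    then show ?thesis
      unfolding partial_deriv_def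
      by (intro DERIV_imp_deriv) (simp add: has_real_derivative_iff_has_vector_derivative)
  qed
  then show ?thesis by (simp add: curl_def)
qed

text \<open>\<open>Ck_on\<close> provides continuity of the derivative only in each fixed direction.
  In the plane, bounds for the two axis directions on a compact ball already control the operator
  norm.\<close>

lemma C1_locally_lipschitz:
  fixes v :: "real^2 \<Rightarrow> real^2"
  assumes C1: "Ck_on \<Omega> 1 v" and "open \<Omega>" "q \<in> \<Omega>"
  shows "\<exists>r>0. \<exists>L. cball q r \<subseteq> \<Omega> \<and> L-lipschitz_on (cball q r) v"
proof -
  obtain r where r: "r > 0" "cball q r \<subseteq> \<Omega>" using assms open_contains_cball by blast
  let ?D = "\<lambda>x. frechet_derivative v (at x)"
  have "\<exists>B>0. \<forall>x\<in>cball q r. norm (?D x h) \<le> B" for h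
  proof -
    have "compact ((\<lambda>x. ?D x h) ` cball q r)"
      using r by (intro compact_continuous_image continuous_on_subset[OF Ck_on_1D(2)[OF C1]]) auto
    from compact_imp_bounded[OF this] obtain b where
      "b > 0" "\<forall>y\<in>(\<lambda>x. ?D x h) ` cball q r. norm y \<le> b"
      unfolding bounded_pos by blast
    then show ?thesis by (intro exI[of _ b]) simp
  qed
  then obtain B where B: "\<And>h. B h > 0" "\<And>h x. x \<in> cball q r \<Longrightarrow> norm (?D x h) \<le> B h" by metis
  have "(B (axis 1 1) + B (axis 2 1))-lipschitz_on (cball q r) v"
  proof (rule bounded_derivative_imp_lipschitz)
    fix x assume x: "x \<in> cball q r"
    then have der: "(v has_derivative ?D x) (at x)" using Ck_on_1D(1)[OF C1] r by auto
    then show "(v has_derivative ?D x) (at x within cball q r)" by (rule has_derivative_at_withinI)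
    show "onorm (?D x) \<le> B (axis 1 1) + B (axis 2 1)"
    proof (rule onorm_le)
      fix h
      have "?D x h = Re (to_complex h) *\<^sub>R ?D x (axis 1 1) + Im (to_complex h) *\<^sub>R ?D x (axis 2 1)"
        using frechet_derivative_of_complex[OF der, of "to_complex h"] by simp
      also have "norm \<dots> \<le> \<bar>Re (to_complex h)\<bar> * norm (?D x (axis 1 1)) + \<bar>Im (to_complex h)\<bar> * norm (?D x (axis 2 1))"
        by (metis norm_scaleR norm_triangle_ineq)
      also have "\<dots> \<le> norm h * B (axis 1 1) + norm h * B (axis 2 1)"
        using B x abs_Re_le_cmod[of "to_complex h"] abs_Im_le_cmod[of "to_complex h"]
        by (intro add_mono mult_mono) (auto simp del: to_complex_sel)
      finally show "norm (?D x h) \<le> (B (axis 1 1) + B (axis 2 1)) * norm h" by (simp add: algebra_simps)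
    qed
  qed (use B less_imp_le[OF B(1)] in \<open>auto intro: add_nonneg_nonneg\<close>)
  with r show ?thesis by blast
qed

lemma complex_field_log:
  fixes v :: "real^2 \<Rightarrow> real^2"
  assumes "continuous_on (ball 0 2) v" "\<And>p. p \<in> ball 0 2 \<Longrightarrow> v p \<noteq> 0"
  obtains \<Lambda> where "continuous_on (ball 0 2) \<Lambda>"
    "\<And>z. z \<in> ball 0 2 \<Longrightarrow> to_complex (v (of_complex z)) = exp (\<Lambda> z)"
proof -
  have "continuous_on (ball 0 2) (\<lambda>z. to_complex (v (of_complex z)))"
    by (intro bounded_linear.continuous_on[OF bounded_linear_to_complex] continuous_on_compose2[OF assms(1)]
        linear_continuous_on bounded_linear_of_complex) auto
  moreover have "to_complex (v (of_complex z)) \<noteq> 0" if "z \<in> ball 0 2" for z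
    using assms(2)[of "of_complex z"] that norm_to_complex by (metis mem_ball_0 norm_eq_zero norm_of_complex)
  ultimately show ?thesis
    using continuous_logarithm_on_contractible[OF _ convex_imp_contractible[OF convex_ball]] that by metis
qed

lemma to_complex_curve:
  assumes "integral_curve (ball 0 2) v x0 J \<gamma>" "t \<in> J"
  shows "((\<lambda>t. to_complex (\<gamma> t)) has_vector_derivative to_complex (v (of_complex (to_complex (\<gamma> t))))) (at t within A)"
    "to_complex (\<gamma> t) \<in> ball 0 2"
  using bounded_linear.has_vector_derivative[OF bounded_linear_to_complex integral_curve_derivative(2)[OF assms]]
    integral_curve_derivative(1)[OF assms] by simp_all

text \<open>A curve that never meets the circle stays in the closed unit disc by the intermediate
  value theorem. Maximality then gives existence for all forward time, and a logarithm of the field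
  excludes such a trapped trajectory. \<open>T\<close> is the first meeting time.\<close>

lemma integral_curve_leaves_unit_disc:
  fixes v :: "real^2 \<Rightarrow> real^2"
  assumes \<gamma>: "maximal_integral_curve (ball 0 2) v 0 J \<gamma>" and cont: "continuous_on (ball 0 2) v"
    and lip: "\<And>q. q \<in> ball 0 2 \<Longrightarrow> \<exists>r>0. \<exists>L. cball q r \<subseteq> ball 0 2 \<and> L-lipschitz_on (cball q r) v"
    and nz: "\<And>p. p \<in> ball 0 2 \<Longrightarrow> v p \<noteq> 0"
  obtains T where "0 < T" "{0..T} \<subseteq> J" "norm (\<gamma> T) = 1" "\<And>t. 0 \<le> t \<Longrightarrow> t < T \<Longrightarrow> norm (\<gamma> t) < 1"
proof -
  have ic: "integral_curve (ball 0 2) v 0 J \<gamma>" using \<gamma> by (simp add: maximal_integral_curve_def)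
  then have J: "is_interval J" "0 \<in> J" "\<gamma> 0 = 0" by (auto simp: integral_curve_def)
  have sub: "{0..t} \<subseteq> J" if "t \<in> J" for t
    using J that unfolding is_interval_1 by (meson atLeastAtMost_iff subsetI)
  have contn: "continuous_on {0..t} (\<lambda>t. norm (\<gamma> t))" if "t \<in> J" for t
    using integral_curve_derivative(2)[OF ic] sub[OF that]
    by (intro continuous_on_norm) (meson continuous_on_eq_continuous_within has_vector_derivative_continuous in_mono)
  have reach: "\<exists>s\<in>{0..t}. norm (\<gamma> s) = 1" if "t \<in> J" "0 \<le> t" "1 \<le> norm (\<gamma> t)" for t
    using IVT'[of "\<lambda>t. norm (\<gamma> t)" 0 1 t] contn that J by auto
  have "\<exists>t\<in>J. 0 \<le> t \<and> norm (\<gamma> t) = 1"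
  proof (rule ccontr)
    assume no: "\<not> ?thesis"
    have inD: "\<gamma> t \<in> cball 0 1" if t: "t \<in> J" "0 \<le> t" for t
    proof (rule ccontr)
      assume "\<gamma> t \<notin> cball 0 1"
      then obtain s where "s \<in> {0..t}" "norm (\<gamma> s) = 1" using reach[OF t] by auto
      then show False using no sub[OF t(1)] by auto
    qed
    have "{0..} \<subseteq> J"
    proof (rule maximal_integral_curve_trapped_in_compact[OF \<gamma> cont lip compact_cball[of 0 1]])
      show "cball 0 1 \<subseteq> ball (0 :: real^2) 2" by auto
    qed (use inD in auto)
    then have J0: "t \<in> J" if "0 \<le> t" for t using that by auto
    obtain \<Lambda> where \<Lambda>: "continuous_on (ball 0 2) \<Lambda>"
      "\<And>z. z \<in> ball 0 2 \<Longrightarrow> to_complex (v (of_complex z)) = exp (\<Lambda> z)"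
      using complex_field_log[OF cont nz] by blast
    show False
    proof (rule not_trapped_in_compact[OF \<Lambda>(1) open_ball compact_cball[of 0 1]])
      fix t :: real assume "0 \<le> t"
      then have t: "t \<in> J" by (rule J0)
      show "((\<lambda>t. to_complex (\<gamma> t)) has_vector_derivative exp (\<Lambda> (to_complex (\<gamma> t)))) (at t)"
        using to_complex_curve(1)[OF ic t, of UNIV] \<Lambda>(2)[OF to_complex_curve(2)[OF ic t]] by (simp only:)
      show "to_complex (\<gamma> t) \<in> cball 0 1" using inD[OF t \<open>0 \<le> t\<close>] by simp
    qed auto
  qed
  then obtain t0 where t0: "t0 \<in> J" "0 \<le> t0" "norm (\<gamma> t0) = 1" by blast
  define X where "X = {0..t0} \<inter> (\<lambda>t. norm (\<gamma> t)) -` {1}"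
  have "closed X" unfolding X_def using contn[OF t0(1)] by (intro continuous_closed_preimage) auto
  moreover have "t0 \<in> X" using t0 by (simp add: X_def)
  moreover have bdd: "bdd_below X" by (auto simp: X_def bdd_below_def)
  ultimately have Inf: "Inf X \<in> X" by (intro closed_contains_Inf) auto
  define T where "T = Inf X"
  have T: "0 \<le> T" "T \<le> t0" "norm (\<gamma> T) = 1" using Inf by (auto simp: X_def T_def)
  have TJ: "{0..T} \<subseteq> J" using sub[OF t0(1)] T by auto
  show ?thesis
  proof (rule that[OF _ TJ T(3)])
    show "0 < T" using T J by (cases "T = 0") auto
    show "norm (\<gamma> t) < 1" if t: "0 \<le> t" "t < T" for t
    proof (rule ccontr)
      assume "\<not> norm (\<gamma> t) < 1"
      then obtain s where s: "s \<in> {0..t}" "norm (\<gamma> s) = 1" using reach[of t] TJ t by force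
      then have "s \<in> X" using t T by (auto simp: X_def)
      then show False using cInf_lower[OF _ bdd] s t by (force simp: T_def)
    qed
  qed
qed

section \<open>Closing the chord and estimating the circulation\<close>

lemma short_arc_on_unit_circle:
  fixes a b :: complex
  assumes "norm a = 1" "norm b = 1" "a \<noteq> b"
  obtains \<alpha> \<beta> where "cis \<alpha> = a" "cis \<beta> = b" "\<alpha> \<noteq> \<beta>" "\<bar>\<beta> - \<alpha>\<bar> \<le> pi"
proof -
  have nz: "a \<noteq> 0" "b \<noteq> 0" using assms by auto
  have ca: "cis (Arg a) = a" using assms cis_Arg[OF nz(1)] by (simp add: sgn_div_norm)
  have "norm (b / a) = 1" using assms by (simp add: norm_divide)
  then have cba: "cis (Arg (b / a)) = b / a" using nz cis_Arg[of "b / a"] by (simp add: sgn_div_norm)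
  show ?thesis
  proof (rule that[OF ca])
    \<comment> \<open>The second angle is the first plus the principal argument of the quotient; the
      principal arguments of \<open>a\<close> and \<open>b\<close> themselves may differ by more
      than pi.\<close>
    show "cis (Arg a + Arg (b / a)) = b" using ca cba nz by (simp add: cis_mult[symmetric])
    show "Arg a \<noteq> Arg a + Arg (b / a)" using cba nz assms by auto
    show "\<bar>Arg a + Arg (b / a) - Arg a\<bar> \<le> pi" using Arg_bounded[of "b / a"] by linarith
  qed
qed

lemma norm_part_circlepath_unit: "z \<in> path_image (part_circlepath 0 1 \<alpha> \<beta>) \<Longrightarrow> norm z = 1"
  by (auto simp: path_image_def part_circlepath_def norm_mult simp flip: of_real_mult)

lemma continuous_deriv_part_circlepath:
  "continuous_on A (\<lambda>x. \<i> * of_real r * (of_real \<beta> - of_real \<alpha>) * exp (\<i> * of_real (linepath \<alpha> \<beta> x)))"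
  unfolding linepath_def by (intro continuous_intros)

text \<open>The field is conjugated because the circulation of \<open>v\<close> is the real part of the contour integral
  of its conjugate.\<close>

lemma conjugate_field_cutoff:
  fixes v :: "real^2 \<Rightarrow> real^2"
  assumes C1: "Ck_on (ball 0 2) 1 v"
  obtains \<phi> \<phi>x \<phi>y where "C1_compact_support \<phi> \<phi>x \<phi>y (3 / 2)"
    "\<And>z. norm z \<le> 1 \<Longrightarrow> \<phi> z = cnj (to_complex (v (of_complex z)))"
    "\<And>z. norm z \<le> 1 \<Longrightarrow> Im (C1_compact_support.dbar2 \<phi>x \<phi>y z) = - curl v (of_complex z)"
proof -
  let ?D = "\<lambda>x. frechet_derivative v (at x)"
  define f where "f = (\<lambda>z. cnj (to_complex (v (of_complex z))))"
  define fx where "fx = (\<lambda>z. cnj (to_complex (?D (of_complex z) (axis 1 1))))"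
  define fy where "fy = (\<lambda>z. cnj (to_complex (?D (of_complex z) (axis 2 1))))"
  have lin: "bounded_linear (\<lambda>p. cnj (to_complex p))"
    by (rule bounded_linear_compose[OF bounded_linear_cnj bounded_linear_to_complex])
  have "(f has_derivative (\<lambda>h. Re h *\<^sub>R fx z + Im h *\<^sub>R fy z)) (at z)" if z: "z \<in> ball 0 2" for z
  proof -
    have der: "(v has_derivative ?D (of_complex z)) (at (of_complex z))"
      using Ck_on_1D(1)[OF C1] z by simp
    have "(f has_derivative (\<lambda>h. cnj (to_complex (?D (of_complex z) (of_complex h))))) (at z)"
      unfolding f_def
      by (rule bounded_linear.has_derivative[OF lin])
         (rule has_derivative_compose[OF bounded_linear_imp_has_derivative[OF bounded_linear_of_complex] der])
    also have "(\<lambda>h. cnj (to_complex (?D (of_complex z) (of_complex h)))) = (\<lambda>h. Re h *\<^sub>R fx z + Im h *\<^sub>R fy z)"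
      unfolding frechet_derivative_of_complex[OF der] fx_def fy_def
      by (simp add: complex_eq_iff fun_eq_iff)
    finally show ?thesis .
  qed
  moreover have "continuous_on (ball 0 2) fx" "continuous_on (ball 0 2) fy"
    unfolding fx_def fy_def
    by (intro bounded_linear.continuous_on[OF lin] continuous_on_compose2[OF Ck_on_1D(2)[OF C1]]
        linear_continuous_on bounded_linear_of_complex; auto)+
  ultimately obtain \<phi> \<phi>x \<phi>y where \<phi>: "C1_compact_support \<phi> \<phi>x \<phi>y (3 / 2)"
    "\<And>z. norm z \<le> 1 \<Longrightarrow> \<phi> z = f z \<and> \<phi>x z = fx z \<and> \<phi>y z = fy z"
    using C1_cutoff by blast
  show ?thesis
  proof (rule that[OF \<phi>(1)])
    fix z :: complex assume z: "norm z \<le> 1"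
    show "\<phi> z = cnj (to_complex (v (of_complex z)))" using \<phi>(2)[OF z] by (simp add: f_def)
    have "(v has_derivative ?D (of_complex z)) (at (of_complex z))"
      using Ck_on_1D(1)[OF C1] z by simp
    then have "curl v (of_complex z) = ?D (of_complex z) (axis 1 1) $ 2 - ?D (of_complex z) (axis 2 1) $ 1"
      by (rule curl_eq)
    then show "Im (C1_compact_support.dbar2 \<phi>x \<phi>y z) = - curl v (of_complex z)"
      using \<phi>(2)[OF z] by (simp add: C1_compact_support.dbar2_def[OF \<phi>(1)] fx_def fy_def)
  qed
qed

lemma continuous_on_curl:
  assumes "Ck_on \<Omega> 1 v"
  shows "continuous_on \<Omega> (curl v)"
proof -
  have "continuous_on \<Omega> (\<lambda>p. frechet_derivative v (at p) (axis 1 1) $ 2 - frechet_derivative v (at p) (axis 2 1) $ 1)"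
    by (intro continuous_intros Ck_on_1D(2)[OF assms])
  then show ?thesis
    by (rule continuous_on_eq) (use curl_eq Ck_on_1D(1)[OF assms] in metis)
qed

text \<open>Along the chord the velocity is \<open>v\<close> itself, so the circulation is the
  integral of the squared speed, with no angle to control. The closing arc has radius 1 and angle at
  most pi, whence the term \<open>c2 * pi\<close>.\<close>

lemma chord_energy_bound:
  fixes v :: "real^2 \<Rightarrow> real^2"
  assumes C1: "Ck_on (ball 0 2) 1 v"
    and bound: "\<And>p. p \<in> ball 0 2 \<Longrightarrow> norm (v p) \<le> c2"
    and nz: "\<And>p. p \<in> ball 0 2 \<Longrightarrow> v p \<noteq> 0"
    and \<gamma>: "integral_curve (ball 0 2) v x0 J \<gamma>" and ab: "a < b" "{a..b} \<subseteq> J"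
    and ends: "norm (\<gamma> a) = 1" "norm (\<gamma> b) = 1" and inside: "\<And>t. a < t \<Longrightarrow> t < b \<Longrightarrow> norm (\<gamma> t) < 1"
  shows "integral {a..b} (\<lambda>t. (norm (v (\<gamma> t)))\<^sup>2) \<le> c2 * pi + integral (ball 0 1) (\<lambda>p. \<bar>curl v p\<bar>)"
proof -
  have contv: "continuous_on (ball 0 2) v"
    using Ck_on_1D(1)[OF C1] by (meson continuous_at_imp_continuous_on has_derivative_continuous)
  define W where "W = (\<lambda>z. to_complex (v (of_complex z)))"
  define g where "g = (\<lambda>t. to_complex (\<gamma> t))"
  have contW: "continuous_on (ball 0 2) W"
    unfolding W_def
    by (intro bounded_linear.continuous_on[OF bounded_linear_to_complex] continuous_on_compose2[OF contv]
        linear_continuous_on bounded_linear_of_complex) auto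
  have der: "(g has_vector_derivative W (g t)) (at t within A)" and g2: "g t \<in> ball 0 2" if "t \<in> {a..b}" for t A
    using to_complex_curve[OF \<gamma>, of t] that ab by (auto simp: g_def W_def)
  have contg: "continuous_on {a..b} g"
    using der by (meson continuous_on_eq_continuous_within has_vector_derivative_continuous)
  have contWg: "continuous_on {a..b} (\<lambda>t. W (g t))"
    by (rule continuous_on_compose2[OF contW contg]) (use g2 in auto)
  obtain \<Lambda> where \<Lambda>: "continuous_on (ball 0 2) \<Lambda>" "\<And>z. z \<in> ball 0 2 \<Longrightarrow> W z = exp (\<Lambda> z)"
    using complex_field_log[OF contv nz] unfolding W_def by blast
  have inj: "inj_on g {a..b}"
  proof (rule liftable_curve_injective[OF _ \<Lambda>(1) open_ball])
    show "(g has_vector_derivative exp (\<Lambda> (g t))) (at t within {a..b})" if "t \<in> {a..b}" for t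
      using der[OF that] \<Lambda>(2)[OF g2[OF that]] by simp
  qed (use g2 in auto)
  define \<sigma> where "\<sigma> = (\<lambda>x. a + x * (b - a))"
  have \<sigma>: "\<sigma> x \<in> {a..b}" if "x \<in> {0..1}" for x
    using segment_param_bounds[of a b x] that ab by (auto simp: \<sigma>_def)
  define p where "p = (\<lambda>x. g (\<sigma> x))"
  define p' where "p' = (\<lambda>x. (b - a) *\<^sub>R W (g (\<sigma> x)))"
  have cont\<sigma>: "continuous_on {0..1} \<sigma>" unfolding \<sigma>_def by (intro continuous_intros)
  have derp: "(p has_vector_derivative p' x) (at x)" if x: "x \<in> {0..1}" for x
  proof -
    have "(\<sigma> has_vector_derivative (b - a)) (at x)"
      unfolding \<sigma>_def has_real_derivative_iff_has_vector_derivative[symmetric]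
      by (auto intro!: derivative_eq_intros)
    from vector_diff_chain_at[OF this der[OF \<sigma>[OF x]]]
    show ?thesis by (simp add: p_def p'_def o_def)
  qed
  have contp': "continuous_on {0..1} p'"
    unfolding p'_def by (intro continuous_intros continuous_on_compose2[OF contWg cont\<sigma>]) (use \<sigma> in auto)
  have contp: "continuous_on {0..1} p"
    unfolding p_def by (rule continuous_on_compose2[OF contg cont\<sigma>]) (use \<sigma> in auto)
  have "inj_on p {0..1}"
  proof (rule inj_onI)
    fix x y assume xy: "x \<in> {0..1}" "y \<in> {0..1}" "p x = p y"
    then have "\<sigma> x = \<sigma> y" using inj_onD[OF inj] \<sigma> by (simp add: p_def)
    then show "x = y" using ab by (simp add: \<sigma>_def)
  qed
  then have arcp: "arc p" using contp by (simp add: arc_def path_def)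
  have pe: "pathstart p = g a" "pathfinish p = g b"
    by (simp_all add: pathstart_def pathfinish_def p_def \<sigma>_def)
  have nle: "norm (g t) \<le> 1" if "t \<in> {a..b}" for t
    using ends inside[of t] that by (cases "t = a \<or> t = b") (auto simp: g_def)
  have imgp: "path_image p \<subseteq> cball 0 1" using nle \<sigma> by (auto simp: path_image_def p_def)
  \<comment> \<open>Injectivity of the trajectory guarantees that the closing arc is
    nondegenerate.\<close>
  have "g a \<noteq> g b" using inj_onD[OF inj, of a b] ab by auto
  then obtain \<alpha> \<beta> where ang: "cis \<alpha> = g b" "cis \<beta> = g a" "\<alpha> \<noteq> \<beta>" "\<bar>\<beta> - \<alpha>\<bar> \<le> pi"
    using short_arc_on_unit_circle[of "g b" "g a"] ends by (auto simp: g_def)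
  define q where "q = part_circlepath 0 1 \<alpha> \<beta>"
  have qe: "pathstart q = g b" "pathfinish q = g a"
    using ang by (simp_all add: q_def cis_conv_exp)
  have arcq: "arc q"
    unfolding q_def using ang pi_gt_zero by (intro arc_part_circlepath) auto
  have imgq: "norm z = 1" if "z \<in> path_image q" for z
    using that norm_part_circlepath_unit by (simp add: q_def)
  \<comment> \<open>At interior times the chord is in the open disc, whereas the arc lies on the
    circle.\<close>
  have "path_image p \<inter> path_image q \<subseteq> {pathstart p, pathstart q}"
  proof
    fix z assume z: "z \<in> path_image p \<inter> path_image q"
    then obtain x where x: "x \<in> {0..1}" "z = g (\<sigma> x)" by (auto simp: path_image_def p_def)
    have "norm (\<gamma> (\<sigma> x)) = 1" using imgq[of z] z x by (simp add: g_def)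
    then have "\<sigma> x = a \<or> \<sigma> x = b" using inside[of "\<sigma> x"] \<sigma>[OF x(1)] by force
    then show "z \<in> {pathstart p, pathstart q}" using x pe qe by auto
  qed
  then have simple: "simple_path (p +++ q)"
    using arcp arcq pe qe by (intro simple_path_join_loop) auto
  obtain \<phi> \<phi>x \<phi>y where C: "C1_compact_support \<phi> \<phi>x \<phi>y (3 / 2)"
    and \<phi>: "\<And>z. norm z \<le> 1 \<Longrightarrow> \<phi> z = cnj (W z)"
      "\<And>z. norm z \<le> 1 \<Longrightarrow> Im (C1_compact_support.dbar2 \<phi>x \<phi>y z) = - curl v (of_complex z)"
    using conjugate_field_cutoff[OF C1] unfolding W_def by blast
  interpret C1_compact_support \<phi> \<phi>x \<phi>y "3 / 2" by (rule C)
  define q' where "q' = (\<lambda>x. \<i> * of_real 1 * (of_real \<beta> - of_real \<alpha>) * exp (\<i> * of_real (linepath \<alpha> \<beta> x)))"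
  have derq: "(q has_vector_derivative q' x) (at x)" for x
    unfolding q_def q'_def by (rule has_vector_derivative_part_circlepath)
  have contq': "continuous_on {0..1} q'" unfolding q'_def by (rule continuous_deriv_part_circlepath)
  define I where "I = (\<integral>a. indicator (ball 0 1) a * \<bar>Im (dbar2 a)\<bar> \<partial>lborel)"
  have circ: "\<bar>Re (contour_integral p \<phi> + contour_integral q \<phi>)\<bar> \<le> I"
    unfolding I_def
    by (rule circulation_bound[OF derp contp' derq contq' simple]) (use pe qe imgp imgq in auto)
  have "I = integral (ball 0 1) (\<lambda>p. \<bar>curl v p\<bar>)"
    unfolding I_def
  proof (rule integral_ball_eq_complex[symmetric])
    show "continuous_on (ball 0 1) (\<lambda>p. \<bar>curl v p\<bar>)"
      by (intro continuous_intros continuous_on_subset[OF continuous_on_curl[OF C1]]) auto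
    have "integrable lborel (\<lambda>a. \<bar>Im (dbar2 a)\<bar>)"
      by (rule integrable_continuous_compact_support[where R = "3 / 2"])
         (auto intro!: continuous_intros continuous_dbar2 simp: dbar2_supp)
    then show "integrable lborel (\<lambda>a. indicator (ball 0 1) a * \<bar>Im (dbar2 a)\<bar>)"
      using integrable_mult_indicator[of "ball 0 1" lborel "\<lambda>a. \<bar>Im (dbar2 a)\<bar>"] by simp
  qed (simp add: \<phi>(2))
  moreover have "norm (contour_integral q \<phi>) \<le> c2 * pi"
  proof -
    have c2: "0 \<le> c2" using order_trans[OF norm_ge_zero bound[of 0]] by simp
    have "norm (contour_integral q \<phi>) \<le> c2 * 1 * \<bar>\<beta> - \<alpha>\<bar>"
      unfolding q_def
    proof (rule contour_integral_bound_part_circlepath)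
      show "\<phi> contour_integrable_on part_circlepath 0 1 \<alpha> \<beta>"
        by (rule contour_integrable_continuous_part_circlepath) (rule continuous_on_subset[OF cont], simp)
      show "norm (\<phi> z) \<le> c2" if "z \<in> path_image (part_circlepath 0 1 \<alpha> \<beta>)" for z
        using imgq[of z] that \<phi>(1)[of z] bound[of "of_complex z"] by (simp add: q_def W_def)
    qed (use c2 in auto)
    also have "\<dots> \<le> c2 * pi" using ang(4) c2 by (simp add: mult_left_mono)
    finally show ?thesis .
  qed
  moreover have "Re (contour_integral p \<phi>) = integral {a..b} (\<lambda>t. (norm (v (\<gamma> t)))\<^sup>2)"
  proof -
    define h where "h = (\<lambda>t. of_real ((norm (v (\<gamma> t)))\<^sup>2) :: complex)"
    have h: "cnj (W (g t)) * W (g t) = h t" for t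
      unfolding h_def by (subst mult.commute, subst complex_norm_square[symmetric]) (simp add: W_def g_def)
    have conth: "continuous_on {a..b} h"
      unfolding h[symmetric] by (intro continuous_intros contWg)
    have "contour_integral p \<phi> = integral {0..1} (\<lambda>x. \<phi> (p x) * p' x)"
      unfolding contour_integral_integral
      by (intro integral_cong) (simp add: vector_derivative_at[OF derp])
    also have "\<dots> = integral {0..1} (\<lambda>x. (b - a) *\<^sub>R h (a + x * (b - a)))"
    proof (rule integral_cong)
      fix x :: real assume x: "x \<in> {0..1}"
      have "\<phi> (p x) = cnj (W (g (\<sigma> x)))" using \<phi>(1) nle[OF \<sigma>[OF x]] by (simp add: p_def)
      then have "\<phi> (p x) * p' x = (b - a) *\<^sub>R (cnj (W (g (\<sigma> x))) * W (g (\<sigma> x)))" by (simp add: p'_def)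
      then show "\<phi> (p x) * p' x = (b - a) *\<^sub>R h (a + x * (b - a))" unfolding h by (simp add: \<sigma>_def)
    qed
    \<comment> \<open>\<open>secant h (a, b)\<close> is the mean of \<open>h\<close> over the time
      interval, so \<open>secant_eq\<close>, applied to an antiderivative of \<open>h\<close>,
      performs the substitution back to \<open>{a..b}\<close>.\<close>
    also have "\<dots> = (b - a) *\<^sub>R secant h (a, b)" by (simp add: secant_def)
    also have "\<dots> = integral {a..b} h - integral {a..a} h"
      by (rule secant_eq[OF integral_has_vector_derivative[OF conth]]) (use ab in auto)
    also have "\<dots> = integral {a..b} h" by simp
    finally have "Re (contour_integral p \<phi>) = Re (integral {a..b} h)" by simp
    also have "\<dots> = integral {a..b} (Re \<circ> h)"
      using conth by (intro integral_linear[symmetric] integrable_continuous_real bounded_linear_Re)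
    finally show ?thesis by (simp add: h_def o_def)
  qed
  ultimately show ?thesis
    using circ abs_Re_le_cmod[of "contour_integral q \<phi>"] by simp
qed

section \<open>The length bound\<close>

theorem theorem3:
  fixes c1 c2 :: real
    and v :: "real^2 \<Rightarrow> real^2"
    and \<gamma> :: "real \<Rightarrow> real^2"
    and J :: "real set"
  assumes "0 < c1" and "c1 < c2"
    and "smooth_on (ball 0 2) v"
    and "\<And>p. p \<in> ball 0 2 \<Longrightarrow> c1 < norm (v p) \<and> norm (v p) < c2"
    and "maximal_integral_curve (ball 0 2) v 0 J \<gamma>"
  shows "(INF t\<in>{t\<in>J. 0 < t \<and> norm (\<gamma> t) = 1}.
            ereal (integral {0..t} (\<lambda>s. norm (vector_derivative \<gamma> (at s)))))
         \<le> ereal (pi * (c2 / c1) + 1 / c1 * integral (ball 0 1) (\<lambda>p. \<bar>curl v p\<bar>))"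
proof -
  note c = assms(1,2) and speed = assms(4) and \<gamma> = assms(5)
  have C1: "Ck_on (ball 0 2) 1 v" using assms(3) unfolding smooth_on_def by blast
  have contv: "continuous_on (ball 0 2) v"
    using Ck_on_1D(1)[OF C1] by (meson continuous_at_imp_continuous_on has_derivative_continuous)
  have nz: "v p \<noteq> 0" if "p \<in> ball 0 2" for p using speed[OF that] c by auto
  have bound: "norm (v p) \<le> c2" if "p \<in> ball 0 2" for p using speed[OF that] by simp
  have lip: "\<exists>r>0. \<exists>L. cball q r \<subseteq> ball 0 2 \<and> L-lipschitz_on (cball q r) v" if "q \<in> ball 0 2" for q
    by (rule C1_locally_lipschitz[OF C1 open_ball that])
  have lip': "\<exists>r>0. \<exists>L. cball q r \<subseteq> ball 0 2 \<and> L-lipschitz_on (cball q r) (\<lambda>x. - v x)" if "q \<in> ball 0 2" for q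
    using lip[OF that] lipschitz_on_minus by blast
  have ic: "integral_curve (ball 0 2) v 0 J \<gamma>" using \<gamma> by (simp add: maximal_integral_curve_def)
  then have \<gamma>0: "\<gamma> 0 = 0" by (simp add: integral_curve_def)
  obtain T where T: "0 < T" "{0..T} \<subseteq> J" "norm (\<gamma> T) = 1" "\<And>t. 0 \<le> t \<Longrightarrow> t < T \<Longrightarrow> norm (\<gamma> t) < 1"
    using integral_curve_leaves_unit_disc[OF \<gamma> contv lip nz] by blast
  \<comment> \<open>The backward exit time is the forward exit time for the reversed field.\<close>
  obtain S where S: "0 < S" "{0..S} \<subseteq> uminus ` J" "norm (\<gamma> (- S)) = 1"
      "\<And>t. 0 \<le> t \<Longrightarrow> t < S \<Longrightarrow> norm (\<gamma> (- t)) < 1"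
    using integral_curve_leaves_unit_disc[OF maximal_integral_curve_reverse[OF \<gamma>] continuous_on_minus[OF contv] lip'] nz
    by (metis neg_equal_0_iff_equal)
  have sub: "{- S..T} \<subseteq> J"
  proof
    fix t assume t: "t \<in> {- S..T}"
    show "t \<in> J"
    proof (cases "0 \<le> t")
      case False
      then have "- t \<in> uminus ` J" using S(2) t by auto
      then show ?thesis by auto
    qed (use T t in auto)
  qed
  have inside: "norm (\<gamma> t) < 1" if "- S < t" "t < T" for t
    using T(4)[of t] S(4)[of "- t"] that by (cases "0 \<le> t") auto
  define K where "K = integral (ball 0 1) (\<lambda>p. \<bar>curl v p\<bar>)"
  have E: "integral {- S..T} (\<lambda>t. (norm (v (\<gamma> t)))\<^sup>2) \<le> c2 * pi + K"
    unfolding K_def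
    by (rule chord_energy_bound[OF C1 bound nz ic _ sub S(3) T(3) inside]) (use S(1) T(1) in auto)
  have in2: "\<gamma> t \<in> ball 0 2" if "t \<in> {- S..T}" for t using integral_curve_derivative(1)[OF ic] sub that by auto
  have "continuous_on {- S..T} \<gamma>"
    using integral_curve_derivative(2)[OF ic] sub
    by (meson continuous_on_eq_continuous_within has_vector_derivative_continuous in_mono)
  then have contn: "continuous_on {- S..T} (\<lambda>t. norm (v (\<gamma> t)))"
    using in2 by (intro continuous_on_norm continuous_on_compose2[OF contv]) auto
  have contn0: "continuous_on {0..T} (\<lambda>t. norm (v (\<gamma> t)))"
    using S by (intro continuous_on_subset[OF contn]) auto
  define len where "len = integral {0..T} (\<lambda>s. norm (v (\<gamma> s)))"
  \<comment> \<open>The lower speed bound trades one factor of the squared speed for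
    \<open>c1\<close>. Enlarging the interval to the whole chord only adds a nonnegative
    contribution.\<close>
  have "c1 * len = integral {0..T} (\<lambda>t. c1 * norm (v (\<gamma> t)))" by (simp add: len_def)
  also have "\<dots> \<le> integral {0..T} (\<lambda>t. (norm (v (\<gamma> t)))\<^sup>2)"
  proof (rule integral_le)
    fix t assume "t \<in> {0..T}"
    then have "c1 \<le> norm (v (\<gamma> t))" using speed[OF in2[of t]] S by auto
    then show "c1 * norm (v (\<gamma> t)) \<le> (norm (v (\<gamma> t)))\<^sup>2" by (simp add: power2_eq_square mult_right_mono)
  qed (intro integrable_continuous_real continuous_intros contn0)+
  also have "\<dots> \<le> integral {- S..T} (\<lambda>t. (norm (v (\<gamma> t)))\<^sup>2)"
    using S by (intro integral_subset_le integrable_continuous_real continuous_intros contn contn0) auto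
  finally have "c1 * len \<le> c2 * pi + K" using E by linarith
  then have "len \<le> (c2 * pi + K) / c1" using c by (simp add: le_divide_eq mult.commute)
  also have "\<dots> = pi * (c2 / c1) + 1 / c1 * K" by (simp add: add_divide_distrib)
  finally have le: "len \<le> pi * (c2 / c1) + 1 / c1 * K" .
  have "integral {0..T} (\<lambda>s. norm (vector_derivative \<gamma> (at s))) = len"
    unfolding len_def
  proof (rule integral_cong)
    fix s assume "s \<in> {0..T}"
    then have "s \<in> J" using T(2) by auto
    then show "norm (vector_derivative \<gamma> (at s)) = norm (v (\<gamma> s))"
      using vector_derivative_at[OF integral_curve_derivative(2)[OF ic, where A = UNIV]] by simp
  qed
  moreover have "T \<in> {t \<in> J. 0 < t \<and> norm (\<gamma> t) = 1}" using T by auto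
  ultimately show ?thesis
    unfolding K_def[symmetric] using le by (intro INF_lower2) auto
qed

end
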